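(* Let $G=(V,E)$ be a finite simple connected graph with $|V|=k\ge 2$, with distance matrix $D_G$ and blowup-polynomial $p_G(n_1,\dots,n_k)$. Define the homogenized blowup-polynomial $$\widetilde p_G(z_0,z_1,\dots,z_k):=(-z_0)^k\,p_G\!\left(\frac{z_1}{-z_0},\dots,\frac{z_k}{-z_0}\right)\in\mathbb{R}[z_0,z_1,\dots,z_k].$$ The following are equivalent. (1) The homogenized polynomial $\widetilde p_G(z_0,z_1,\dots,z_k)$ is real-stable. (2) The polynomial $\widetilde p_G(z_0,z_1,\dots,z_k)$ is Lorentzian. That is, $\widetilde p_G$ is homogeneous of degree $k$ with non-negative coefficients, and given indices $0\le j_1,\dots,j_{k-2}\le k$, if $$g(z_0,z_1,\dots,z_k):=\left(\partial_{z_{j_1}}\cdots\partial_{z_{j_{k-2}}}\widetilde p_G\right)(z_0,z_1,\dots,z_k),$$ then its Hessian matrix $\mathcal{H}_g:=(\partial_{z_i}\partial_{z_j}g)_{i,j=0}^k\in\mathbb{R}^{(k+1)\times(k+1)}$ is Lorentzian (i.e., $\mathcal{H}_g$ is nonsingular and has exactly one positive eigenvalue). (3) $\widetilde p_G$ has all coefficients non-negative (i.e., of the monomials $z_0^{k-|J|}\prod_{j\in J}z_j$, $J\subset\{1,\dots,k\}$). (4) $(-1)^k p_G(-1,\dots,-1)>0$, and the normalized "reflected" polynomial $$(z_1,\dots,z_k)\mapsto \frac{p_G(-z_1,\dots,-z_k)}{p_G(-1,\dots,-1)}$$ is strongly Rayleigh. That is, this multi-affine polynomial is real-stable, has non-negative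 coefficients (of all monomials $\prod_{j\in J}z_j$), and these sum up to $1$. (5) The matrix $M_G:=D_G+2\operatorname{Id}_k$ is positive semidefinite. (6) The graph $G$ is a blowup of a complete graph, that is, $G$ is a complete multipartite graph.
   Context: For a finite simple connected graph $H$, its distance matrix $D_H$ is the matrix indexed by $V(H)\times V(H)$ whose $(v,w)$ entry is the length of a shortest path from $v$ to $w$ if $v\ne w$, and $0$ if $v=w$. Given a finite simple connected graph $G=(V,E)$ with $|V|\ge 2$ and positive integers $\mathbf n=\{n_v: v\in V\}$, the blowup graph $G[\mathbf n]$ is the finite simple connected graph having $n_v$ copies of each vertex $v\in V$, in which a copy of $v$ is adjacent to a copy of $w$ if and only if $v\neq w$ and $(v,w)\in E$. The blowup-polynomial of $G$ is the unique polynomial $p_G(\mathbf n)\in\mathbb{Z}[\{n_v: v\in V\}]$ (it is known to exist, and to be multi-affine, i.e. of degree at most $1$ in each variable) such that $\det D_{G[\mathbf n]}=(-2)^{\sum_{v}(n_v-1)}p_G(\mathbf n)$ for all $\mathbf n\in\mathbb{Z}_{>0}^V$; here the $n_v$ are regarded as indeterminates, enumerated as $n_1,\dots,n_k$ with $k=|V|$. A polynomial $p(z_1,\dots,z_m)$ with real coefficients is real-stable if $p(z_1,\dots,z_m)\neq 0$ whenever $z_1,\dots,z_m\in\mathbb{C}$ satisfy $\operatorname{Im}(z_j)>0$ for all $j$.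
   Formalization: In (2), Lorentzian is taken in Brändén–Huh's sense: a limit of forms with all coefficients positive satisfying the displayed Hessian condition. Read literally, nonsingularity of H_g fails for every G with k≥3 (e.g. K_3), as p̃_G has degree at most 1 in each z_j, j≥1. *)

theory Defs
  imports
    Complex_Main
    "HOL-Library.Poly_Mapping"
    "HOL-Library.Disjoint_Sets"
    "Jordan_Normal_Form.Char_Poly"
begin

section \<open>Graphs, distance matrices and blowups\<close>

definition simple_connected_graph :: "'a set \<Rightarrow> ('a \<times> 'a) set \<Rightarrow> bool" where
  "simple_connected_graph V E \<longleftrightarrow>
     finite V \<and> V \<noteq> {} \<and> E \<subseteq> V \<times> V \<and> sym E \<and> irrefl E \<and>
     (\<forall>u\<in>V. \<forall>w\<in>V. (u, w) \<in> E\<^sup>*)"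

text \<open>\<open>E ^^ l\<close> relates the ends of walks of length \<open>l\<close>; a shortest walk is a shortest path.
  The value is \<open>0\<close> on the diagonal.\<close>

definition graph_dist :: "('a \<times> 'a) set \<Rightarrow> 'a \<Rightarrow> 'a \<Rightarrow> nat" where
  "graph_dist E v w = (LEAST l. (v, w) \<in> E ^^ l)"

text \<open>Matrices whose rows and columns are labelled by a finite set are taken with respect to a
  list enumerating that set without repetition.\<close>

definition indexed_mat :: "'a list \<Rightarrow> ('a \<Rightarrow> 'a \<Rightarrow> 'b) \<Rightarrow> 'b mat" where
  "indexed_mat xs f = mat (length xs) (length xs) (\<lambda>(i, j). f (xs ! i) (xs ! j))"

definition dist_mat :: "'a list \<Rightarrow> ('a \<times> 'a) set \<Rightarrow> 'b::comm_ring_1 mat" where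
  "dist_mat vs E = indexed_mat vs (\<lambda>v w. of_nat (graph_dist E v w))"

definition blowup_vertices :: "'a list \<Rightarrow> ('a \<Rightarrow> nat) \<Rightarrow> ('a \<times> nat) list" where
  "blowup_vertices vs n = concat (map (\<lambda>v. map (\<lambda>i. (v, i)) [0..<n v]) vs)"

definition blowup_edges ::
    "('a \<times> 'a) set \<Rightarrow> ('a \<Rightarrow> nat) \<Rightarrow> (('a \<times> nat) \<times> ('a \<times> nat)) set" where
  "blowup_edges E n =
     {((v, i), (w, j)) | v i w j. v \<noteq> w \<and> (v, w) \<in> E \<and> i < n v \<and> j < n w}"

definition graph_iso ::
    "'a set \<Rightarrow> ('a \<times> 'a) set \<Rightarrow> 'b set \<Rightarrow> ('b \<times> 'b) set \<Rightarrow> bool" where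
  "graph_iso V E V' E' \<longleftrightarrow>
     (\<exists>f. bij_betw f V V' \<and> (\<forall>u\<in>V. \<forall>w\<in>V. (u, w) \<in> E \<longleftrightarrow> (f u, f w) \<in> E'))"

definition complete_edges :: "nat \<Rightarrow> (nat \<times> nat) set" where
  "complete_edges r = {(i, j). i < r \<and> j < r \<and> i \<noteq> j}"

definition blowup_of_complete_graph :: "'a set \<Rightarrow> ('a \<times> 'a) set \<Rightarrow> bool" where
  "blowup_of_complete_graph V E \<longleftrightarrow>
     (\<exists>r n. 2 \<le> r \<and> (\<forall>i<r. 0 < n i) \<and>
        graph_iso V E (set (blowup_vertices [0..<r] n)) (blowup_edges (complete_edges r) n))"

definition complete_multipartite :: "'a set \<Rightarrow> ('a \<times> 'a) set \<Rightarrow> bool" where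
  "complete_multipartite V E \<longleftrightarrow>
     (\<exists>P. partition_on V P \<and>
        (\<forall>u\<in>V. \<forall>w\<in>V. (u, w) \<in> E \<longleftrightarrow> \<not> (\<exists>B\<in>P. u \<in> B \<and> w \<in> B)))"

section \<open>Multivariate polynomials\<close>

text \<open>Polynomials over \<open>'c\<close> in variables labelled by \<open>'v\<close>: a monomial is its finitely supported
  exponent function, a polynomial its finitely supported coefficient function. Addition and
  multiplication are those of \<^typ>\<open>('v \<Rightarrow>\<^sub>0 nat) \<Rightarrow>\<^sub>0 'c\<close> (the monoid algebra).\<close>

type_synonym ('v, 'c) mvpoly = "('v \<Rightarrow>\<^sub>0 nat) \<Rightarrow>\<^sub>0 'c"

abbreviation mcoeff :: "('v, 'c::zero) mvpoly \<Rightarrow> ('v \<Rightarrow>\<^sub>0 nat) \<Rightarrow> 'c" where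
  "mcoeff \<equiv> Poly_Mapping.lookup"

definition mconst :: "'c::zero \<Rightarrow> ('v, 'c) mvpoly" where
  "mconst c = Poly_Mapping.single 0 c"

definition mvar :: "'v \<Rightarrow> ('v, 'c::zero_neq_one) mvpoly" where
  "mvar v = Poly_Mapping.single (Poly_Mapping.single v 1) 1"

definition mvars :: "('v, 'c::zero) mvpoly \<Rightarrow> 'v set" where
  "mvars p = (\<Union>m\<in>Poly_Mapping.keys p. Poly_Mapping.keys m)"

definition mdegree :: "('v \<Rightarrow>\<^sub>0 nat) \<Rightarrow> nat" where
  "mdegree m = (\<Sum>v\<in>Poly_Mapping.keys m. Poly_Mapping.lookup m v)"

text \<open>Evaluation at \<open>z\<close> after mapping the coefficients by the embedding \<open>h\<close>. The target may itself
  be a polynomial ring, which gives substitution.\<close>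

definition meval ::
    "('c::zero \<Rightarrow> 'd::comm_semiring_1) \<Rightarrow> ('v \<Rightarrow> 'd) \<Rightarrow> ('v, 'c) mvpoly \<Rightarrow> 'd" where
  "meval h z p = (\<Sum>m\<in>Poly_Mapping.keys p.
     h (mcoeff p m) * (\<Prod>v\<in>Poly_Mapping.keys m. z v ^ Poly_Mapping.lookup m v))"

text \<open>Partial derivative. Where the subtraction of exponents truncates, the coefficient is \<open>0\<close>.\<close>

definition mpderiv :: "'v \<Rightarrow> ('v, 'c::comm_semiring_1) mvpoly \<Rightarrow> ('v, 'c) mvpoly" where
  "mpderiv v p = (\<Sum>m\<in>Poly_Mapping.keys p.
     Poly_Mapping.single (m - Poly_Mapping.single v 1)
       (of_nat (Poly_Mapping.lookup m v) * mcoeff p m))"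

definition mhomogeneous :: "nat \<Rightarrow> ('v, 'c::zero) mvpoly \<Rightarrow> bool" where
  "mhomogeneous d p \<longleftrightarrow> (\<forall>m. mcoeff p m \<noteq> 0 \<longrightarrow> mdegree m = d)"

definition multi_affine :: "('v, 'c::zero) mvpoly \<Rightarrow> bool" where
  "multi_affine p \<longleftrightarrow> (\<forall>m. mcoeff p m \<noteq> 0 \<longrightarrow> (\<forall>v. Poly_Mapping.lookup m v \<le> 1))"

definition nonneg_coeffs :: "('v, real) mvpoly \<Rightarrow> bool" where
  "nonneg_coeffs p \<longleftrightarrow> (\<forall>m. 0 \<le> mcoeff p m)"

text \<open>In the following notions \<open>X\<close> is the set, or a list enumerating the set, of indeterminates
  of the polynomial ring.\<close>

definition real_stable :: "'v set \<Rightarrow> ('v, real) mvpoly \<Rightarrow> bool" where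
  "real_stable X p \<longleftrightarrow> mvars p \<subseteq> X \<and>
     (\<forall>z. (\<forall>v\<in>X. 0 < Im (z v)) \<longrightarrow> meval complex_of_real z p \<noteq> 0)"

definition strongly_rayleigh :: "'v set \<Rightarrow> ('v, real) mvpoly \<Rightarrow> bool" where
  "strongly_rayleigh X p \<longleftrightarrow> multi_affine p \<and> real_stable X p \<and> nonneg_coeffs p \<and>
     (\<Sum>m\<in>Poly_Mapping.keys p. mcoeff p m) = 1"

section \<open>Lorentzian polynomials\<close>

text \<open>Nonsingular with exactly one positive eigenvalue, counted with multiplicity.\<close>

definition lorentzian_mat :: "real mat \<Rightarrow> bool" where
  "lorentzian_mat A \<longleftrightarrow> A\<^sup>T = A \<and> invertible_mat A \<and>
     (\<Sum>a\<in>{a. eigenvalue A a \<and> 0 < a}. Polynomial.order a (char_poly A)) = 1"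

text \<open>Only used for quadratic forms \<open>g\<close>, whose second derivatives are constant; these constants
  are read off as the coefficients of the trivial monomial.\<close>

definition hessian_mat :: "'v list \<Rightarrow> ('v, real) mvpoly \<Rightarrow> real mat" where
  "hessian_mat xs g = indexed_mat xs (\<lambda>u v. mcoeff (mpderiv u (mpderiv v g)) 0)"

text \<open>The definitions of Branden and Huh: strictly Lorentzian polynomials, and Lorentzian
  polynomials as their limits in the (finite-dimensional) space of forms of degree \<open>d \<ge> 2\<close>.
  The limit is essential. The Hessian condition with a nonsingular Hessian never holds for a form
  of degree \<open>d \<ge> 3\<close> of degree at most one in some variable \<open>z\<close>: differentiate first
  in \<open>z\<close>, then the row of \<open>z\<close> in the Hessian vanishes.
  Homogeneity and non-negativity in \<open>lorentzian\<close> are implied by the limit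
  and displayed for readability.\<close>

definition strictly_lorentzian :: "'v list \<Rightarrow> nat \<Rightarrow> ('v, real) mvpoly \<Rightarrow> bool" where
  "strictly_lorentzian xs d p \<longleftrightarrow>
     mvars p \<subseteq> set xs \<and> mhomogeneous d p \<and>
     (\<forall>m. Poly_Mapping.keys m \<subseteq> set xs \<and> mdegree m = d \<longrightarrow> 0 < mcoeff p m) \<and>
     (\<forall>js. set js \<subseteq> set xs \<and> length js = d - 2 \<longrightarrow>
        lorentzian_mat (hessian_mat xs (fold mpderiv js p)))"

definition lorentzian :: "'v list \<Rightarrow> nat \<Rightarrow> ('v, real) mvpoly \<Rightarrow> bool" where
  "lorentzian xs d p \<longleftrightarrow>
     mvars p \<subseteq> set xs \<and> mhomogeneous d p \<and> nonneg_coeffs p \<and>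
     (\<exists>q. (\<forall>i::nat. strictly_lorentzian xs d (q i)) \<and>
          (\<forall>m. (\<lambda>i. mcoeff (q i) m) \<longlonglongrightarrow> mcoeff p m))"

definition psd_mat :: "real mat \<Rightarrow> bool" where
  "psd_mat A \<longleftrightarrow> square_mat A \<and> A\<^sup>T = A \<and>
     (\<forall>x\<in>carrier_vec (dim_row A). 0 \<le> x \<bullet> (A *\<^sub>v x))"

section \<open>The blowup-polynomial\<close>

definition blowup_poly :: "'a list \<Rightarrow> ('a \<times> 'a) set \<Rightarrow> ('a, int) mvpoly" where
  "blowup_poly vs E = (THE p. mvars p \<subseteq> set vs \<and>
     (\<forall>n. (\<forall>v\<in>set vs. 0 < n v) \<longrightarrow>
        det (dist_mat (blowup_vertices vs n) (blowup_edges E n)) =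
          (-2) ^ (\<Sum>v\<in>set vs. n v - 1) * meval id (\<lambda>v. int (n v)) p))"

text \<open>The homogenizing variable \<open>z\<^sub>0\<close> is \<open>None\<close>, and the variable of the vertex \<open>v\<close> is \<open>Some v\<close>.
  The defining formula involves division by \<open>- z\<^sub>0\<close>, hence is imposed where \<open>z\<^sub>0 \<noteq> 0\<close>;
  this determines the polynomial.\<close>

definition homogenized_vars :: "'a list \<Rightarrow> 'a option list" where
  "homogenized_vars vs = None # map Some vs"

definition homogenized_blowup_poly ::
    "'a list \<Rightarrow> ('a \<times> 'a) set \<Rightarrow> ('a option, real) mvpoly" where
  "homogenized_blowup_poly vs E = (THE q. mvars q \<subseteq> set (homogenized_vars vs) \<and>
     (\<forall>z. z None \<noteq> 0 \<longrightarrow>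
        meval id z q =
          (- z None) ^ length vs *
          meval real_of_int (\<lambda>v. z (Some v) / (- z None)) (blowup_poly vs E)))"

definition blowup_poly_at_minus_one :: "'a list \<Rightarrow> ('a \<times> 'a) set \<Rightarrow> real" where
  "blowup_poly_at_minus_one vs E = meval real_of_int (\<lambda>_. -1) (blowup_poly vs E)"

definition reflected_blowup_poly ::
    "'a list \<Rightarrow> ('a \<times> 'a) set \<Rightarrow> ('a, real) mvpoly" where
  "reflected_blowup_poly vs E =
     mconst (1 / blowup_poly_at_minus_one vs E) *
     meval (\<lambda>c. mconst (real_of_int c)) (\<lambda>v. - mvar v) (blowup_poly vs E)"

definition tfae :: "bool list \<Rightarrow> bool" where
  "tfae Ps \<longleftrightarrow> (\<forall>P\<in>set Ps. \<forall>Q\<in>set Ps. P \<longleftrightarrow> Q)"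

end

theory Submission
  imports Defs "Jordan_Normal_Form.Schur_Decomposition"
begin

text \<open>Put \<open>M = D + 2 Id\<close>, where \<open>D\<close> is the distance matrix of \<open>G\<close>. Copies of one vertex have
  distance \<open>2\<close>, so the distance matrix of a blowup is \<open>W M W\<^sup>T - 2 Id\<close> with a matrix \<open>W\<close> of
  zeros and ones for which \<open>W\<^sup>T W = diag n\<close>. Sylvester's determinant identity gives \<open>p(n) = det
  (M diag n - 2 Id)\<close>, and the homogenized polynomial is \<open>det (2 z\<^sub>0 Id + M diag z)\<close>
  (\<open>blowup_poly_eq\<close>, \<open>homogenized_blowup_poly_eq\<close>). Every condition is shown to be equivalent to
  \<open>M\<close> being positive semidefinite.

  The polynomial conditions imply semidefiniteness because each of them excludes zeros of \<open>det
  (2 Id + s M)\<close> with \<open>s > 0\<close>: stability does so at purely imaginary points, nonnegative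
  coefficients at positive points. A symmetric pencil that starts at a positive definite matrix
  can lose positivity only at a singular matrix (\<open>psd_if_nonsingular_ray\<close>), so \<open>2 Id + s M\<close>
  remains positive semidefinite for all \<open>s\<close>, and \<open>M\<close> is positive semidefinite. Conversely, if
  \<open>M\<close> is positive semidefinite, a kernel vector of \<open>2 z\<^sub>0 Id + M diag z\<close> at a point of the upper
  half planes contradicts the reality and nonnegativity of the Hermitian form of \<open>M\<close>
  (\<open>det_pencil_nonzero\<close>). This gives the stability of the homogenized and of the reflected
  polynomial.

  The Lorentzian property, and with it the nonnegativity of all coefficients, is obtained by
  approximation (\<open>pencil_lorentzian\<close>). Adding \<open>\<delta> Id\<close> to \<open>M\<close> and \<open>\<delta>\<close> times the sum of all
  variables to each variable produces a form with two properties: it has no zero with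
  nonnegative imaginary parts that are not all zero, and it is not invariant under any
  translation. Partial derivatives inherit the first property by the theorem of Gauss and Lucas
  (\<open>strictly_stable_mpderiv\<close>), and the second, down to degree two, because adding unbounded
  constants to a polynomial of degree at least three destroys real-rootedness
  (\<open>lineality_free_mpderiv\<close>). For the quadratic form that remains, real-rootedness along lines
  is the reverse inequality of Cauchy and Schwarz, that is, the Hessian has one positive
  eigenvalue, and the absence of invariant directions says that the Hessian is nonsingular.

  Finally, \<open>M\<close> is positive semidefinite exactly for the complete multipartite graphs. Evaluating
  its quadratic form at \<open>e\<^sub>u - e\<^sub>v\<close> and at \<open>e\<^sub>u - 2 e\<^sub>v + e\<^sub>w\<close> shows that non-adjacency is
  transitive (\<open>complete_multipartite_if_psd\<close>); for a complete multipartite graph the form is a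
  sum of squares (\<open>psd_if_complete_multipartite\<close>).\<close>

section \<open>Evaluation of polynomials\<close>

abbreviation "keys \<equiv> Poly_Mapping.keys"
abbreviation "lookup \<equiv> Poly_Mapping.lookup"
abbreviation "single \<equiv> Poly_Mapping.single"

definition mono_eval :: "('v \<Rightarrow> 'd::comm_semiring_1) \<Rightarrow> ('v \<Rightarrow>\<^sub>0 nat) \<Rightarrow> 'd" where
  "mono_eval z m = (\<Prod>v\<in>keys m. z v ^ lookup m v)"

lemma mono_eval_superset:
  assumes "finite S" "keys m \<subseteq> S"
  shows "mono_eval z m = (\<Prod>v\<in>S. z v ^ lookup m v)"
  unfolding mono_eval_def using assms
  by (intro prod.mono_neutral_left) (auto simp: in_keys_iff)

lemma mono_eval_zero [simp]: "mono_eval z 0 = 1"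
  by (simp add: mono_eval_def)

lemma mono_eval_add: "mono_eval z (a + b) = mono_eval z a * mono_eval z b"
proof -
  let ?S = "keys a \<union> keys b"
  have "keys (a + b) \<subseteq> ?S" by (rule keys_add)
  then show ?thesis
    by (simp add: mono_eval_superset[of ?S] lookup_add power_add prod.distrib)
qed

lemma mono_eval_single [simp]: "mono_eval z (single v n) = z v ^ n"
  by (cases "n = 0") (auto simp: mono_eval_def)

lemma meval_superset:
  assumes "finite S" "keys p \<subseteq> S" "h 0 = 0"
  shows "meval h z p = (\<Sum>m\<in>S. h (mcoeff p m) * mono_eval z m)"
  unfolding meval_def mono_eval_def using assms
  by (intro sum.mono_neutral_left) (auto simp: in_keys_iff)

lemma meval_single:
  assumes "h 0 = 0"
  shows "meval h z (single m c) = h c * mono_eval z m"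
  using assms by (cases "c = 0") (auto simp: meval_def mono_eval_def)

lemma meval_add:
  assumes "h 0 = 0" "\<And>a b. h (a + b) = h a + h b"
  shows "meval h z (p + q) = meval h z p + meval h z q"
proof -
  let ?S = "keys p \<union> keys q"
  have "keys (p + q) \<subseteq> ?S" by (rule keys_add)
  with assms show ?thesis
    by (simp add: meval_superset[of ?S] lookup_add sum.distrib distrib_right)
qed

lemma meval_sum:
  assumes "h 0 = 0" "\<And>a b. h (a + b) = h a + h b"
  shows "meval h z (\<Sum>i\<in>I. p i) = (\<Sum>i\<in>I. meval h z (p i))"
proof (cases "finite I")
  case True
  then show ?thesis
    by (induction I rule: finite_induct) (simp_all add: meval_add[OF assms], simp add: meval_def)
next
  case False
  then show ?thesis by (simp add: meval_def)
qed

lemma mvpoly_sum_monomials: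
  "p = (\<Sum>m\<in>keys p. single m (mcoeff p m))"
  by (rule poly_mapping_eqI) (auto simp: lookup_sum lookup_single when_def in_keys_iff)

lemma mvpoly_mult_monomials:
  fixes p q :: "('v, 'c::comm_ring_1) mvpoly"
  shows "p * q = (\<Sum>m\<in>keys p. \<Sum>l\<in>keys q.
    single (m + l) (mcoeff p m * mcoeff q l))"
  by (subst (1) mvpoly_sum_monomials[of p], subst (1) mvpoly_sum_monomials[of q])
     (simp add: sum_product mult_single)

lemma meval_comm_ring_hom:
  assumes "comm_ring_hom h"
  shows "comm_ring_hom (meval h z)"
proof -
  interpret h: comm_ring_hom h by fact
  note add = meval_add[of h, OF h.hom_zero h.hom_add]
  note sum = meval_sum[of h, OF h.hom_zero h.hom_add]
  have mult: "meval h z (p * q) = meval h z p * meval h z q" for p q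
  proof -
    have "meval h z (p * q) = (\<Sum>m\<in>keys p. \<Sum>l\<in>keys q.
        (h (mcoeff p m) * mono_eval z m) * (h (mcoeff q l) * mono_eval z l))"
      by (simp add: mvpoly_mult_monomials sum meval_single mono_eval_add h.hom_mult algebra_simps)
    also have "\<dots> = meval h z p * meval h z q"
      by (simp add: sum_product meval_def mono_eval_def)
    finally show ?thesis .
  qed
  have one: "meval h z 1 = 1"
    using meval_single[of h z 0 1] by simp
  show ?thesis
    by unfold_locales (simp_all add: mult one add, simp add: meval_def)
qed

lemma meval_mvar [simp]: "h 0 = 0 \<Longrightarrow> h 1 = 1 \<Longrightarrow> meval h z (mvar v) = z v"
  by (simp add: mvar_def meval_single)

lemma meval_mconst [simp]: "h 0 = 0 \<Longrightarrow> meval h z (mconst c) = h c"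
  by (simp add: mconst_def meval_single)

text \<open>Evaluation commutes with ring homomorphisms of the target. Applied to evaluation of
  univariate polynomials, to complex conjugation and to the embedding of the reals, this relates
  the values of one polynomial at different kinds of points.\<close>

lemma comm_ring_hom_meval:
  assumes "comm_ring_hom g"
  shows "g (meval h z p) = meval (\<lambda>c. g (h c)) (\<lambda>v. g (z v)) p"
proof -
  interpret g: comm_ring_hom g by fact
  show ?thesis
    by (simp add: meval_def g.hom_sum g.hom_mult g.hom_prod g.hom_power)
qed

lemma comm_ring_hom_id: "comm_ring_hom id"
  by unfold_locales auto

lemma comm_ring_hom_of_real: "comm_ring_hom (of_real :: real \<Rightarrow> 'a::{real_algebra_1,comm_ring_1})"
  by unfold_locales auto

lemma comm_ring_hom_of_int: "comm_ring_hom (of_int :: int \<Rightarrow> 'a::comm_ring_1)"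
  by unfold_locales auto

lemma comm_ring_hom_pCons: "comm_ring_hom (\<lambda>c. [:c:])"
  by unfold_locales (auto simp: one_pCons)

lemma comm_ring_hom_mconst: "comm_ring_hom (mconst :: 'c::comm_ring_1 \<Rightarrow> ('v, 'c) mvpoly)"
  by unfold_locales (auto simp: mconst_def single_add mult_single)

lemma comm_ring_hom_comp:
  assumes "comm_ring_hom f" "comm_ring_hom g"
  shows "comm_ring_hom (\<lambda>x. f (g x))"
proof -
  interpret f: comm_ring_hom f by fact
  interpret g: comm_ring_hom g by fact
  show ?thesis by unfold_locales (auto simp: f.hom_add g.hom_add f.hom_mult g.hom_mult)
qed

lemma meval_of_real:
  "meval complex_of_real (\<lambda>v. complex_of_real (x v)) p = complex_of_real (meval id x p)"
  by (subst comm_ring_hom_meval[OF comm_ring_hom_of_real]) simp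

section \<open>Polynomials are determined by their values\<close>

lemma digits_inj:
  fixes a b :: "nat \<Rightarrow> nat"
  assumes "\<And>i. i < n \<Longrightarrow> a i < N" "\<And>i. i < n \<Longrightarrow> b i < N"
    and "(\<Sum>i<n. a i * N ^ i) = (\<Sum>i<n. b i * N ^ i)" "i < n"
  shows "a i = b i"
  using assms
proof (induction n arbitrary: a b i)
  case 0
  then show ?case by simp
next
  case (Suc n)
  have split: "(\<Sum>i<Suc n. c i * N ^ i) = c 0 + N * (\<Sum>i<n. c (Suc i) * N ^ i)" for c :: "nat \<Rightarrow> nat"
    by (simp add: sum.lessThan_Suc_shift sum_distrib_left mult.assoc mult.left_commute del:
        sum.lessThan_Suc)
  have eq: "a 0 + N * (\<Sum>i<n. a (Suc i) * N ^ i) = b 0 + N * (\<Sum>i<n. b (Suc i) * N ^ i)"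
    using Suc.prems(3) by (simp only: split)
  have lt: "a 0 < N" "b 0 < N" using Suc.prems by auto
  have a0: "a 0 = b 0"
    using arg_cong[OF eq, of "\<lambda>x. x mod N"] lt by simp
  moreover have "(\<Sum>i<n. a (Suc i) * N ^ i) = (\<Sum>i<n. b (Suc i) * N ^ i)"
    using eq a0 lt by auto
  from Suc.IH[OF _ _ this, of "i - 1"] Suc.prems have "i \<noteq> 0 \<Longrightarrow> a (Suc (i - 1)) = b (Suc (i - 1))"
    by auto
  ultimately show ?case by (cases i) auto
qed

text \<open>Kronecker substitution: replacing the \<open>i\<close>-th variable by \<open>t ^ (N ^ i)\<close>, with \<open>N\<close> larger
  than every exponent, sends distinct monomials to distinct powers of \<open>t\<close>. The resulting
  univariate polynomial has the same coefficients, and it vanishes at every positive integer.\<close>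

lemma mvpoly_eq_0_if_vanishing:
  fixes p :: "('v, 'c::{idom,ring_char_0}) mvpoly"
  assumes van: "\<And>n::'v \<Rightarrow> nat. (\<And>v. 0 < n v) \<Longrightarrow> meval id (\<lambda>v. of_nat (n v)) p = 0"
  shows "p = 0"
proof -
  have "finite (mvars p)" by (simp add: mvars_def)
  then obtain xs where xs: "distinct xs" "set xs = mvars p"
    using finite_distinct_list by blast
  define l where "l = length xs"
  define N where "N = Suc (Max (insert 0 (\<Union>m\<in>keys p. lookup m ` mvars p)))"
  define idx where "idx v = (THE i. i < l \<and> xs ! i = v)" for v
  have idx: "idx (xs ! i) = i" if "i < l" for i
    unfolding idx_def by (rule the_equality) (use that xs in \<open>auto simp: l_def nth_eq_iff_index_eq\<close>)
  define e where "e v = N ^ idx v" for v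
  define W where "W m = (\<Sum>v\<in>mvars p. lookup m v * e v)" for m
  have Wsum: "W m = (\<Sum>i<l. lookup m (xs ! i) * N ^ i)" for m
  proof -
    have "W m = (\<Sum>v\<leftarrow>xs. lookup m v * e v)"
      unfolding W_def xs(2)[symmetric] by (rule sum_list_distinct_conv_sum_set[symmetric, OF xs(1)])
    also have "\<dots> = (\<Sum>i<l. lookup m (xs ! i) * N ^ i)"
      by (simp add: sum_list_sum_nth l_def atLeast0LessThan e_def idx)
    finally show ?thesis .
  qed
  have small: "lookup m v < N" if "m \<in> keys p" "v \<in> mvars p" for m v
    unfolding N_def less_Suc_eq_le by (rule Max_ge) (use that in \<open>auto simp: mvars_def\<close>)
  have inj: "inj_on W (keys p)"
  proof (rule inj_onI)
    fix a b assume ab: "a \<in> keys p" "b \<in> keys p" "W a = W b"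
    have on: "lookup a (xs ! i) = lookup b (xs ! i)" if "i < l" for i
      by (rule digits_inj[of l _ N _ i])
         (use ab that small xs in \<open>auto simp: Wsum l_def intro!: small\<close>)
    show "a = b"
    proof (rule poly_mapping_eqI)
      fix v
      show "lookup a v = lookup b v"
      proof (cases "v \<in> mvars p")
        case True
        then show ?thesis using on xs by (metis in_set_conv_nth l_def)
      next
        case False
        then have "v \<notin> keys a" "v \<notin> keys b"
          using ab by (auto simp: mvars_def)
        then show ?thesis by (simp add: in_keys_iff)
      qed
    qed
  qed
  define q :: "'c poly" where "q = (\<Sum>m\<in>keys p. monom (mcoeff p m) (W m))"
  have mono: "mono_eval (\<lambda>v. t ^ e v) m = t ^ W m" if "m \<in> keys p" for m and t :: 'c
  proof -
    have "mono_eval (\<lambda>v. t ^ e v) m = (\<Prod>v\<in>mvars p. (t ^ e v) ^ lookup m v)"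
      using that xs by (intro mono_eval_superset) (auto simp: mvars_def)
    also have "\<dots> = (\<Prod>v\<in>mvars p. t ^ (lookup m v * e v))"
      by (simp add: power_mult[symmetric] mult.commute)
    also have "\<dots> = t ^ W m" by (simp add: W_def power_sum)
    finally show ?thesis .
  qed
  have "poly q (of_nat (Suc t)) = 0" for t
  proof -
    have "poly q (of_nat (Suc t)) = meval id (\<lambda>v. of_nat (Suc t) ^ e v) p"
      by (simp add: q_def poly_sum poly_monom meval_def mono_eval_def[symmetric] mono del:
          of_nat_Suc)
    also have "\<dots> = meval id (\<lambda>v. of_nat (Suc t ^ e v)) p" by (simp del: of_nat_Suc)
    also have "\<dots> = 0" by (rule van) simp
    finally show ?thesis .
  qed
  then have "range (\<lambda>t. of_nat (Suc t)) \<subseteq> {x. poly q x = 0}" by auto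
  moreover have "infinite (range (\<lambda>t. of_nat (Suc t) :: 'c))"
    by (rule range_inj_infinite) (auto simp: inj_def simp del: of_nat_Suc)
  ultimately have "q = 0" using poly_roots_finite finite_subset by metis
  show ?thesis
  proof (rule poly_mapping_eqI)
    fix m
    show "mcoeff p m = mcoeff 0 m"
    proof (cases "m \<in> keys p")
      case True
      have "coeff q (W m) = (\<Sum>m'\<in>keys p. if m' = m then mcoeff p m else 0)"
        unfolding q_def coeff_sum coeff_monom
        by (intro sum.cong) (use True inj in \<open>auto dest: inj_onD\<close>)
      also have "\<dots> = mcoeff p m" using True by simp
      finally show ?thesis using \<open>q = 0\<close> by simp
    qed (simp add: in_keys_iff)
  qed
qed

text \<open>This makes the definite descriptions of the blowup-polynomial and of its homogenization
  meaningful: each prescribes the values at all points with positive integer coordinates.\<close>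

lemma mvpoly_eqI:
  fixes p q :: "('v, 'c::{idom,ring_char_0}) mvpoly"
  assumes "\<And>n::'v \<Rightarrow> nat. (\<And>v. 0 < n v) \<Longrightarrow>
    meval id (\<lambda>v. of_nat (n v)) p = meval id (\<lambda>v. of_nat (n v)) q"
  shows "p = q"
proof -
  have "meval id (\<lambda>v. of_nat (n v)) (p - q) = 0" if "\<And>v. 0 < n v" for n :: "'v \<Rightarrow> nat"
  proof -
    interpret comm_ring_hom "meval id (\<lambda>v. of_nat (n v)) :: ('v,'c) mvpoly \<Rightarrow> 'c"
      by (intro meval_comm_ring_hom comm_ring_hom_id)
    show ?thesis using assms[of n] that by (simp add: hom_minus)
  qed
  from mvpoly_eq_0_if_vanishing[OF this] show ?thesis by simp
qed

section \<open>Partial derivatives\<close>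

text \<open>Coefficientwise description, in which the truncated subtraction of exponents no longer
  occurs.\<close>

lemma lookup_mpderiv:
  "mcoeff (mpderiv v p) m =
     of_nat (lookup m v + 1) * mcoeff p (m + single v 1)"
proof -
  let ?e = "single v (1::nat)"
  have eq: "(of_nat (lookup m' v) * mcoeff p m' when m' - ?e = m) =
      (if m' = m + ?e then of_nat (lookup m v + 1) * mcoeff p (m + ?e) else 0)" for m'
  proof (cases "m' = m + ?e")
    case True
    then show ?thesis by (simp add: lookup_add)
  next
    case False
    show ?thesis
    proof (cases "lookup m' v = 0")
      case True
      then show ?thesis using False by (simp add: when_def)
    next
      case False
      have "m' - ?e + ?e = m'"
        by (rule poly_mapping_eqI) (use False in \<open>auto simp: lookup_add lookup_minus
            lookup_single when_def\<close>)
      then have "m' - ?e \<noteq> m" using \<open>m' \<noteq> m + ?e\<close> by auto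
      then show ?thesis using \<open>m' \<noteq> m + ?e\<close> by (simp add: when_def)
    qed
  qed
  have "mcoeff (mpderiv v p) m = (\<Sum>m'\<in>keys p.
      if m' = m + ?e then of_nat (lookup m v + 1) * mcoeff p (m + ?e) else 0)"
    by (simp only: mpderiv_def lookup_sum lookup_single eq)
  also have "\<dots> = of_nat (lookup m v + 1) * mcoeff p (m + ?e)"
    by (simp add: in_keys_iff)
  finally show ?thesis .
qed

lemma mpderiv_commute: "mpderiv u (mpderiv v p) = mpderiv v (mpderiv u p)"
  by (rule poly_mapping_eqI)
     (auto simp: lookup_mpderiv lookup_add lookup_single when_def algebra_simps)

lemma keys_mpderiv:
  assumes "m \<in> keys (mpderiv v p)"
  shows "m + single v 1 \<in> keys p"
  using assms by (auto simp: in_keys_iff lookup_mpderiv)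

lemma mvars_subsetI:
  assumes "\<And>m. m \<in> keys p \<Longrightarrow> keys m \<subseteq> X"
  shows "mvars p \<subseteq> X"
  using assms by (auto simp: mvars_def)

lemma mvars_subsetD:
  assumes "mvars p \<subseteq> X" "m \<in> keys p"
  shows "keys m \<subseteq> X"
  using assms by (auto simp: mvars_def)

lemma keys_add_nat:
  fixes a b :: "'v \<Rightarrow>\<^sub>0 nat"
  shows "keys (a + b) = keys a \<union> keys b"
  by (auto simp: in_keys_iff lookup_add)

lemma mvars_mpderiv: "mvars (mpderiv v p) \<subseteq> mvars p"
proof (rule mvars_subsetI)
  fix m assume "m \<in> keys (mpderiv v p)"
  from mvars_subsetD[OF order.refl keys_mpderiv[OF this]]
  show "keys m \<subseteq> mvars p" by (simp add: keys_add_nat)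
qed

lemma mdegree_superset:
  assumes "finite S" "keys m \<subseteq> S"
  shows "mdegree m = (\<Sum>v\<in>S. lookup m v)"
  unfolding mdegree_def using assms
  by (intro sum.mono_neutral_left) (auto simp: in_keys_iff)

lemma mdegree_add: "mdegree (a + b) = mdegree a + mdegree b"
  by (simp add: mdegree_superset[of "keys a \<union> keys b"]
      keys_add_nat lookup_add sum.distrib)

lemma mdegree_zero [simp]: "mdegree 0 = 0"
  by (simp add: mdegree_def)

lemma mdegree_single [simp]: "mdegree (single v n) = n"
  by (cases "n = 0") (simp_all add: mdegree_def)

lemma mdegree_eq_0_iff [simp]: "mdegree m = 0 \<longleftrightarrow> m = 0"
proof
  assume "mdegree m = 0"
  then have "\<forall>v\<in>keys m. lookup m v = 0" by (simp add: mdegree_def)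
  then show "m = 0" by (intro poly_mapping_eqI) (metis lookup_zero in_keys_iff)
qed simp

lemma mhomogeneous_mpderiv:
  assumes "mhomogeneous d p"
  shows "mhomogeneous (d - 1) (mpderiv v p)"
  unfolding mhomogeneous_def
proof (intro allI impI)
  fix m
  assume "mcoeff (mpderiv v p) m \<noteq> 0"
  then have "mcoeff p (m + single v 1) \<noteq> 0" by (auto simp: lookup_mpderiv)
  with assms have "mdegree (m + single v 1) = d" by (auto simp: mhomogeneous_def)
  then show "mdegree m = d - 1" by (auto simp: mdegree_add)
qed

lemma meval_scale:
  assumes "mhomogeneous d p" "h 0 = 0"
  shows "meval h (\<lambda>v. c * z v) p = c ^ d * meval h z p"
proof -
  have "mono_eval (\<lambda>v. c * z v) m = c ^ mdegree m * mono_eval z m" for m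
    by (simp add: mono_eval_def mdegree_def power_mult_distrib prod.distrib power_sum)
  moreover have "mdegree m = d" if "m \<in> keys p" for m
    using assms that by (auto simp: mhomogeneous_def in_keys_iff)
  ultimately show ?thesis
    unfolding meval_def mono_eval_def[symmetric] by (simp add: sum_distrib_left algebra_simps)
qed

lemma meval_homogeneous_0:
  assumes "mhomogeneous 0 p" "h 0 = 0"
  shows "meval h z p = h (mcoeff p 0)"
proof -
  have "keys p \<subseteq> {0}"
    using assms(1) by (auto simp: mhomogeneous_def in_keys_iff)
  then show ?thesis by (subst meval_superset[of "{0}"]) (use assms in auto)
qed

lemma euler_homogeneous:
  fixes p :: "('v, real) mvpoly"
  assumes "mhomogeneous d p" "mvars p \<subseteq> X" "finite X"
  shows "(\<Sum>v\<in>X. z v * meval id z (mpderiv v p)) = real d * meval id z p"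
proof -
  have mono: "z v * (real (lookup m v) * mono_eval z (m - single v 1)) =
      real (lookup m v) * mono_eval z m" for v m
  proof (cases "lookup m v = 0")
    case False
    have "m = single v 1 + (m - single v 1)"
      by (rule poly_mapping_eqI) (use False in \<open>auto simp: lookup_add lookup_minus lookup_single
          when_def\<close>)
    then have "mono_eval z m = z v * mono_eval z (m - single v 1)"
      by (metis mono_eval_add mono_eval_single power_one_right)
    then show ?thesis by simp
  qed simp
  have deg: "(\<Sum>v\<in>X. real (lookup m v)) = real d" if "m \<in> keys p" for m
  proof -
    have "mdegree m = d" using assms that by (auto simp: mhomogeneous_def in_keys_iff)
    moreover have "mdegree m = (\<Sum>v\<in>X. lookup m v)"
      using assms that by (intro mdegree_superset) (auto simp: mvars_def)
    ultimately show ?thesis by (metis of_nat_sum)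
  qed
  have "meval id z (mpderiv v p) = (\<Sum>m\<in>keys p.
      mcoeff p m * (real (lookup m v) * mono_eval z (m - single v 1)))" for v
    unfolding mpderiv_def by (simp add: meval_sum meval_single algebra_simps)
  then have "(\<Sum>v\<in>X. z v * meval id z (mpderiv v p)) = (\<Sum>v\<in>X. \<Sum>m\<in>keys p.
      mcoeff p m * (z v * (real (lookup m v) * mono_eval z (m - single v 1))))"
    by (simp add: sum_distrib_left algebra_simps)
  also have "\<dots> = (\<Sum>m\<in>keys p. mcoeff p m * mono_eval z m * (\<Sum>v\<in>X. real (lookup m v)))"
    by (subst sum.swap) (simp only: mono sum_distrib_left mult_ac)
  also have "\<dots> = real d * meval id z p"
    by (simp add: deg meval_def mono_eval_def[symmetric] sum_distrib_left algebra_simps)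
  finally show ?thesis .
qed

section \<open>Restriction of polynomials to lines\<close>

text \<open>The univariate polynomial whose value at \<open>t\<close> is the value of \<open>p\<close> at \<open>y + t x\<close>. It is again
  an evaluation, at linear polynomials in \<open>t\<close>, so it inherits the homomorphism properties of
  \<open>meval\<close>.\<close>

definition line_poly :: "('c \<Rightarrow> 'd::comm_ring_1) \<Rightarrow> ('v \<Rightarrow> 'd) \<Rightarrow> ('v \<Rightarrow> 'd) \<Rightarrow>
    ('v, 'c::comm_ring_1) mvpoly \<Rightarrow> 'd poly" where
  "line_poly h y x p = meval (\<lambda>c. [:h c:]) (\<lambda>v. [:y v, x v:]) p"

lemma poly_line_poly: "poly (line_poly h y x p) t = meval h (\<lambda>v. y v + t * x v) p"
  unfolding line_poly_def
  by (subst comm_ring_hom_meval[of "\<lambda>q. poly q t"]) (unfold_locales, simp_all)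

lemma coeff_mult_le:
  fixes p q :: "'a::comm_semiring_0 poly"
  assumes "degree p \<le> a" "degree q \<le> b"
  shows "coeff (p * q) (a + b) = coeff p a * coeff q b"
proof -
  have "coeff p i * coeff q (a + b - i) = (if i = a then coeff p a * coeff q b else 0)" if "i \<le>
      a + b" for i
  proof (cases "i = a")
    case False
    then consider "i > a" | "a + b - i > b" using \<open>i \<le> a + b\<close> by linarith
    then show ?thesis using False assms by cases (auto simp: coeff_eq_0)
  qed simp
  then have "coeff (p * q) (a + b) = (\<Sum>i\<le>a + b. if i = a then coeff p a * coeff q b else 0)"
    unfolding coeff_mult by (intro sum.cong) auto
  also have "\<dots> = coeff p a * coeff q b" by simp
  finally show ?thesis .
qed

lemma linear_power_top:
  fixes y x :: "'d::comm_ring_1"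
  shows "degree ([:y, x:] ^ n) \<le> n \<and> coeff ([:y, x:] ^ n) n = x ^ n"
proof (induction n)
  case (Suc n)
  have "degree [:y, x:] \<le> 1" by simp
  moreover from this Suc have "degree ([:y, x:] * [:y, x:] ^ n) \<le> 1 + n"
    using degree_mult_le[of "[:y, x:]" "[:y, x:] ^ n"] by linarith
  ultimately show ?case
    using coeff_mult_le[of "[:y, x:]" 1 "[:y, x:] ^ n" n] Suc by simp
qed simp

lemma mono_eval_line_top:
  fixes y x :: "'v \<Rightarrow> 'd::comm_ring_1"
  shows "degree (mono_eval (\<lambda>v. [:y v, x v:]) m) \<le> mdegree m \<and>
    coeff (mono_eval (\<lambda>v. [:y v, x v:]) m) (mdegree m) = mono_eval x m"
proof -
  have "degree (\<Prod>v\<in>S. [:y v, x v:] ^ f v) \<le> (\<Sum>v\<in>S. f v) \<and>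
      coeff (\<Prod>v\<in>S. [:y v, x v:] ^ f v) (\<Sum>v\<in>S. f v) = (\<Prod>v\<in>S. x v ^ f v)"
    if "finite S" for S and f :: "'v \<Rightarrow> nat"
    using that
  proof induction
    case (insert u S)
    let ?A = "[:y u, x u:] ^ f u" and ?B = "\<Prod>v\<in>S. [:y v, x v:] ^ f v"
    have "degree (?A * ?B) \<le> f u + (\<Sum>v\<in>S. f v)"
      using degree_mult_le[of ?A ?B] insert linear_power_top[of "y u" "x u" "f u"] by linarith
    moreover have "coeff (?A * ?B) (f u + (\<Sum>v\<in>S. f v)) = coeff ?A (f u) * coeff ?B (\<Sum>v\<in>S. f v)"
      by (rule coeff_mult_le) (use insert linear_power_top[of "y u" "x u" "f u"] in auto)
    ultimately show ?case using insert linear_power_top[of "y u" "x u" "f u"] by simp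
  qed simp
  then show ?thesis by (simp add: mono_eval_def mdegree_def)
qed

text \<open>For a form of degree \<open>d\<close> the coefficient of \<open>t ^ d\<close> depends on the direction only.
  Stability makes it non-zero, and this fixes the degree of the restriction.\<close>

lemma line_poly_top:
  assumes "mhomogeneous d p" "h 0 = 0"
  shows "degree (line_poly h y x p) \<le> d" "coeff (line_poly h y x p) d = meval h x p"
proof -
  have deg: "mdegree m = d" if "m \<in> keys p" for m
    using assms that by (auto simp: mhomogeneous_def in_keys_iff)
  have eq: "line_poly h y x p = (\<Sum>m\<in>keys p. Polynomial.smult (h (mcoeff p m)) (mono_eval (\<lambda>v.
      [:y v, x v:]) m))"
    by (simp add: line_poly_def meval_def mono_eval_def)
  show "degree (line_poly h y x p) \<le> d"
    unfolding eq
  proof (rule degree_sum_le)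
    fix m assume "m \<in> keys p"
    then show "degree (Polynomial.smult (h (mcoeff p m)) (mono_eval (\<lambda>v. [:y v, x v:]) m)) \<le> d"
      using degree_smult_le mono_eval_line_top[of y x m] deg le_trans by metis
  qed simp
  have "coeff (mono_eval (\<lambda>v. [:y v, x v:]) m) d = mono_eval x m" if "m \<in> keys p" for m
    using mono_eval_line_top[of y x m] deg[OF that] by simp
  then show "coeff (line_poly h y x p) d = meval h x p"
    by (simp add: eq coeff_sum meval_def mono_eval_def)
qed

lemma pderiv_line_poly:
  fixes p :: "('v, 'c::comm_ring_1) mvpoly" and h :: "'c \<Rightarrow> 'd::idom"
  assumes "comm_ring_hom h"
  shows "pderiv (line_poly h y (\<lambda>u. if u = v then 1 else 0) p) =
    line_poly h y (\<lambda>u. if u = v then 1 else 0) (mpderiv v p)"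
proof -
  interpret h: comm_ring_hom h by fact
  let ?Z = "\<lambda>u. [:y u, if u = v then 1 else 0:] :: 'd poly"
  have mono: "pderiv (mono_eval ?Z m) =
      of_nat (lookup m v) * mono_eval ?Z (m - single v 1)" for m
  proof -
    define a where "a = lookup m v"
    define m' where "m' = m - single v a"
    have lk: "lookup m' v = 0" by (simp add: m'_def lookup_minus a_def)
    have m: "m = m' + single v a"
      by (rule poly_mapping_eqI) (auto simp: m'_def a_def lookup_add lookup_minus lookup_single
          when_def)
    have const: "mono_eval ?Z m' = [:mono_eval y m':]"
    proof -
      interpret c: comm_ring_hom "\<lambda>c::'d. [:c:]" by (rule comm_ring_hom_pCons)
      have "mono_eval ?Z m' = (\<Prod>u\<in>keys m'. [:y u:] ^ lookup m' u)"
        unfolding mono_eval_def by (intro prod.cong refl) (use lk in \<open>auto simp: in_keys_iff\<close>)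
      also have "\<dots> = [:mono_eval y m':]" by (simp add: mono_eval_def c.hom_prod c.hom_power)
      finally show ?thesis .
    qed
    show ?thesis
    proof (cases a)
      case 0
      then have "m = m'" using m by simp
      then show ?thesis using const 0 lk by (simp add: pderiv_pCons)
    next
      case (Suc b)
      have m1: "m - single v 1 = m' + single v b"
        by (rule poly_mapping_eqI) (auto simp: m lookup_add lookup_minus lookup_single when_def Suc)
      have pd1: "pderiv [:y v, 1:] = 1" by (simp add: pderiv_pCons one_pCons)
      have "mono_eval ?Z m = [:mono_eval y m':] * [:y v, 1:] ^ a"
        by (subst m) (simp add: mono_eval_add const)
      then have "pderiv (mono_eval ?Z m) = [:mono_eval y m':] * pderiv ([:y v, 1:] ^ Suc b)"
        by (simp add: pderiv_smult Suc del: power_Suc)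
      also have "\<dots> = of_nat a * ([:mono_eval y m':] * [:y v, 1:] ^ b)"
        using pderiv_power_Suc[of "[:y v, 1:]" b] by (simp only: pd1 Suc) (simp add: of_nat_poly
            mult.commute del: power_Suc)
      also have "\<dots> = of_nat a * mono_eval ?Z (m - single v 1)"
        by (simp only: m1 mono_eval_add const mono_eval_single) simp
      finally show ?thesis by (simp add: a_def)
    qed
  qed
  let ?H = "\<lambda>c. [:h c:]"
  have H: "?H 0 = 0" "\<And>a b. ?H (a + b) = ?H a + ?H b" by (auto simp: h.hom_add)
  have "pderiv (line_poly h y (\<lambda>u. if u = v then 1 else 0) p) =
      (\<Sum>m\<in>keys p. pderiv ([:h (mcoeff p m):] * mono_eval ?Z m))"
    by (simp add: line_poly_def meval_def mono_eval_def[symmetric] pderiv_sum del: mult_pCons_left)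
  also have "\<dots> = (\<Sum>m\<in>keys p. [:h (of_nat (lookup m v) * mcoeff p m):] *
      mono_eval ?Z (m - single v 1))"
    by (intro sum.cong refl)
       (simp add: pderiv_smult mono h.hom_mult h.hom_of_nat of_nat_poly mult.commute)
  also have "\<dots> = line_poly h y (\<lambda>u. if u = v then 1 else 0) (mpderiv v p)"
    unfolding mpderiv_def line_poly_def by (simp add: meval_sum[OF H] meval_single del:
        mult_pCons_left)
  finally show ?thesis .
qed

section \<open>Monomials occurring in determinants\<close>

text \<open>One induction serves for all bounds on monomials: the set of occurring variables, the
  total degree and the degree in one variable are all relations \<open>R\<close> that are additive in this
  sense.\<close>

lemma keys_prod_graded:
  fixes p :: "'i \<Rightarrow> ('v, 'c::comm_ring_1) mvpoly" and R :: "nat \<Rightarrow> ('v \<Rightarrow>\<^sub>0 nat) \<Rightarrow> bool"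
  assumes R0: "R 0 0" and Radd: "\<And>a b m n. R a m \<Longrightarrow> R b n \<Longrightarrow> R (a + b) (m + n)"
    and p: "\<And>i m. i \<in> I \<Longrightarrow> m \<in> keys (p i) \<Longrightarrow> R (d i) m"
    and "finite I" "m \<in> keys (\<Prod>i\<in>I. p i)"
  shows "R (\<Sum>i\<in>I. d i) m"
  using assms(4,5) p
proof (induction I arbitrary: m rule: finite_induct)
  case empty
  then show ?case by (auto simp: R0)
next
  case (insert i I)
  from insert.prems(1) insert.hyps have "m \<in> keys (p i * (\<Prod>i\<in>I. p i))" by simp
  then obtain a b where "m = a + b" "a \<in> keys (p i)" "b \<in> keys (\<Prod>i\<in>I. p i)"
    using keys_mult by blast
  then show ?case using insert Radd[of "d i" a "\<Sum>i\<in>I. d i" b] by simp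
qed

text \<open>By the Leibniz formula, since each product takes one entry from every column; the bound
  \<open>d\<close> therefore only has to be given column by column.\<close>

lemma keys_det_graded:
  fixes A :: "('v, 'c::comm_ring_1) mvpoly mat" and R :: "nat \<Rightarrow> ('v \<Rightarrow>\<^sub>0 nat) \<Rightarrow> bool"
  assumes R0: "R 0 0" and Radd: "\<And>a b m n. R a m \<Longrightarrow> R b n \<Longrightarrow> R (a + b) (m + n)"
    and A: "A \<in> carrier_mat k k"
    and Ak: "\<And>i j m. i < k \<Longrightarrow> j < k \<Longrightarrow> m \<in> keys (A $$ (i, j)) \<Longrightarrow> R (d j) m"
    and m: "m \<in> keys (det A)"
  shows "R (\<Sum>j<k. d j) m"
proof -
  have "mcoeff (det A) m \<noteq> 0" using m by (simp add: in_keys_iff)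
  then have "(\<Sum>p\<in>{p. p permutes {0..<k}}. mcoeff (signof p * (\<Prod>i = 0..<k. A $$ (i, p i))) m) \<noteq> 0"
    by (simp add: det_def'[OF A] lookup_sum)
  then obtain p where p: "p permutes {0..<k}"
    "mcoeff (signof p * (\<Prod>i = 0..<k. A $$ (i, p i))) m \<noteq> 0"
    by (metis (mono_tags, lifting) sum.not_neutral_contains_not_neutral mem_Collect_eq)
  then have "m \<in> keys (\<Prod>i = 0..<k. A $$ (i, p i))"
    by (cases p rule: sign_cases) (auto simp: in_keys_iff)
  then have "R (\<Sum>i = 0..<k. d (p i)) m"
  proof (intro keys_prod_graded[where R = R, OF R0 Radd])
    fix i l
    assume "i \<in> {0..<k}" "l \<in> keys (A $$ (i, p i))"
    moreover have "p i \<in> {0..<k}" using permutes_in_image[OF p(1)] \<open>i \<in> {0..<k}\<close> by blast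
    ultimately show "R (d (p i)) l" by (intro Ak) auto
  next
    show "m \<in> keys (\<Prod>i = 0..<k. A $$ (i, p i))" by fact
  qed simp_all
  moreover have "(\<Sum>i = 0..<k. d (p i)) = (\<Sum>j<k. d j)"
    using sum.permute[OF p(1), of d] by (simp add: atLeast0LessThan o_def)
  ultimately show ?thesis by simp
qed

section \<open>Polynomials with nonnegative coefficients\<close>

lemma nonneg_coeffs_sum: "(\<And>i. i \<in> I \<Longrightarrow> nonneg_coeffs (p i)) \<Longrightarrow> nonneg_coeffs (\<Sum>i\<in>I. p i)"
  by (auto simp: nonneg_coeffs_def lookup_sum intro!: sum_nonneg)

lemma nonneg_coeffs_single: "0 \<le> c \<Longrightarrow> nonneg_coeffs (single m c)"
  by (auto simp: nonneg_coeffs_def lookup_single when_def)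

lemma nonneg_coeffs_mult:
  assumes "nonneg_coeffs p" "nonneg_coeffs q"
  shows "nonneg_coeffs (p * q)"
  unfolding mvpoly_mult_monomials[of p q]
  by (intro nonneg_coeffs_sum nonneg_coeffs_single) (use assms in \<open>auto simp: nonneg_coeffs_def\<close>)

lemma nonneg_coeffs_prod: "(\<And>i. i \<in> I \<Longrightarrow> nonneg_coeffs (p i)) \<Longrightarrow> nonneg_coeffs (\<Prod>i\<in>I. p i)"
proof (induction I rule: infinite_finite_induct)
  case (insert i I)
  then show ?case by (simp add: nonneg_coeffs_mult)
qed (auto simp: nonneg_coeffs_def lookup_one when_def)

lemma nonneg_coeffs_power: "nonneg_coeffs p \<Longrightarrow> nonneg_coeffs (p ^ n)"
  using nonneg_coeffs_prod[of "{..<n}" "\<lambda>_. p"] by simp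

text \<open>Used to set the homogenizing variable to \<open>1\<close>.\<close>

lemma nonneg_coeffs_subst:
  assumes "nonneg_coeffs p" "\<And>v. nonneg_coeffs (s v)"
  shows "nonneg_coeffs (meval mconst s p)"
proof -
  have "nonneg_coeffs (mconst (mcoeff p m))" for m
    using assms(1) unfolding mconst_def nonneg_coeffs_def
    by (simp add: lookup_single when_def)
  moreover have "nonneg_coeffs (\<Prod>v\<in>keys m. s v ^ lookup m v)" for m
    by (rule nonneg_coeffs_prod) (rule nonneg_coeffs_power[OF assms(2)])
  ultimately show ?thesis
    unfolding meval_def by (blast intro!: nonneg_coeffs_sum nonneg_coeffs_mult)
qed

lemma meval_pos_if_nonneg_coeffs:
  assumes "nonneg_coeffs p" "p \<noteq> 0" "\<And>v. (0::real) < z v"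
  shows "0 < meval id z p"
proof -
  have "0 < mcoeff p m * mono_eval z m" if "m \<in> keys p" for m
  proof (rule mult_pos_pos)
    show "0 < mcoeff p m"
      using that assms(1) unfolding nonneg_coeffs_def in_keys_iff less_le by auto
    show "0 < mono_eval z m"
      unfolding mono_eval_def by (intro prod_pos ballI zero_less_power assms(3))
  qed
  moreover have "keys p \<noteq> {}" using assms(2) by (metis keys_eq_empty)
  ultimately show ?thesis
    unfolding meval_def mono_eval_def[symmetric] by (intro sum_pos) auto
qed

section \<open>Positive semidefinite quadratic forms\<close>

text \<open>Matrices and vectors are handled as functions on the indices below \<open>k\<close>, so that quadratic
  forms are plain double sums; \<open>fmat\<close> passes to matrices when determinants or eigenvalues are
  needed.\<close>

definition fmat :: "nat \<Rightarrow> (nat \<Rightarrow> nat \<Rightarrow> 'a) \<Rightarrow> 'a mat" where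
  "fmat k M = mat k k (\<lambda>(i, j). M i j)"

definition bform :: "nat \<Rightarrow> (nat \<Rightarrow> nat \<Rightarrow> real) \<Rightarrow> (nat \<Rightarrow> real) \<Rightarrow> (nat \<Rightarrow> real) \<Rightarrow> real" where
  "bform k M x y = (\<Sum>i<k. \<Sum>j<k. x i * M i j * y j)"

abbreviation qform :: "nat \<Rightarrow> (nat \<Rightarrow> nat \<Rightarrow> real) \<Rightarrow> (nat \<Rightarrow> real) \<Rightarrow> real" where
  "qform k M x \<equiv> bform k M x x"

definition symmetric_on :: "nat \<Rightarrow> (nat \<Rightarrow> nat \<Rightarrow> 'a) \<Rightarrow> bool" where
  "symmetric_on k M \<longleftrightarrow> (\<forall>i<k. \<forall>j<k. M i j = M j i)"

definition psd_on :: "nat \<Rightarrow> (nat \<Rightarrow> nat \<Rightarrow> real) \<Rightarrow> bool" where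
  "psd_on k M \<longleftrightarrow> (\<forall>x. 0 \<le> qform k M x)"

definition pd_on :: "nat \<Rightarrow> (nat \<Rightarrow> nat \<Rightarrow> real) \<Rightarrow> bool" where
  "pd_on k M \<longleftrightarrow> (\<forall>x. (\<exists>i<k. x i \<noteq> 0) \<longrightarrow> 0 < qform k M x)"

lemma fmat_carrier [simp]: "fmat k M \<in> carrier_mat k k"
  by (simp add: fmat_def)

lemma fmat_index [simp]: "i < k \<Longrightarrow> j < k \<Longrightarrow> fmat k M $$ (i, j) = M i j"
  by (simp add: fmat_def)

lemma fmat_cong: "(\<And>i j. i < k \<Longrightarrow> j < k \<Longrightarrow> M i j = N i j) \<Longrightarrow> fmat k M = fmat k N"
  by (auto simp: fmat_def intro!: cong_mat)

lemma fmat_mult: "fmat k M * fmat k N = fmat k (\<lambda>i j. \<Sum>l<k. M i l * N l j)"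
  by (rule eq_matI) (auto simp: fmat_def scalar_prod_def atLeast0LessThan)

lemma bform_add_left: "bform k M (\<lambda>i. a * x i + b * y i) z = a * bform k M x z + b * bform k M y z"
  by (simp add: bform_def sum.distrib sum_distrib_left algebra_simps)

lemma bform_add_right: "bform k M z (\<lambda>i. a * x i + b * y i) = a * bform k M z x + b * bform k M z y"
  by (simp add: bform_def sum.distrib sum_distrib_left algebra_simps)

lemma bform_commute:
  assumes "symmetric_on k M"
  shows "bform k M x y = bform k M y x"
  unfolding bform_def
  by (subst sum.swap) (use assms in \<open>auto simp: symmetric_on_def intro!: sum.cong\<close>)

lemma qform_add:
  assumes "symmetric_on k M"
  shows "qform k M (\<lambda>i. a * x i + b * y i) = a\<^sup>2 * qform k M x + 2 * a * b * bform k M x y + b\<^sup>2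
      * qform k M y"
  by (simp add: bform_add_left bform_add_right bform_commute[OF assms, of y x] power2_eq_square
      algebra_simps)

lemma bform_add_matrix: "bform k (\<lambda>i j. P i j + s * U i j) x y = bform k P x y + s * bform k U x y"
  by (simp add: bform_def sum.distrib sum_distrib_left algebra_simps)

lemma bform_unit:
  assumes "i < k" "j < k"
  shows "bform k M (\<lambda>l. if l = i then 1 else 0) (\<lambda>l. if l = j then 1 else 0) = M i j"
proof -
  let ?e = "\<lambda>i l. if l = i then 1 else 0 :: real"
  have "(\<Sum>b<k. ?e i a * M a b * ?e j b) = (if a = i then M a j else 0)" for a
  proof -
    have "(\<Sum>b<k. ?e i a * M a b * ?e j b) = (\<Sum>b<k. if b = j then ?e i a * M a j else 0)"
      by (intro sum.cong) auto
    then show ?thesis using assms by simp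
  qed
  then show ?thesis using assms by (simp add: bform_def)
qed

lemma psd_cauchy_schwarz:
  assumes "symmetric_on k M" "psd_on k M"
  shows "(bform k M x y)\<^sup>2 \<le> qform k M x * qform k M y"
proof -
  let ?a = "qform k M x" and ?b = "bform k M x y" and ?c = "qform k M y"
  have nonneg: "0 \<le> ?a + 2 * t * ?b + t\<^sup>2 * ?c" for t
  proof -
    have "0 \<le> qform k M (\<lambda>i. 1 * x i + t * y i)"
      using assms(2) unfolding psd_on_def by blast
    then show ?thesis unfolding qform_add[OF assms(1)] by simp
  qed
  show ?thesis
  proof (cases "?c = 0")
    case True
    have "?b = 0"
    proof (rule ccontr)
      assume "?b \<noteq> 0"
      then show False using nonneg[of "- (?a + 1) / (2 * ?b)"] True by (simp add: field_simps)
    qed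
    then show ?thesis using True by simp
  next
    case False
    then have "0 < ?c" using assms(2) by (simp add: psd_on_def less_le)
    then show ?thesis using nonneg[of "- ?b / ?c"]
      by (simp add: field_simps power2_eq_square)
  qed
qed

lemma sum_squares_pos:
  fixes x :: "nat \<Rightarrow> real"
  assumes "i < k" "x i \<noteq> 0"
  shows "0 < (\<Sum>i<k. (x i)\<^sup>2)"
  using assms by (intro sum_pos2[of _ i]) auto

lemma qform_bounded: "\<bar>qform k M x\<bar> \<le> (\<Sum>i<k. \<Sum>j<k. \<bar>M i j\<bar>) * (\<Sum>i<k. (x i)\<^sup>2)"
proof -
  have le: "\<bar>x i\<bar> * \<bar>x j\<bar> \<le> (\<Sum>i<k. (x i)\<^sup>2)" if "i < k" "j < k" for i j
  proof -
    have "(x i)\<^sup>2 \<le> (\<Sum>i<k. (x i)\<^sup>2)" "(x j)\<^sup>2 \<le> (\<Sum>i<k. (x i)\<^sup>2)"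
      using that by (auto intro!: member_le_sum)
    moreover have "2 * (\<bar>x i\<bar> * \<bar>x j\<bar>) \<le> (x i)\<^sup>2 + (x j)\<^sup>2"
      using sum_squares_bound[of "\<bar>x i\<bar>" "\<bar>x j\<bar>"] by simp
    ultimately show ?thesis by linarith
  qed
  have "\<bar>qform k M x\<bar> \<le> (\<Sum>i<k. \<Sum>j<k. \<bar>x i * M i j * x j\<bar>)"
    unfolding bform_def by (rule order_trans[OF sum_abs]) (intro sum_mono sum_abs)
  also have "\<dots> \<le> (\<Sum>i<k. \<Sum>j<k. \<bar>M i j\<bar> * (\<Sum>i<k. (x i)\<^sup>2))"
  proof (intro sum_mono)
    fix i j assume "i \<in> {..<k}" "j \<in> {..<k}"
    then have "\<bar>M i j\<bar> * (\<bar>x i\<bar> * \<bar>x j\<bar>) \<le> \<bar>M i j\<bar> * (\<Sum>i<k. (x i)\<^sup>2)"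
      by (intro mult_left_mono le) auto
    then show "\<bar>x i * M i j * x j\<bar> \<le> \<bar>M i j\<bar> * (\<Sum>i<k. (x i)\<^sup>2)"
      by (simp add: abs_mult mult_ac)
  qed
  also have "\<dots> = (\<Sum>i<k. \<Sum>j<k. \<bar>M i j\<bar>) * (\<Sum>i<k. (x i)\<^sup>2)"
    by (simp add: sum_distrib_right)
  finally show ?thesis .
qed

lemma det_fmat_eq_0_iff:
  fixes M :: "nat \<Rightarrow> nat \<Rightarrow> 'a::idom"
  shows "det (fmat k M) = 0 \<longleftrightarrow> (\<exists>x. (\<exists>i<k. x i \<noteq> 0) \<and> (\<forall>i<k. (\<Sum>j<k. M i j * x j) = 0))"
proof -
  have row: "(fmat k M *\<^sub>v v) $ i = (\<Sum>j<k. M i j * v $ j)" if "i < k" "v \<in> carrier_vec k" for v i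
    using that by (simp add: fmat_def scalar_prod_def atLeast0LessThan)
  have "det (fmat k M) = 0 \<longleftrightarrow> (\<exists>v. v \<in> carrier_vec k \<and> v \<noteq> 0\<^sub>v k \<and> fmat k M *\<^sub>v v = 0\<^sub>v k)"
    by (rule det_0_iff_vec_prod_zero) simp
  also have "\<dots> \<longleftrightarrow> (\<exists>x. (\<exists>i<k. x i \<noteq> 0) \<and> (\<forall>i<k. (\<Sum>j<k. M i j * x j) = 0))"
  proof
    assume "\<exists>v. v \<in> carrier_vec k \<and> v \<noteq> 0\<^sub>v k \<and> fmat k M *\<^sub>v v = 0\<^sub>v k"
    then obtain v where v: "v \<in> carrier_vec k" "v \<noteq> 0\<^sub>v k" "fmat k M *\<^sub>v v = 0\<^sub>v k" by blast
    from v(1,2) have "\<exists>i<k. v $ i \<noteq> 0" by (auto simp: vec_eq_iff)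
    moreover have "\<forall>i<k. (\<Sum>j<k. M i j * v $ j) = 0"
      using row[OF _ v(1)] v(3) by (metis index_zero_vec(1))
    ultimately show "\<exists>x. (\<exists>i<k. x i \<noteq> 0) \<and> (\<forall>i<k. (\<Sum>j<k. M i j * x j) = 0)"
      by (intro exI[of _ "\<lambda>i. v $ i"]) simp
  next
    assume "\<exists>x. (\<exists>i<k. x i \<noteq> 0) \<and> (\<forall>i<k. (\<Sum>j<k. M i j * x j) = 0)"
    then obtain x where x: "\<exists>i<k. x i \<noteq> 0" "\<forall>i<k. (\<Sum>j<k. M i j * x j) = 0" by blast
    have "fmat k M *\<^sub>v vec k x = 0\<^sub>v k"
      by (rule eq_vecI) (use x(2) in \<open>auto simp: row simp del: index_mult_mat_vec, simp add:
          fmat_def\<close>)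
    moreover have "vec k x \<noteq> 0\<^sub>v k" using x(1) by (auto simp: vec_eq_iff)
    ultimately show "\<exists>v. v \<in> carrier_vec k \<and> v \<noteq> 0\<^sub>v k \<and> fmat k M *\<^sub>v v = 0\<^sub>v k"
      by (intro exI[of _ "vec k x"]) simp
  qed
  finally show ?thesis .
qed

lemma fmat_right_inverse:
  fixes M :: "nat \<Rightarrow> nat \<Rightarrow> 'a::field"
  assumes "det (fmat k M) \<noteq> 0"
  obtains B where "\<And>i j. i < k \<Longrightarrow> j < k \<Longrightarrow> (\<Sum>l<k. M i l * B l j) = (if i = j then 1 else 0)"
proof -
  let ?A = "fmat k M" and ?d = "det (fmat k M)"
  define B where "B l j = adj_mat ?A $$ (l, j) / ?d" for l j
  have adj: "adj_mat ?A \<in> carrier_mat k k" "?A * adj_mat ?A = ?d \<cdot>\<^sub>m 1\<^sub>m k"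
    by (rule adj_mat[OF fmat_carrier])+
  have "(\<Sum>l<k. M i l * B l j) = (if i = j then 1 else 0)" if "i < k" "j < k" for i j
  proof -
    have "(\<Sum>l<k. M i l * B l j) * ?d = (\<Sum>l<k. M i l * adj_mat ?A $$ (l, j))"
      using assms by (simp add: B_def sum_distrib_right)
    also have "\<dots> = (?A * adj_mat ?A) $$ (i, j)"
      using that adj(1) by (simp add: fmat_def scalar_prod_def atLeast0LessThan)
    also have "\<dots> = (if i = j then ?d else 0)" using that by (simp add: adj(2))
    finally show ?thesis using assms by (auto split: if_splits)
  qed
  then show ?thesis by (rule that)
qed

text \<open>A nonsingular positive semidefinite form is bounded below by a multiple of the squared
  norm. The constant comes from the inverse matrix: with \<open>M y = x\<close>, the inequality of Cauchy and
  Schwarz gives \<open>(x \<bullet> x)\<^sup>2 = (x \<bullet> M y)\<^sup>2 \<le> (x \<bullet> M x) (y \<bullet> M y)\<close>, and \<open>y \<bullet> M y\<close> is a quadratic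
  form in \<open>x\<close>, hence bounded by a multiple of \<open>x \<bullet> x\<close>.\<close>

lemma psd_nonsingular_margin:
  assumes sym: "symmetric_on k M" and psd: "psd_on k M" and det: "det (fmat k M) \<noteq> 0"
  obtains \<epsilon> where "0 < \<epsilon>" "\<And>x. \<epsilon> * (\<Sum>i<k. (x i)\<^sup>2) \<le> qform k M x"
proof -
  obtain B where B: "\<And>i j. i < k \<Longrightarrow> j < k \<Longrightarrow> (\<Sum>l<k. M i l * B l j) = (if i = j then 1 else 0)"
    using fmat_right_inverse[OF det] by blast
  \<comment> \<open>a bound for the quadratic form of the inverse; the summand \<open>1\<close> makes it positive\<close>
  define C where "C = 1 + (\<Sum>i<k. \<Sum>j<k. \<bar>B i j\<bar>)"
  have C: "0 < C" unfolding C_def by (intro add_pos_nonneg sum_nonneg) auto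
  have "(\<Sum>i<k. (x i)\<^sup>2) \<le> C * qform k M x" for x
  proof -
    let ?n = "\<Sum>i<k. (x i)\<^sup>2"
    define y where "y j = (\<Sum>l<k. B j l * x l)" for j
    have My: "(\<Sum>j<k. M i j * y j) = x i" if "i < k" for i
    proof -
      have "(\<Sum>j<k. M i j * y j) = (\<Sum>l<k. (\<Sum>j<k. M i j * B j l) * x l)"
        unfolding y_def sum_distrib_left sum_distrib_right
        by (subst sum.swap) (simp add: mult.assoc)
      also have "\<dots> = (\<Sum>l<k. if l = i then x l else 0)"
        using that by (intro sum.cong) (auto simp: B)
      finally show ?thesis using that by simp
    qed
    have bf: "bform k M z y = (\<Sum>i<k. z i * x i)" for z
      by (simp add: bform_def mult.assoc sum_distrib_left[symmetric] My)
    have "bform k M x y = ?n" by (simp add: bf power2_eq_square)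
    moreover have "qform k M y = qform k B x"
      by (simp add: bf) (simp add: bform_def y_def sum_distrib_left sum_distrib_right mult_ac)
    moreover have "qform k B x \<le> C * ?n"
    proof -
      have "qform k B x \<le> (\<Sum>i<k. \<Sum>j<k. \<bar>B i j\<bar>) * ?n" using qform_bounded[of k B x] by linarith
      also have "\<dots> \<le> C * ?n" unfolding C_def by (intro mult_right_mono sum_nonneg) auto
      finally show ?thesis .
    qed
    moreover have "0 \<le> qform k M x" using psd by (simp add: psd_on_def)
    ultimately have "?n * ?n \<le> qform k M x * (C * ?n)"
      using psd_cauchy_schwarz[OF sym psd, of x y] mult_left_mono[of "qform k B x" "C * ?n"
          "qform k M x"]
      by (simp add: power2_eq_square)
    moreover have "0 \<le> ?n" by (intro sum_nonneg) auto
    ultimately show ?thesis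
    proof (cases "?n = 0")
      case False
      then have "0 < ?n" using \<open>0 \<le> ?n\<close> by linarith
      then show ?thesis using \<open>?n * ?n \<le> qform k M x * (C * ?n)\<close> by (simp add:
          mult.assoc[symmetric] mult.commute)
    qed (use C \<open>0 \<le> qform k M x\<close> in auto)
  qed
  then have "1 / C * (\<Sum>i<k. (x i)\<^sup>2) \<le> qform k M x" for x
    using C by (simp add: field_simps)
  then show ?thesis using C by (intro that[of "1 / C"]) auto
qed

text \<open>Positivity is lost only at a singular matrix: at the supremum \<open>t\<close> of all \<open>s\<close> for which \<open>P
  + s U\<close> is positive semidefinite, the form is nonsingular, hence bounded away from zero, and a
  slightly larger \<open>s\<close> would still do. So \<open>P + s U\<close> stays positive semidefinite for all \<open>s\<close>,
  which forces \<open>U\<close> to be.\<close>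

lemma psd_if_nonsingular_ray:
  assumes P: "symmetric_on k P" "psd_on k P" and U: "symmetric_on k U"
    and det: "\<And>s. 0 \<le> s \<Longrightarrow> det (fmat k (\<lambda>i j. P i j + s * U i j)) \<noteq> 0"
  shows "psd_on k U"
proof (rule ccontr)
  assume "\<not> psd_on k U"
  then obtain x0 where x0: "qform k U x0 < 0" by (auto simp: psd_on_def not_le)
  define S where "S = {s. 0 \<le> s \<and> psd_on k (\<lambda>i j. P i j + s * U i j)}"
  have "0 \<in> S" using P by (simp add: S_def)
  have bound: "s \<le> qform k P x0 / (- qform k U x0)" if "s \<in> S" for s
  proof -
    have "0 \<le> qform k P x0 + s * qform k U x0"
      using that by (auto simp: S_def psd_on_def bform_add_matrix)
    then show ?thesis using x0 by (simp add: field_simps)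
  qed
  then have bdd: "bdd_above S" by (auto simp: bdd_above_def)
  \<comment> \<open>the last parameter up to which positivity persists\<close>
  define t where "t = Sup S"
  have "0 \<le> t" unfolding t_def by (rule cSup_upper[OF \<open>0 \<in> S\<close> bdd])
  have psd: "psd_on k (\<lambda>i j. P i j + t * U i j)"
    unfolding psd_on_def
  proof
    fix x
    show "0 \<le> qform k (\<lambda>i j. P i j + t * U i j) x"
    proof (rule ccontr)
      assume "\<not> 0 \<le> qform k (\<lambda>i j. P i j + t * U i j) x"
      then have neg: "qform k P x + t * qform k U x < 0" by (simp add: bform_add_matrix)
      have "0 \<le> qform k P x" using P by (simp add: psd_on_def)
      then have "t * qform k U x < 0" using neg by linarith
      then have U0: "qform k U x < 0" using \<open>0 \<le> t\<close> by (metis mult_nonneg_nonneg not_le)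
      then have "qform k P x / (- qform k U x) < t" using neg by (simp add: field_simps)
      then obtain s where "s \<in> S" "qform k P x / (- qform k U x) < s"
        unfolding t_def using less_cSup_iff[OF _ bdd] \<open>0 \<in> S\<close> by blast
      then have "qform k P x + s * qform k U x < 0" using U0 by (simp add: field_simps)
      then show False using \<open>s \<in> S\<close> by (auto simp: S_def psd_on_def bform_add_matrix
          not_le[symmetric])
    qed
  qed
  have "symmetric_on k (\<lambda>i j. P i j + t * U i j)" using P U by (auto simp: symmetric_on_def)
  from psd_nonsingular_margin[OF this psd det[OF \<open>0 \<le> t\<close>]]
  obtain \<epsilon> where \<epsilon>: "0 < \<epsilon>" "\<And>x. \<epsilon> * (\<Sum>i<k. (x i)\<^sup>2) \<le> qform k P x + t * qform k U x"
    by (auto simp: bform_add_matrix)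
  define C where "C = 1 + (\<Sum>i<k. \<Sum>j<k. \<bar>U i j\<bar>)"
  have C: "0 < C" unfolding C_def by (intro add_pos_nonneg sum_nonneg) auto
  have "t + \<epsilon> / C \<in> S"
    unfolding S_def psd_on_def mem_Collect_eq
  proof (intro conjI allI)
    show "0 \<le> t + \<epsilon> / C" using \<open>0 \<le> t\<close> C \<epsilon> by simp
    fix x :: "nat \<Rightarrow> real"
    let ?n = "\<Sum>i<k. (x i)\<^sup>2"
    have "0 \<le> ?n" by (intro sum_nonneg) auto
    have "\<bar>qform k U x\<bar> \<le> (\<Sum>i<k. \<Sum>j<k. \<bar>U i j\<bar>) * ?n" by (rule qform_bounded)
    also have "\<dots> \<le> C * ?n" unfolding C_def using \<open>0 \<le> ?n\<close> by (intro mult_right_mono) auto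
    finally have "- (C * ?n) \<le> qform k U x" by linarith
    then have "\<epsilon> / C * (- (C * ?n)) \<le> \<epsilon> / C * qform k U x"
      using C \<epsilon> by (intro mult_left_mono) auto
    then have "- (\<epsilon> * ?n) \<le> \<epsilon> / C * qform k U x" using C by simp
    then have "0 \<le> qform k P x + (t + \<epsilon> / C) * qform k U x"
      using \<epsilon>(2)[of x] unfolding distrib_right by linarith
    then show "0 \<le> qform k (\<lambda>i j. P i j + (t + \<epsilon> / C) * U i j) x"
      by (simp only: bform_add_matrix)
  qed
  then have "t + \<epsilon> / C \<le> t" unfolding t_def by (rule cSup_upper[OF _ bdd])
  then show False using C \<epsilon> by (simp add: field_simps)
qed

lemma hermitian_form:
  assumes "symmetric_on k M"
  shows "(\<Sum>i<k. \<Sum>j<k. cnj (v i) * complex_of_real (M i j) * v j) =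
    complex_of_real (qform k M (\<lambda>i. Re (v i)) + qform k M (\<lambda>i. Im (v i)))"
proof -
  let ?S = "\<Sum>i<k. \<Sum>j<k. cnj (v i) * complex_of_real (M i j) * v j"
  have "Im ?S = (\<Sum>i<k. \<Sum>j<k. Re (v i) * M i j * Im (v j) - Im (v i) * M i j * Re (v j))"
    unfolding Im_sum by (intro sum.cong refl) (simp add: algebra_simps)
  also have "\<dots> = bform k M (\<lambda>i. Re (v i)) (\<lambda>i. Im (v i)) - bform k M (\<lambda>i. Im (v i)) (\<lambda>i. Re (v i))"
    by (simp only: bform_def sum_subtractf)
  also have "\<dots> = 0" using bform_commute[OF assms, of "\<lambda>i. Re (v i)" "\<lambda>i. Im (v i)"] by simp
  finally have "Im ?S = 0" .
  moreover have "Re ?S = (\<Sum>i<k. \<Sum>j<k. Re (v i) * M i j * Re (v j) + Im (v i) * M i j * Im (v j))"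
    unfolding Re_sum by (intro sum.cong refl) (simp add: algebra_simps)
  then have "Re ?S = qform k M (\<lambda>i. Re (v i)) + qform k M (\<lambda>i. Im (v i))"
    by (simp only: bform_def sum.distrib)
  ultimately show ?thesis by (intro complex_eqI) simp_all
qed

section \<open>Zeros of determinantal pencils\<close>

text \<open>The matrix \<open>2 w\<^sub>0 Id + M diag w\<close>. Its determinant is the homogenized blowup-polynomial
  when \<open>M = D + 2 Id\<close>, and the blowup-polynomial itself for \<open>w\<^sub>0 = -1\<close>.\<close>

definition pencil :: "nat \<Rightarrow> (nat \<Rightarrow> nat \<Rightarrow> 'a::comm_ring_1) \<Rightarrow> 'a \<Rightarrow> (nat \<Rightarrow> 'a) \<Rightarrow> 'a mat" where
  "pencil k M w0 w = fmat k (\<lambda>i j. (if i = j then 2 * w0 else 0) + M i j * w j)"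

lemma pencil_carrier [simp]: "pencil k M w0 w \<in> carrier_mat k k"
  by (simp add: pencil_def)

lemma hom_det_pencil:
  assumes "comm_ring_hom h"
  shows "h (det (pencil k M w0 w)) = det (pencil k (\<lambda>i j. h (M i j)) (h w0) (\<lambda>j. h (w j)))"
proof -
  interpret h: comm_ring_hom h by fact
  have "map_mat h (pencil k M w0 w) = pencil k (\<lambda>i j. h (M i j)) (h w0) (\<lambda>j. h (w j))"
    by (rule eq_matI) (auto simp: pencil_def fmat_def h.hom_add h.hom_mult h.hom_numeral)
  then show ?thesis by (metis h.hom_det)
qed

lemma det_pencil_scale: "det (pencil k M (c * w0) (\<lambda>j. c * w j)) = c ^ k * det (pencil k M w0 w)"
proof -
  have "pencil k M (c * w0) (\<lambda>j. c * w j) = c \<cdot>\<^sub>m pencil k M w0 w"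
    by (rule eq_matI) (auto simp: pencil_def fmat_def algebra_simps)
  then show ?thesis by (simp add: pencil_def fmat_def)
qed

text \<open>For a kernel vector \<open>x\<close>, put \<open>y\<^sub>j = w\<^sub>j x\<^sub>j\<close>. Then \<open>M y = - 2 w\<^sub>0 x\<close>, so the real number
  \<open>r = y\<^sup>* M y \<ge> 0\<close> equals \<open>- 2 w\<^sub>0 (\<Sum>j. cnj w\<^sub>j \<bar>x\<^sub>j\<bar>\<^sup>2)\<close>. After multiplication by the
  conjugate of \<open>w\<^sub>0\<close> the imaginary part of the left side is at most \<open>0\<close>, that of the right side
  is positive. Allowing real \<open>w\<^sub>0 \<noteq> 0\<close> covers the polynomial in which the homogenizing variable
  is set to \<open>1\<close>.\<close>

lemma det_pencil_nonzero:
  assumes sym: "symmetric_on k M" and psd: "psd_on k M"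
    and w: "\<And>j. j < k \<Longrightarrow> 0 < Im (w j)" and w0: "w0 \<noteq> 0" "0 \<le> Im w0"
  shows "det (pencil k (\<lambda>i j. complex_of_real (M i j)) w0 w) \<noteq> 0"
proof
  assume "det (pencil k (\<lambda>i j. complex_of_real (M i j)) w0 w) = 0"
  then obtain x where x: "\<exists>i<k. x i \<noteq> 0"
    "\<forall>i<k. (\<Sum>j<k. ((if i = j then 2 * w0 else 0) + complex_of_real (M i j) * w j) * x j) = 0"
    unfolding pencil_def det_fmat_eq_0_iff by blast
  define y where "y j = w j * x j" for j
  define r where "r = qform k M (\<lambda>i. Re (y i)) + qform k M (\<lambda>i. Im (y i))"
  have "0 \<le> r" using psd by (simp add: r_def psd_on_def)
  have row: "2 * w0 * x i + (\<Sum>j<k. complex_of_real (M i j) * y j) = 0" if "i < k" for i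
  proof -
    have "(\<Sum>j<k. ((if i = j then 2 * w0 else 0) + complex_of_real (M i j) * w j) * x j) =
        (\<Sum>j<k. if j = i then 2 * w0 * x j else 0) + (\<Sum>j<k. complex_of_real (M i j) * y j)"
      unfolding sum.distrib[symmetric] by (intro sum.cong) (auto simp: y_def algebra_simps)
    then show ?thesis using x(2) that by simp
  qed
  have "complex_of_real r = (\<Sum>i<k. cnj (y i) * (\<Sum>j<k. complex_of_real (M i j) * y j))"
    unfolding r_def hermitian_form[OF sym, symmetric] by (simp add: sum_distrib_left mult.assoc)
  also have "\<dots> = (\<Sum>i<k. cnj (y i) * (- 2 * w0 * x i))"
  proof (intro sum.cong refl)
    fix i assume "i \<in> {..<k}"
    then have "(\<Sum>j<k. complex_of_real (M i j) * y j) = - (2 * w0 * x i)"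
      unfolding eq_neg_iff_add_eq_0 using row by (simp add: add.commute)
    then show "cnj (y i) * (\<Sum>j<k. complex_of_real (M i j) * y j) = cnj (y i) * (- 2 * w0 * x i)"
      by simp
  qed
  also have "\<dots> = - 2 * w0 * (\<Sum>i<k. cnj (w i) * complex_of_real ((cmod (x i))\<^sup>2))"
    unfolding sum_distrib_left complex_norm_square y_def
    by (intro sum.cong refl) (simp add: mult_ac)
  finally have eq: "complex_of_real r * cnj w0 =
      - 2 * complex_of_real ((cmod w0)\<^sup>2) * (\<Sum>i<k. cnj (w i) * complex_of_real ((cmod (x i))\<^sup>2))"
    unfolding complex_norm_square by (simp add: mult_ac)
  have "Im (complex_of_real r * cnj w0) \<le> 0" using \<open>0 \<le> r\<close> w0 by simp
  moreover have "Im (- 2 * complex_of_real ((cmod w0)\<^sup>2) * (\<Sum>i<k. cnj (w i) * complex_of_real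
      ((cmod (x i))\<^sup>2))) =
      2 * (cmod w0)\<^sup>2 * (\<Sum>i<k. Im (w i) * (cmod (x i))\<^sup>2)"
    by (simp add: sum_negf)
  moreover have "0 < (\<Sum>i<k. Im (w i) * (cmod (x i))\<^sup>2)"
  proof -
    obtain i where "i < k" "x i \<noteq> 0" using x(1) by blast
    then show ?thesis using w by (intro sum_pos2[of _ i]) (auto intro!: mult_nonneg_nonneg
        intro: less_imp_le)
  qed
  then have "0 < 2 * (cmod w0)\<^sup>2 * (\<Sum>i<k. Im (w i) * (cmod (x i))\<^sup>2)"
    using w0 by (intro mult_pos_pos) auto
  ultimately show False using arg_cong[OF eq, of Im] by linarith
qed

lemma poly_pos_if_no_pos_root:
  fixes p :: "real poly"
  assumes "0 < lead_coeff p" "\<And>x. 0 < x \<Longrightarrow> poly p x \<noteq> 0" "0 < x"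
  shows "0 < poly p x"
proof (rule ccontr)
  assume "\<not> 0 < poly p x"
  with assms(2)[OF \<open>0 < x\<close>] have neg: "poly p x < 0" by linarith
  obtain n where n: "\<forall>y\<ge>n. lead_coeff p \<le> poly p y" using poly_pinfty_gt_lc[OF assms(1)] by blast
  define y where "y = max n (x + 1)"
  have "0 < poly p y" "x < y" using n assms(1) by (auto simp: y_def less_le_trans)
  then obtain z where "x < z" "z < y" "poly p z = 0"
    using poly_IVT_pos[of x y p] neg by blast
  then show False using assms(2)[of z] \<open>0 < x\<close> by simp
qed

text \<open>As a function of \<open>w\<^sub>0\<close> the determinant is a characteristic polynomial, hence positive for
  large arguments; on the positive real axis it has no zero, because multiplying all arguments
  by \<open>\<i>\<close> brings them into the upper half plane, where \<open>det_pencil_nonzero\<close> applies.\<close>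

lemma det_pencil_pos:
  assumes sym: "symmetric_on k M" and psd: "psd_on k M"
    and a: "\<And>j. j < k \<Longrightarrow> 0 < a j" and b: "0 < b"
  shows "0 < det (pencil k M b a)"
proof -
  define N where "N = fmat k (\<lambda>i j. - (M i j * a j))"
  have N: "N \<in> carrier_mat k k" by (simp add: N_def)
  have eval: "poly (char_poly N) t = det (pencil k M (t / 2) a)" for t
    unfolding char_poly_def
    by (rule poly_det_cong[of _ k]) (use N in \<open>auto simp: char_poly_matrix_def pencil_def N_def
        fmat_def\<close>)
  have "det (pencil k M s a) \<noteq> 0" if "0 < s" for s
  proof -
    let ?c = "complex_of_real"
    have "det (pencil k (\<lambda>i j. ?c (M i j)) (\<i> * ?c s) (\<lambda>j. \<i> * ?c (a j))) \<noteq> 0"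
      using that a by (intro det_pencil_nonzero[OF sym psd]) auto
    then have "?c (det (pencil k M s a)) \<noteq> 0"
      by (simp add: det_pencil_scale hom_det_pencil[OF comm_ring_hom_of_real])
    then show ?thesis by simp
  qed
  then have "poly (char_poly N) t \<noteq> 0" if "0 < t" for t
    using that by (simp add: eval)
  moreover have "lead_coeff (char_poly N) = 1" using degree_monic_char_poly[OF N] by auto
  ultimately have "0 < poly (char_poly N) (2 * b)"
    using b by (intro poly_pos_if_no_pos_root) auto
  then show ?thesis by (simp add: eval)
qed

text \<open>The common exit of all polynomial conditions: each of them keeps \<open>2 Id + s M\<close> nonsingular
  for \<open>s > 0\<close>, and the ray lemma applies with \<open>P = 2 Id\<close>.\<close>

lemma psd_if_pencil_nonsingular:
  assumes sym: "symmetric_on k M" and det: "\<And>s. 0 < s \<Longrightarrow> det (pencil k M 1 (\<lambda>_. s)) \<noteq> 0"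
  shows "psd_on k M"
proof (rule psd_if_nonsingular_ray[where P = "\<lambda>i j. if i = j then 2 else 0"])
  have q: "qform k (\<lambda>i j. if i = j then 2 else 0) x = (\<Sum>i<k. 2 * (x i)\<^sup>2)" for x
  proof -
    have "qform k (\<lambda>i j. if i = j then 2 else 0) x = (\<Sum>i<k. \<Sum>j<k. if j = i then 2 * (x i)\<^sup>2 else 0)"
      unfolding bform_def by (intro sum.cong) (auto simp: power2_eq_square)
    then show ?thesis by simp
  qed
  show "psd_on k (\<lambda>i j. if i = j then 2 else 0)"
    unfolding psd_on_def q by (auto intro!: sum_nonneg)
  fix s :: real
  assume "0 \<le> s"
  show "det (fmat k (\<lambda>i j. (if i = j then 2 else 0) + s * M i j)) \<noteq> 0"
  proof (cases "s = 0")
    case True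
    have "fmat k (\<lambda>i j. (if i = j then 2 else 0) + s * M i j) = 2 \<cdot>\<^sub>m 1\<^sub>m k"
      by (rule eq_matI) (auto simp: fmat_def True)
    then show ?thesis by simp
  next
    case False
    then have "det (pencil k M 1 (\<lambda>_. s)) \<noteq> 0" using \<open>0 \<le> s\<close> by (intro det) auto
    moreover have "pencil k M 1 (\<lambda>_. s) = fmat k (\<lambda>i j. (if i = j then 2 else 0) + s * M i j)"
      unfolding pencil_def by (rule fmat_cong) simp
    ultimately show ?thesis by simp
  qed
qed (use sym in \<open>auto simp: symmetric_on_def\<close>)

text \<open>Multiplied by \<open>M\<close> on the right, the pencil along the line \<open>(1/2, 0) + s (u\<^sub>0, u)\<close> becomes
  the symmetric pencil \<open>M + s U\<close> with \<open>U = 2 u\<^sub>0 M + M diag(u) M\<close>. If it is never singular, the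
  ray lemma for \<open>U\<close> and for \<open>-U\<close> gives \<open>U = 0\<close>, that is \<open>2 u\<^sub>0 Id + diag(u) M = 0\<close>; the
  off-diagonal entries of \<open>M\<close> then force \<open>u = 0\<close>. So the determinant of the pencil is not
  invariant under any translation.\<close>

lemma pencil_lineality:
  assumes sym: "symmetric_on k M" and pd: "pd_on k M" and k: "2 \<le> k"
    and off: "\<And>i j. i < k \<Longrightarrow> j < k \<Longrightarrow> i \<noteq> j \<Longrightarrow> M i j \<noteq> 0"
    and det: "\<And>s. det (pencil k M (1 / 2 + s * u0) (\<lambda>j. s * u j)) \<noteq> 0"
  shows "u0 = 0" "\<And>j. j < k \<Longrightarrow> u j = 0"
proof -
  have M0: "x j = 0" if "\<And>i. i < k \<Longrightarrow> (\<Sum>l<k. M i l * x l) = 0" "j < k" for x j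
  proof (rule ccontr)
    assume "x j \<noteq> 0"
    then have "0 < qform k M x" using pd that(2) by (auto simp: pd_on_def)
    moreover have "qform k M x = (\<Sum>i<k. x i * (\<Sum>l<k. M i l * x l))"
      by (simp add: bform_def sum_distrib_left mult.assoc)
    ultimately show False using that(1) by simp
  qed
  have detM: "det (fmat k M) \<noteq> 0" unfolding det_fmat_eq_0_iff using M0 by blast
  have psd: "psd_on k M"
    unfolding psd_on_def
  proof
    fix x
    show "0 \<le> qform k M x"
      using pd by (cases "\<exists>i<k. x i \<noteq> 0") (auto simp: pd_on_def less_imp_le bform_def)
  qed
  define Y where "Y l j = (if l = j then 2 * u0 else 0) + u l * M l j" for l j
  define U where "U i j = (\<Sum>l<k. M i l * Y l j)" for i j
  have Ueq: "U i j = 2 * u0 * M i j + (\<Sum>l<k. M i l * u l * M l j)" if "j < k" for i j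
  proof -
    have "U i j = (\<Sum>l<k. (if l = j then 2 * u0 * M i l else 0) + M i l * u l * M l j)"
      unfolding U_def by (intro sum.cong) (auto simp: Y_def algebra_simps)
    then show ?thesis using that by (simp add: sum.distrib)
  qed
  have symU: "symmetric_on k U"
    using sym by (auto simp: symmetric_on_def Ueq mult_ac intro!: sum.cong)
  have nonsing: "det (fmat k (\<lambda>i j. M i j + s * U i j)) \<noteq> 0" for s
  proof -
    have "pencil k M (1 / 2 + s * u0) (\<lambda>j. s * u j) * fmat k M = fmat k (\<lambda>i j. M i j + s * U i j)"
      unfolding pencil_def fmat_mult
    proof (rule fmat_cong)
      fix i j assume ij: "i < k" "j < k"
      have "(\<Sum>l<k. ((if i = l then 2 * (1 / 2 + s * u0) else 0) + M i l * (s * u l)) * M l j) =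
          (\<Sum>l<k. (if l = i then (1 + 2 * s * u0) * M l j else 0) + s * (M i l * u l * M l j))"
        by (intro sum.cong) (auto simp: algebra_simps)
      also have "\<dots> = (1 + 2 * s * u0) * M i j + s * (\<Sum>l<k. M i l * u l * M l j)"
        using ij by (simp add: sum.distrib sum_distrib_left)
      also have "\<dots> = M i j + s * U i j" using ij by (simp add: Ueq algebra_simps)
      finally show "(\<Sum>l<k. ((if i = l then 2 * (1 / 2 + s * u0) else 0) + M i l * (s * u l)) * M
          l j) =
        M i j + s * U i j" .
    qed
    then have "det (fmat k (\<lambda>i j. M i j + s * U i j)) = det (pencil k M (1 / 2 + s * u0) (\<lambda>j. s
        * u j)) * det (fmat k M)"
      using det_mult[of "pencil k M (1 / 2 + s * u0) (\<lambda>j. s * u j)" k "fmat k M"] by simp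
    then show ?thesis using det detM by simp
  qed
  have "psd_on k U" by (rule psd_if_nonsingular_ray[OF sym psd symU nonsing])
  moreover have "psd_on k (\<lambda>i j. - U i j)"
  proof (rule psd_if_nonsingular_ray[OF sym psd])
    show "symmetric_on k (\<lambda>i j. - U i j)" using symU by (simp add: symmetric_on_def)
    show "det (fmat k (\<lambda>i j. M i j + s * - U i j)) \<noteq> 0" for s using nonsing[of "- s"] by simp
  qed
  ultimately have q0: "qform k U x = 0" for x
    using order.antisym by (fastforce simp: psd_on_def bform_def sum_negf)
  have U0: "U i j = 0" if "i < k" "j < k" for i j
  proof -
    let ?e = "\<lambda>i l. if l = i then 1 else 0 :: real"
    have "U i j = bform k U (?e i) (?e j)" using that by (simp add: bform_unit)
    then show ?thesis using qform_add[OF symU, of 1 "?e i" 1 "?e j"] q0 by simp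
  qed
  have Y0: "Y l j = 0" if "l < k" "j < k" for l j
    by (rule M0[of "\<lambda>l. Y l j"]) (use that U0 in \<open>auto simp: U_def\<close>)
  show u: "u j = 0" if "j < k" for j
  proof -
    define l where "l = (if j = 0 then 1 else 0 :: nat)"
    have "l < k" "l \<noteq> j" using k by (auto simp: l_def)
    then show ?thesis using Y0[of j l] off[of j l] that by (simp add: Y_def)
  qed
  show "u0 = 0" using Y0[of 0 0] u[of 0] k by (simp add: Y_def)
qed

section \<open>Spectrum of real symmetric matrices\<close>

lemma real_rooted_splits:
  fixes p :: "real poly"
  assumes real: "\<And>z. poly (map_poly complex_of_real p) z = 0 \<Longrightarrow> Im z = 0"
  obtains rs where "p = Polynomial.smult (lead_coeff p) (\<Prod>r\<leftarrow>rs. [:- r, 1:])"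
proof -
  let ?c = "complex_of_real"
  interpret c: map_poly_inj_idom_hom ?c ..
  obtain cs where cs: "Polynomial.smult (lead_coeff (map_poly ?c p)) (\<Prod>a\<leftarrow>cs. [:- a, 1:]) =
      map_poly ?c p"
    using fundamental_theorem_algebra_factorized by blast
  have lc: "lead_coeff (map_poly ?c p) = ?c (lead_coeff p)" by simp
  show ?thesis
  proof (cases "p = 0")
    case False
    have "a = ?c (Re a)" if "a \<in> set cs" for a
    proof -
      have "poly (\<Prod>a\<leftarrow>cs. [:- a, 1:]) a = 0" using that by (induction cs) auto
      then have "poly (map_poly ?c p) a = 0" by (subst cs[symmetric]) simp
      then show ?thesis using real by (simp add: complex_eq_iff)
    qed
    then have "(\<Prod>a\<leftarrow>cs. [:- a, 1:]) = (\<Prod>a\<leftarrow>map Re cs. [:- ?c a, 1:])"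
      unfolding map_map by (intro arg_cong[of _ _ prod_list] map_cong refl) (auto simp: o_def)
    also have "\<dots> = map_poly ?c (\<Prod>a\<leftarrow>map Re cs. [:- a, 1:])"
      by (simp add: c.hom_prod_list o_def)
    finally have "map_poly ?c p = map_poly ?c (Polynomial.smult (lead_coeff p) (\<Prod>a\<leftarrow>map Re cs.
        [:- a, 1:]))"
      using cs lc by (simp add: of_real_hom.map_poly_hom_smult)
    then have "p = Polynomial.smult (lead_coeff p) (\<Prod>a\<leftarrow>map Re cs. [:- a, 1:])"
      by (simp only: c.eq_iff)
    then show ?thesis by (rule that)
  qed (rule that[of "[]"], simp)
qed

lemma symmetric_char_poly_splits:
  fixes M :: "nat \<Rightarrow> nat \<Rightarrow> real"
  assumes "symmetric_on k M"
  obtains es where "char_poly (fmat k M) = (\<Prod>e\<leftarrow>es. [:- e, 1:])"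
proof -
  let ?c = "complex_of_real"
  let ?A = "map_mat ?c (fmat k M)"
  have A: "?A \<in> carrier_mat k k" by simp
  have cp: "map_poly ?c (char_poly (fmat k M)) = char_poly ?A"
    by (rule of_real_hom.char_poly_hom[symmetric, OF fmat_carrier])
  have real: "Im a = 0" if "poly (map_poly ?c (char_poly (fmat k M))) a = 0" for a
  proof -
    have "poly (char_poly ?A) a = 0" using that by (simp add: cp)
    then have "det (- (char_matrix ?A a)) = 0" using char_poly_matrix[OF A, of a] by simp
    moreover have "- (char_matrix ?A a) = fmat k (\<lambda>i j. (if i = j then a else 0) - ?c (M i j))"
      by (rule eq_matI) (auto simp: char_matrix_def fmat_def)
    ultimately obtain x where x: "\<exists>i<k. x i \<noteq> 0"
      "\<forall>i<k. (\<Sum>j<k. ((if i = j then a else 0) - ?c (M i j)) * x j) = 0"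
      by (auto simp: det_fmat_eq_0_iff)
    have row: "(\<Sum>j<k. ?c (M i j) * x j) = a * x i" if "i < k" for i
    proof -
      have "(\<Sum>j<k. ((if i = j then a else 0) - ?c (M i j)) * x j) =
          (\<Sum>j<k. if j = i then a * x j else 0) - (\<Sum>j<k. ?c (M i j) * x j)"
        unfolding sum_subtractf[symmetric] by (intro sum.cong) (auto simp: algebra_simps)
      then show ?thesis using x(2) that by simp
    qed
    define n where "n = (\<Sum>i<k. (cmod (x i))\<^sup>2)"
    have "0 < n"
    proof -
      obtain i where "i < k" "x i \<noteq> 0" using x(1) by blast
      then show ?thesis unfolding n_def by (intro sum_pos2[of _ i]) auto
    qed
    have "(\<Sum>i<k. \<Sum>j<k. cnj (x i) * ?c (M i j) * x j) = (\<Sum>i<k. cnj (x i) * (\<Sum>j<k. ?c (M i j) * x j))"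
      by (simp add: sum_distrib_left mult.assoc)
    also have "\<dots> = (\<Sum>i<k. cnj (x i) * (a * x i))" by (intro sum.cong) (auto simp: row)
    also have "\<dots> = a * ?c n"
      unfolding n_def of_real_sum sum_distrib_left complex_norm_square
      by (intro sum.cong refl) (simp add: mult_ac)
    finally have "Im (a * ?c n) = 0" unfolding hermitian_form[OF assms] by (metis
        Im_complex_of_real)
    then show ?thesis using \<open>0 < n\<close> by simp
  qed
  have "lead_coeff (char_poly (fmat k M)) = 1"
    using degree_monic_char_poly[OF fmat_carrier[of k M]] by auto
  then show ?thesis using real_rooted_splits[OF real] that by (metis smult_1_left)
qed

lemma sum_order_char_poly:
  fixes es :: "real list"
  assumes "p = (\<Prod>e\<leftarrow>es. [:- e, 1:])"
  shows "(\<Sum>a\<in>{a. poly p a = 0 \<and> 0 < a}. Polynomial.order a p) = length (filter ((<) 0) es)"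
proof -
  have roots: "{a. poly p a = 0 \<and> 0 < a} = set (filter ((<) 0) es)"
    unfolding assms by (induction es) auto
  have nz: "(\<Prod>e\<leftarrow>xs. [:- e, 1:]) \<noteq> 0" for xs :: "real list"
    by (induction xs) (simp_all del: mult_pCons_left)
  have "Polynomial.order a (\<Prod>e\<leftarrow>xs. [:- e, 1:]) = count_list xs a" for a and xs :: "real list"
  proof (induction xs)
    case (Cons x xs)
    have "Polynomial.order a ([:- x, 1:] * (\<Prod>e\<leftarrow>xs. [:- e, 1:])) =
        Polynomial.order a [:- x, 1:] + Polynomial.order a (\<Prod>e\<leftarrow>xs. [:- e, 1:])"
      by (rule order_mult) (use nz[of "x # xs"] in simp)
    then show ?case using Cons by (auto simp: order_linear')
  qed (simp add: order_1)
  then have "(\<Sum>a\<in>{a. poly p a = 0 \<and> 0 < a}. Polynomial.order a p) =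
      (\<Sum>a\<in>set (filter ((<) 0) es). count_list (filter ((<) 0) es) a)"
    unfolding roots unfolding assms by (intro sum.cong refl) (auto simp:
        count_list_eq_length_filter intro!: arg_cong[of _ _ length] filter_cong)
  also have "\<dots> = length (filter ((<) 0) es)" by (rule sum_count_set) auto
  finally show ?thesis .
qed

text \<open>Schur's triangular form allows the two chosen roots to come first on the diagonal. Its
  first two columns \<open>p\<close>, \<open>r\<close> satisfy \<open>M p = l p\<close> and \<open>M r = b p + m r\<close>, and the component of \<open>r\<close>
  orthogonal to \<open>p\<close> is an eigenvector because \<open>M\<close> is symmetric. The case \<open>l = m\<close> is included, so
  multiplicities of roots are seen in the quadratic form.\<close>

lemma orthogonal_eigenvectors:
  fixes M :: "nat \<Rightarrow> nat \<Rightarrow> real"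
  assumes sym: "symmetric_on k M" and cp: "char_poly (fmat k M) = (\<Prod>e\<leftarrow>l # m # es. [:- e, 1:])"
  obtains p q where "\<exists>i<k. p i \<noteq> 0" "\<exists>i<k. q i \<noteq> 0" "(\<Sum>i<k. p i * q i) = 0"
    "\<And>i. i < k \<Longrightarrow> (\<Sum>j<k. M i j * p j) = l * p i"
    "\<And>i. i < k \<Longrightarrow> (\<Sum>j<k. M i j * q j) = m * q i"
proof -
  let ?A = "fmat k M"
  obtain B P Q where BPQ: "schur_decomposition ?A (l # m # es) = (B, P, Q)" by (metis prod_cases3)
  from schur_decomposition[OF fmat_carrier cp BPQ]
  have sim: "similar_mat_wit ?A B P Q" and ut: "upper_triangular B" and diag: "diag_mat B = l #
      m # es"
    by auto
  have carr: "B \<in> carrier_mat k k" "P \<in> carrier_mat k k" "Q \<in> carrier_mat k k"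
    and QP: "Q * P = 1\<^sub>m k" and A: "?A = P * B * Q"
    using similar_mat_witD2[OF fmat_carrier sim] by auto
  have k: "2 \<le> k" 
  proof -
    have "length (diag_mat B) = k" using carr(1) by (simp add: diag_mat_def)
    then show ?thesis by (simp add: diag)
  qed
  have B00: "B $$ (0, 0) = l" and B11: "B $$ (1, 1) = m"
    using arg_cong[OF diag, of "\<lambda>xs. xs ! 0"] arg_cong[OF diag, of "\<lambda>xs. xs ! 1"] k carr(1)
    by (auto simp: diag_mat_def)
  have B0: "B $$ (i, j) = 0" if "j < i" "i < k" for i j
    using ut that carr(1) by (auto simp: upper_triangular_def)
  have AP: "?A * P = P * B"
    using carr by (simp add: A QP assoc_mult_mat[of _ k k _ k _ k])
  have AP': "(\<Sum>j<k. M i j * P $$ (j, c)) = (\<Sum>j<k. P $$ (i, j) * B $$ (j, c))" if "i < k" "c < k"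
      for i c
  proof -
    have "(?A * P) $$ (i, c) = (\<Sum>j<k. M i j * P $$ (j, c))"
      using that carr by (simp add: fmat_def scalar_prod_def atLeast0LessThan)
    moreover have "(P * B) $$ (i, c) = (\<Sum>j<k. P $$ (i, j) * B $$ (j, c))"
      using that carr by (simp add: scalar_prod_def atLeast0LessThan)
    ultimately show ?thesis using AP by simp
  qed
  define p where "p i = P $$ (i, 0)" for i
  define r where "r i = P $$ (i, 1)" for i
  define b where "b = B $$ (0, 1)"
  have Mp: "(\<Sum>j<k. M i j * p j) = l * p i" if "i < k" for i
  proof -
    have "(\<Sum>j<k. P $$ (i, j) * B $$ (j, 0)) = (\<Sum>j\<in>{0}. P $$ (i, j) * B $$ (j, 0))"
      by (rule sum.mono_neutral_right) (use k B0 in auto)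
    then show ?thesis using AP'[OF that, of 0] k by (simp add: p_def B00 mult.commute)
  qed
  have Mr: "(\<Sum>j<k. M i j * r j) = b * p i + m * r i" if "i < k" for i
  proof -
    have "(\<Sum>j<k. P $$ (i, j) * B $$ (j, 1)) = (\<Sum>j\<in>{0, 1}. P $$ (i, j) * B $$ (j, 1))"
      by (rule sum.mono_neutral_right) (use k B0 in auto)
    then show ?thesis using AP'[OF that, of 1] k by (simp add: p_def r_def b_def B11[simplified]
        mult.commute)
  qed
  have QP': "(\<Sum>i<k. Q $$ (a, i) * P $$ (i, c)) = (if a = c then 1 else 0)" if "a < k" "c < k"
      for a c
    using arg_cong[OF QP, of "\<lambda>X. X $$ (a, c)"] that carr by (simp add: scalar_prod_def
        atLeast0LessThan)
  have p0: "\<exists>i<k. p i \<noteq> 0"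
  proof (rule ccontr)
    assume "\<not> (\<exists>i<k. p i \<noteq> 0)"
    then show False using QP'[of 0 0] k by (simp add: p_def)
  qed
  define d where "d = (\<Sum>i<k. p i * r i)"
  define n where "n = (\<Sum>i<k. (p i)\<^sup>2)"
  have "0 < n" using p0 unfolding n_def by (metis sum_squares_pos)
  define q where "q i = r i - d / n * p i" for i
  have q0: "\<exists>i<k. q i \<noteq> 0"
  proof (rule ccontr)
    assume "\<not> (\<exists>i<k. q i \<noteq> 0)"
    then have "(\<Sum>i<k. Q $$ (1, i) * q i) = 0" by simp
    moreover have "(\<Sum>i<k. Q $$ (1, i) * q i) = (\<Sum>i<k. Q $$ (1, i) * r i) - d / n * (\<Sum>i<k. Q $$
        (1, i) * p i)"
      by (simp add: q_def sum_subtractf sum_distrib_left algebra_simps)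
    ultimately show False using QP'[of 1 1] QP'[of 1 0] k by (simp add: p_def r_def)
  qed
  have pq: "(\<Sum>i<k. p i * q i) = 0"
  proof -
    have "(\<Sum>i<k. p i * q i) = d - d / n * n"
      unfolding q_def d_def n_def sum_distrib_left sum_subtractf[symmetric]
      by (intro sum.cong) (auto simp: power2_eq_square algebra_simps)
    then show ?thesis using \<open>0 < n\<close> by simp
  qed
  \<comment> \<open>symmetry determines the off-diagonal entry \<open>b\<close> of the triangular form\<close>
  have "l * d = (\<Sum>i<k. (\<Sum>j<k. M i j * p j) * r i)"
    by (simp add: Mp d_def sum_distrib_left mult.assoc)
  also have "\<dots> = bform k M r p"
    by (simp add: bform_def sum_distrib_left sum_distrib_right mult_ac)
  also have "\<dots> = bform k M p r" by (rule bform_commute[OF sym])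
  also have "\<dots> = (\<Sum>i<k. p i * (\<Sum>j<k. M i j * r j))"
    by (simp add: bform_def sum_distrib_left mult.assoc)
  also have "\<dots> = (\<Sum>i<k. p i * (b * p i + m * r i))" by (intro sum.cong) (auto simp: Mr)
  also have "\<dots> = b * n + m * d"
    unfolding d_def n_def sum_distrib_left sum.distrib[symmetric]
    by (intro sum.cong) (auto simp: power2_eq_square algebra_simps)
  finally have b: "b = (l - m) * d / n" using \<open>0 < n\<close> by (simp add: field_simps)
  have Mq: "(\<Sum>j<k. M i j * q j) = m * q i" if "i < k" for i
  proof -
    have "(\<Sum>j<k. M i j * q j) = (\<Sum>j<k. M i j * r j) - d / n * (\<Sum>j<k. M i j * p j)"
      by (simp add: q_def sum_subtractf sum_distrib_left algebra_simps)
    also have "\<dots> = b * p i + m * r i - d / n * (l * p i)" using that by (simp add: Mp Mr)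
    also have "\<dots> = m * q i" by (simp add: b q_def diff_divide_distrib algebra_simps)
    finally show ?thesis .
  qed
  show ?thesis by (rule that[OF p0 q0 pq Mp Mq])
qed

text \<open>If no eigenvalue were positive, \<open>- H\<close> would be positive semidefinite, contrary to the
  choice of \<open>e\<close>. Two positive roots of the characteristic polynomial would give a plane on which
  the form is positive definite, and that plane would meet the hyperplane orthogonal to \<open>e\<close>.\<close>

lemma lorentzian_mat_if_reverse_cauchy_schwarz:
  fixes H :: "nat \<Rightarrow> nat \<Rightarrow> real"
  assumes sym: "symmetric_on k H" and det: "det (fmat k H) \<noteq> 0"
    and e: "0 < qform k H e" and neg: "\<And>x. bform k H x e = 0 \<Longrightarrow> qform k H x \<le> 0"
  shows "lorentzian_mat (fmat k H)"
proof -
  let ?A = "fmat k H"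
  obtain es where es: "char_poly ?A = (\<Prod>e\<leftarrow>es. [:- e, 1:])"
    using symmetric_char_poly_splits[OF sym] by blast
  define ps where "ps = filter ((<) 0) es"
  have "ps \<noteq> []"
  proof
    assume "ps = []"
    then have nopos: "poly (char_poly ?A) a \<noteq> 0" if "0 < a" for a
      using that unfolding es ps_def by (induction es) (auto split: if_splits)
    have "psd_on k (\<lambda>i j. - H i j)"
    proof (rule psd_if_pencil_nonsingular)
      show "symmetric_on k (\<lambda>i j. - H i j)" using sym by (simp add: symmetric_on_def)
      fix s :: real
      assume "0 < s"
      have "pencil k (\<lambda>i j. - H i j) 1 (\<lambda>_. s) = s \<cdot>\<^sub>m (- (char_matrix ?A (2 / s)))"
        by (rule eq_matI) (use \<open>0 < s\<close> in \<open>auto simp: pencil_def fmat_def char_matrix_def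
            field_simps\<close>)
      then have "det (pencil k (\<lambda>i j. - H i j) 1 (\<lambda>_. s)) = s ^ k * poly (char_poly ?A) (2 / s)"
        using char_poly_matrix[of ?A k "2 / s"] by (simp add: char_matrix_def fmat_def)
      then show "det (pencil k (\<lambda>i j. - H i j) 1 (\<lambda>_. s)) \<noteq> 0"
        using \<open>0 < s\<close> nopos[of "2 / s"] by simp
    qed
    then have "0 \<le> qform k (\<lambda>i j. - H i j) e" by (simp add: psd_on_def)
    then show False using e by (simp add: bform_def sum_negf)
  qed
  moreover have "\<not> 2 \<le> length ps"
  proof
    assume "2 \<le> length ps"
    then obtain l m ps' where ps: "ps = l # m # ps'"
      by (metis Suc_le_length_iff numeral_2_eq_2)
    then have "l \<in> set ps" "m \<in> set ps" by simp_all
    then have lm: "0 < l" "0 < m" by (auto simp: ps_def)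
    define es' where "es' = ps' @ filter (\<lambda>a. \<not> 0 < a) es"
    have "mset es = mset ps + mset (filter (\<lambda>a. \<not> 0 < a) es)"
      unfolding ps_def mset_filter by (rule multiset_partition)
    then have "mset es = mset (l # m # es')"
      by (simp add: ps es'_def)
    then have "mset (map (\<lambda>e. [:- e, 1:]) es) = mset (map (\<lambda>e. [:- e, 1:]) (l # m # es'))"
      by simp
    then have "char_poly ?A = (\<Prod>e\<leftarrow>l # m # es'. [:- e, 1:])"
      unfolding es by (metis prod_mset_prod_list)
    from orthogonal_eigenvectors[OF sym this] obtain p q where
      pq: "\<exists>i<k. p i \<noteq> 0" "\<exists>i<k. q i \<noteq> 0" "(\<Sum>i<k. p i * q i) = 0"
      and ev: "\<And>i. i < k \<Longrightarrow> (\<Sum>j<k. H i j * p j) = l * p i" "\<And>i. i < k \<Longrightarrow> (\<Sum>j<k. H i j * q j) = m *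
          q i"
      by blast
    have bf: "bform k H x p = l * (\<Sum>i<k. x i * p i)" "bform k H x q = m * (\<Sum>i<k. x i * q i)" for x
      by (simp_all add: bform_def mult.assoc sum_distrib_left[symmetric] ev)
         (simp_all add: sum_distrib_left mult_ac)
    have pos: "0 < qform k H p" "0 < qform k H q"
      using pq(1,2) lm sum_squares_pos[of _ k p] sum_squares_pos[of _ k q]
      by (auto simp: bf power2_eq_square[symmetric])
    have orth: "bform k H p q = 0" by (simp add: bf pq)
    have "\<exists>a b. (a \<noteq> 0 \<or> b \<noteq> 0) \<and> a * bform k H p e + b * bform k H q e = 0"
    proof (cases "bform k H p e = 0")
      case True
      then show ?thesis by (intro exI[of _ 1] exI[of _ 0]) simp
    next
      case False
      then show ?thesis by (intro exI[of _ "bform k H q e"] exI[of _ "- bform k H p e"]) simp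
    qed
    then obtain a b where ab: "a \<noteq> 0 \<or> b \<noteq> 0" "a * bform k H p e + b * bform k H q e = 0" by blast
    then have "qform k H (\<lambda>i. a * p i + b * q i) \<le> 0"
      by (intro neg) (simp add: bform_add_left)
    then have le: "a\<^sup>2 * qform k H p + b\<^sup>2 * qform k H q \<le> 0"
      by (simp add: qform_add[OF sym] orth)
    have "0 \<le> a\<^sup>2 * qform k H p" "0 \<le> b\<^sup>2 * qform k H q" using pos by auto
    with le have "a\<^sup>2 * qform k H p = 0" "b\<^sup>2 * qform k H q = 0" by linarith+
    then show False using ab(1) pos by auto
  qed
  ultimately have "length ps = 1" by (cases ps) (auto simp: Suc_le_eq)
  moreover have "{a. eigenvalue ?A a \<and> 0 < a} = {a. poly (char_poly ?A) a = 0 \<and> 0 < a}"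
    using eigenvalue_root_char_poly[OF fmat_carrier] by blast
  ultimately have "(\<Sum>a\<in>{a. eigenvalue ?A a \<and> 0 < a}. Polynomial.order a (char_poly ?A)) = 1"
    using sum_order_char_poly[OF es] by (simp add: ps_def)
  moreover have "?A\<^sup>T = ?A"
    by (rule eq_matI) (use sym in \<open>auto simp: fmat_def symmetric_on_def\<close>)
  moreover have "invertible_mat ?A"
  proof -
    have one: "inverse (det ?A) \<cdot>\<^sub>m (det ?A \<cdot>\<^sub>m 1\<^sub>m k) = 1\<^sub>m k"
      by (rule eq_matI) (use det in auto)
    have "inverts_mat ?A (inverse (det ?A) \<cdot>\<^sub>m adj_mat ?A)" "inverts_mat (inverse (det ?A) \<cdot>\<^sub>m
        adj_mat ?A) ?A"
      unfolding inverts_mat_def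
      using adj_mat[OF fmat_carrier[of k H]]
      by (auto simp: mult_smult_distrib[of _ k k _ k] mult_smult_assoc_mat[of _ k k _ k] one)
         (simp_all add: fmat_def adj_mat_def)
    then show ?thesis unfolding invertible_mat_def by (auto simp: fmat_def)
  qed
  ultimately show ?thesis unfolding lorentzian_mat_def by blast
qed

section \<open>Roots of univariate polynomials\<close>

text \<open>The logarithmic derivative at \<open>0\<close> is the sum of \<open>1 / (0 - a)\<close> over the roots \<open>a\<close>. All of
  them lie in the open lower half plane, so every summand has negative imaginary part.\<close>

lemma gauss_lucas_half_plane:
  fixes p :: "complex poly"
  assumes deg: "0 < degree p" and nz: "\<And>t. 0 \<le> Im t \<Longrightarrow> poly p t \<noteq> 0"
  shows "Im (poly (pderiv p) 0 / poly p 0) < 0"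
proof -
  obtain as where as: "Polynomial.smult (lead_coeff p) (\<Prod>a\<leftarrow>as. [:- a, 1:]) = p"
    using fundamental_theorem_algebra_factorized by blast
  have lc: "lead_coeff p \<noteq> 0" using deg by auto
  have neg: "Im a < 0" if "a \<in> set as" for a
  proof -
    have "poly (\<Prod>a\<leftarrow>as. [:- a, 1:]) a = 0" using that by (induction as) auto
    then have "poly p a = 0" by (subst as[symmetric]) simp
    then show ?thesis using nz[of a] by fastforce
  qed
  have "as \<noteq> []"
  proof
    assume "as = []"
    then have "p = [:lead_coeff p:]" using as by simp
    then show False using deg by (metis degree_pCons_0 less_numeral_extra(3))
  qed
  define Q where "Q bs = (\<Prod>a\<leftarrow>bs. [:- a, 1:])" for bs :: "complex list"
  have key: "poly (Q bs) 0 \<noteq> 0 \<and> Im (poly (pderiv (Q bs)) 0 / poly (Q bs) 0) \<le> 0 \<and>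
      (bs \<noteq> [] \<longrightarrow> Im (poly (pderiv (Q bs)) 0 / poly (Q bs) 0) < 0)"
    if "\<forall>b\<in>set bs. Im b < 0" for bs
    using that
  proof (induction bs)
    case Nil
    then show ?case by (simp add: Q_def)
  next
    case (Cons b bs)
    have b: "b \<noteq> 0" "Im b < 0" using Cons.prems by auto
    have "Q (b # bs) = [:- b, 1:] * Q bs" by (simp add: Q_def)
    then have "pderiv (Q (b # bs)) = [:- b, 1:] * pderiv (Q bs) + Q bs * pderiv [:- b, 1:]"
      by (simp only: pderiv_mult)
    then have "poly (pderiv (Q (b # bs))) 0 = - b * poly (pderiv (Q bs)) 0 + poly (Q bs) 0"
      by (simp add: pderiv_pCons)
    moreover have "poly (Q (b # bs)) 0 = - b * poly (Q bs) 0" by (simp add: Q_def)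
    ultimately have "poly (pderiv (Q (b # bs))) 0 / poly (Q (b # bs)) 0 =
        poly (pderiv (Q bs)) 0 / poly (Q bs) 0 - inverse b"
      using Cons b by (simp add: field_simps)
    moreover have "0 < Im (inverse b)"
      using b unfolding inverse_complex.simps
      by (intro divide_pos_pos) (auto simp: sum_power2_gt_zero_iff)
    ultimately show ?case using Cons b by (auto simp: Q_def)
  qed
  have "p = Polynomial.smult (lead_coeff p) (Q as)" using as by (simp add: Q_def)
  then have "poly (pderiv p) 0 = lead_coeff p * poly (pderiv (Q as)) 0" "poly p 0 = lead_coeff p
      * poly (Q as) 0"
    by (metis pderiv_smult poly_smult)+
  then have "poly (pderiv p) 0 / poly p 0 = poly (pderiv (Q as)) 0 / poly (Q as) 0"
    using lc by simp
  then show ?thesis using key[of as] neg \<open>as \<noteq> []\<close> by simp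
qed

text \<open>Newton's identity for the second power sum, from the two coefficients below the top one.
  Multiplication by the square of the variable makes these coefficients exist in all degrees,
  which lets the induction start at the empty list.\<close>

lemma sum_squares_of_roots:
  fixes rs :: "real list"
  defines "q \<equiv> pCons 0 (pCons 0 (\<Prod>r\<leftarrow>rs. [:- r, 1:]))"
  shows "coeff q (length rs + 2) = 1 \<and> (\<forall>i>length rs + 2. coeff q i = 0) \<and>
    (\<Sum>r\<leftarrow>rs. r\<^sup>2) = (coeff q (length rs + 1))\<^sup>2 - 2 * coeff q (length rs)"
  unfolding q_def
proof (induction rs)
  case Nil
  show ?case by (auto simp: coeff_pCons one_pCons split: nat.splits)
next
  case (Cons r rs)
  define q where "q = pCons 0 (pCons 0 (\<Prod>r\<leftarrow>rs. [:- r, 1:]))"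
  define n where "n = length rs"
  note IH = Cons.IH[folded q_def n_def]
  have q': "pCons 0 (pCons 0 (\<Prod>r\<leftarrow>r # rs. [:- r, 1:])) = pCons 0 q - Polynomial.smult r q"
    by (simp add: q_def)
  have c: "coeff (pCons 0 q - Polynomial.smult r q) (Suc i) = coeff q i - r * coeff q (Suc i)" for i
    by simp
  have "coeff q (Suc (Suc n)) = 1" "coeff q (Suc (Suc (Suc n))) = 0" using IH by auto
  moreover have "coeff q i = 0" if "n + 2 < i" for i using IH that by blast
  moreover have "coeff (pCons 0 q - Polynomial.smult r q) i = 0" if "Suc n + 2 < i" for i
    using that IH by (cases i) (auto simp: c)
  ultimately show ?case
    unfolding q' using IH by (simp add: c n_def[symmetric] power2_eq_square algebra_simps)
qed

text \<open>The three top coefficients determine the sum of the squares of the roots. If all roots are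
  real, this bounds every root, hence the constant coefficient. For degree at least \<open>3\<close> the
  bound does not involve the constant coefficient itself.\<close>

lemma real_rooted_constant_bound:
  fixes p :: "real poly"
  assumes real: "\<And>z. poly (map_poly complex_of_real p) z = 0 \<Longrightarrow> Im z = 0"
    and deg: "degree p = d" "2 \<le> d"
  shows "\<bar>coeff p 0\<bar> \<le> \<bar>coeff p d\<bar> *
    (1 + ((coeff p (d - 1) / coeff p d)\<^sup>2 - 2 * (coeff p (d - 2) / coeff p d))) ^ d"
proof -
  obtain rs where rs: "p = Polynomial.smult (lead_coeff p) (\<Prod>r\<leftarrow>rs. [:- r, 1:])"
    using real_rooted_splits[OF real] by blast
  define Q where "Q = (\<Prod>r\<leftarrow>rs. [:- r, 1:])"
  have c: "coeff p d \<noteq> 0" using deg by auto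
  have pQ: "p = Polynomial.smult (coeff p d) Q" using rs deg by (simp add: Q_def)
  have Qc: "coeff Q i = coeff p i / coeff p d" for i
    using c arg_cong[OF pQ, of "\<lambda>p. coeff p i"] by (simp add: field_simps)
  have degQ: "degree Q = d" using deg c by (metis pQ degree_smult_eq)
  have shift: "coeff (pCons 0 (pCons 0 Q)) (Suc (Suc i)) = coeff Q i" for i by simp
  have one: "coeff Q (length rs) = 1"
    using sum_squares_of_roots[of rs] by (simp add: Q_def)
  have zero: "\<forall>i>length rs + 2. coeff (pCons 0 (pCons 0 Q)) i = 0"
    using sum_squares_of_roots[of rs] unfolding Q_def by blast
  have "coeff Q i = 0" if "length rs < i" for i
    using zero[rule_format, of "Suc (Suc i)"] that by simp
  then have "degree Q = length rs"
    using one by (intro antisym degree_le le_degree) auto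
  then have len: "length rs = d" using degQ by simp
  define S where "S = (\<Sum>r\<leftarrow>rs. r\<^sup>2)"
  have S: "S = (coeff p (d - 1) / coeff p d)\<^sup>2 - 2 * (coeff p (d - 2) / coeff p d)"
    using sum_squares_of_roots[of rs] deg(2)
    by (auto simp: S_def len Q_def[symmetric] Qc coeff_pCons numeral_2_eq_2 split: nat.splits)
  have "0 \<le> S" unfolding S_def by (intro sum_list_nonneg) auto
  have small: "\<bar>r\<bar> \<le> 1 + S" if "r \<in> set rs" for r
  proof -
    have "r\<^sup>2 \<le> S" unfolding S_def by (rule member_le_sum_list) (use that in auto)
    moreover have "S \<le> (1 + S)\<^sup>2"
      using \<open>0 \<le> S\<close> mult_nonneg_nonneg[of S S] unfolding power2_sum by (simp add: power2_eq_square)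
    ultimately have "\<bar>r\<bar>\<^sup>2 \<le> (1 + S)\<^sup>2" by simp
    then show ?thesis using \<open>0 \<le> S\<close> by (meson abs_ge_zero add_nonneg_nonneg power2_le_imp_le
        zero_le_one)
  qed
  have "\<bar>coeff Q 0\<bar> \<le> (1 + S) ^ length rs"
    using small unfolding Q_def
  proof (induction rs)
    case (Cons r rs)
    have "\<bar>coeff ([:- r, 1:] * (\<Prod>r\<leftarrow>rs. [:- r, 1:])) 0\<bar> = \<bar>r\<bar> * \<bar>coeff (\<Prod>r\<leftarrow>rs. [:- r, 1:]) 0\<bar>"
      by (simp add: abs_mult)
    also have "\<dots> \<le> (1 + S) * (1 + S) ^ length rs"
      using Cons \<open>0 \<le> S\<close> by (intro mult_mono) auto
    finally show ?case by simp
  qed simp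
  then have "\<bar>coeff p 0\<bar> \<le> \<bar>coeff p d\<bar> * (1 + S) ^ d"
    by (subst pQ) (simp add: abs_mult len mult_left_mono)
  then show ?thesis by (simp only: S)
qed

lemma bounded_poly_constant:
  fixes p :: "real poly"
  assumes "\<And>x. \<bar>poly p x\<bar> \<le> B"
  shows "poly p x = poly p y"
proof -
  have "degree p = 0"
  proof (rule ccontr)
    assume "degree p \<noteq> 0"
    then have deg: "0 < degree p" by simp
    \<comment> \<open>the square has a positive leading coefficient whatever the sign of that of \<open>p\<close>\<close>
    let ?r = "[:- (B\<^sup>2):] + p * p"
    have "degree (p * p) = degree p + degree p" using deg by (intro degree_mult_eq) auto
    then have "lead_coeff ?r = lead_coeff (p * p)"
      using deg by (subst lead_coeff_add_le) auto
    also have "lead_coeff (p * p) = lead_coeff p * lead_coeff p" by (rule lead_coeff_mult)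
    finally have "lead_coeff ?r = lead_coeff p * lead_coeff p" .
    moreover have "lead_coeff p \<noteq> 0" using deg by auto
    ultimately have "0 < lead_coeff ?r" by (metis not_real_square_gt_zero)
    then obtain n where "lead_coeff ?r \<le> poly ?r n" using poly_pinfty_gt_lc by blast
    then have "B\<^sup>2 < (poly p n)\<^sup>2" using \<open>0 < lead_coeff ?r\<close> by (simp add: power2_eq_square)
    moreover have "(poly p n)\<^sup>2 \<le> B\<^sup>2" using assms[of n] by (rule abs_le_square_iff[THEN iffD1,
        OF order_trans]) auto
    ultimately show False by simp
  qed
  then show ?thesis by (metis degree_eq_zeroE poly_pCons mult_zero_right poly_0)
qed

section \<open>Strictly stable forms\<close>

text \<open>Stability on the closed upper half planes, up to the real points. The stronger condition
  makes the restriction to every coordinate line a polynomial of full degree, so that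
  derivatives cannot vanish identically. Positivity on the nonnegative orthant only fixes a
  sign.\<close>

definition strictly_stable_form :: "'v set \<Rightarrow> nat \<Rightarrow> ('v, real) mvpoly \<Rightarrow> bool" where
  "strictly_stable_form X d q \<longleftrightarrow> mvars q \<subseteq> X \<and> mhomogeneous d q \<and>
     (\<forall>z. (\<forall>v\<in>X. 0 \<le> Im (z v)) \<and> (\<exists>v\<in>X. 0 < Im (z v)) \<longrightarrow> meval complex_of_real z q \<noteq> 0) \<and>
     (\<forall>y. (\<forall>v\<in>X. 0 \<le> y v) \<and> (\<exists>v\<in>X. 0 < y v) \<longrightarrow> 0 < meval id y q)"

lemma strictly_stable_nonzero:
  assumes "strictly_stable_form X d q" "\<forall>v\<in>X. 0 \<le> Im (z v)" "\<exists>v\<in>X. 0 < Im (z v)"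
  shows "meval complex_of_real z q \<noteq> 0"
  using assms unfolding strictly_stable_form_def by blast

lemma strictly_stable_pos:
  assumes "strictly_stable_form X d q" "\<forall>v\<in>X. 0 \<le> y v" "\<exists>v\<in>X. 0 < y v"
  shows "0 < meval id y q"
  using assms unfolding strictly_stable_form_def by blast

text \<open>No direction leaves the polynomial invariant. For a quadratic form this says that its
  Hessian is nonsingular.\<close>

definition lineality_free :: "'v set \<Rightarrow> ('v, real) mvpoly \<Rightarrow> bool" where
  "lineality_free X q \<longleftrightarrow>
     (\<forall>x. (\<forall>y s. meval id (\<lambda>v. y v + s * x v) q = meval id y q) \<longrightarrow> (\<forall>v\<in>X. x v = 0))"

abbreviation unit_dir :: "'v \<Rightarrow> 'v \<Rightarrow> 'd::zero_neq_one" where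
  "unit_dir v \<equiv> \<lambda>u. if u = v then 1 else 0"

text \<open>On a coordinate line through a point of the closed half planes, all roots lie in the open
  lower half plane, so the derivative does not vanish at the point. At \<open>\<i> y\<close> with real \<open>y\<close> the
  sign of the logarithmic derivative also shows that positivity is inherited.\<close>

lemma strictly_stable_mpderiv:
  assumes q: "strictly_stable_form X d q" and d: "1 \<le> d" and v: "v \<in> X"
  shows "strictly_stable_form X (d - 1) (mpderiv v q)"
proof -
  let ?c = complex_of_real
  have hom: "mhomogeneous d q" using q by (simp add: strictly_stable_form_def)
  have top: "0 < meval id (unit_dir v) q"
    using q v by (auto simp: strictly_stable_form_def)
  have top': "meval ?c (unit_dir v) q = ?c (meval id (unit_dir v) q)"
    using meval_of_real[of "unit_dir v" q] by (simp add: if_distrib[of ?c] cong: if_cong)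
  have quot: "Im (meval ?c z (mpderiv v q) / meval ?c z q) < 0"
    if z: "\<forall>u\<in>X. 0 \<le> Im (z u)" "\<exists>u\<in>X. 0 < Im (z u)" for z
  proof -
    let ?p = "line_poly ?c z (unit_dir v) q"
    have "poly ?p t \<noteq> 0" if t: "0 \<le> Im t" for t
    proof -
      have "\<forall>u\<in>X. 0 \<le> Im (z u + t * unit_dir v u)" using z t by auto
      moreover obtain u where "u \<in> X" "0 < Im (z u)" using z by blast
      then have "\<exists>u\<in>X. 0 < Im (z u + t * unit_dir v u)" using t by (intro bexI[of _ u]) auto
      ultimately show ?thesis unfolding poly_line_poly by (rule strictly_stable_nonzero[OF q])
    qed
    moreover have "coeff ?p d \<noteq> 0" using line_poly_top(2)[OF hom, of ?c z "unit_dir v"] top by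
        (simp add: top')
    then have "0 < degree ?p" using d le_degree[of ?p d] by simp
    ultimately have "Im (poly (pderiv ?p) 0 / poly ?p 0) < 0" by (intro gauss_lucas_half_plane)
    then show ?thesis
      unfolding pderiv_line_poly[OF comm_ring_hom_of_real] poly_line_poly by simp
  qed
  have pos: "0 < meval id y (mpderiv v q)" if y: "\<forall>v\<in>X. 0 \<le> y v" "\<exists>v\<in>X. 0 < y v" for y
  proof -
    let ?a = "meval id y (mpderiv v q)" and ?b = "meval id y q"
    have "0 < ?b" using q y by (simp add: strictly_stable_form_def)
    have "Im (meval ?c (\<lambda>v. \<i> * ?c (y v)) (mpderiv v q) / meval ?c (\<lambda>v. \<i> * ?c (y v)) q) < 0"
      by (rule quot) (use y in auto)
    then have "Im (\<i> ^ (d - 1) * ?c ?a / (\<i> ^ d * ?c ?b)) < 0"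
      using meval_scale[OF mhomogeneous_mpderiv[OF hom, of v], of ?c \<i> "\<lambda>v. ?c (y v)"]
        meval_scale[OF hom, of ?c \<i> "\<lambda>v. ?c (y v)"] by (simp add: meval_of_real)
    moreover have "\<i> ^ (d - 1) * ?c ?a / (\<i> ^ d * ?c ?b) = - \<i> * ?c (?a / ?b)"
    proof -
      have "\<i> ^ d = \<i> * \<i> ^ (d - 1)" using d by (metis Suc_diff_le diff_Suc_1 power_Suc One_nat_def)
      then show ?thesis using \<open>0 < ?b\<close> by (simp add: field_simps)
    qed
    ultimately have "0 < ?a / ?b" by simp
    then show ?thesis using \<open>0 < ?b\<close> by (simp add: zero_less_divide_iff)
  qed
  have "meval ?c z (mpderiv v q) \<noteq> 0" if z: "\<forall>u\<in>X. 0 \<le> Im (z u)" "\<exists>u\<in>X. 0 < Im (z u)" for z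
    using quot[OF z] by auto
  with pos show ?thesis
    using q mhomogeneous_mpderiv[OF hom, of v] mvars_mpderiv[of v q]
    unfolding strictly_stable_form_def by blast
qed

text \<open>Up to a positive factor, a coefficient is the value of an iterated derivative of order
  \<open>d\<close>, and that derivative is a strictly stable constant.\<close>

lemma strictly_stable_coeff_pos:
  assumes "strictly_stable_form X d q" "X \<noteq> {}" "keys m \<subseteq> X" "mdegree m = d"
  shows "0 < mcoeff q m"
  using assms
proof (induction d arbitrary: q m)
  case 0
  then have "0 < meval id (\<lambda>_. 1) q" by (intro strictly_stable_pos[of X 0 q]) auto
  moreover have "meval id (\<lambda>_. 1) q = mcoeff q 0"
    using 0 meval_homogeneous_0[of q id] by (simp add: strictly_stable_form_def)
  ultimately show ?case using 0 by simp
next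
  case (Suc d)
  then have "m \<noteq> 0" by auto
  then obtain v where v: "v \<in> keys m" by (metis keys_eq_empty all_not_in_conv)
  define m' where "m' = m - single v 1"
  have m: "m = m' + single v 1"
    by (rule poly_mapping_eqI)
       (use v in \<open>auto simp: m'_def lookup_add lookup_minus lookup_single when_def in_keys_iff\<close>)
  have "0 < mcoeff (mpderiv v q) m'"
  proof (rule Suc.IH)
    show "strictly_stable_form X d (mpderiv v q)"
      using strictly_stable_mpderiv[of X "Suc d" q v] Suc.prems v by auto
    show "keys m' \<subseteq> X" using Suc.prems(3) unfolding m keys_add_nat by blast
    show "mdegree m' = d" using Suc.prems(4) unfolding m mdegree_add by simp
  qed fact
  then show ?case by (simp add: lookup_mpderiv m zero_less_mult_iff)
qed

lemma map_poly_line_poly: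
  "map_poly complex_of_real (line_poly id y x q) =
     line_poly complex_of_real (\<lambda>v. complex_of_real (y v)) (\<lambda>v. complex_of_real (x v)) q"
proof -
  interpret c: map_poly_inj_idom_hom complex_of_real ..
  show ?thesis
    unfolding line_poly_def by (subst comm_ring_hom_meval[of "map_poly complex_of_real"])
      (unfold_locales, simp add: of_real_hom.map_poly_pCons_hom)
qed

lemma strictly_stable_line_real_rooted:
  assumes q: "strictly_stable_form X d q" and v: "v \<in> X"
    and root: "poly (map_poly complex_of_real (line_poly id y (unit_dir v) q)) z = 0"
  shows "Im z = 0"
proof -
  let ?c = complex_of_real
  have eval: "poly (map_poly ?c (line_poly id y (unit_dir v) q)) t =
      meval ?c (\<lambda>u. ?c (y u) + t * ?c (unit_dir v u)) q" for t
    unfolding map_poly_line_poly poly_line_poly ..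
  have pos: "poly (map_poly ?c (line_poly id y (unit_dir v) q)) t \<noteq> 0" if "0 < Im t" for t
  proof -
    have "\<forall>u\<in>X. 0 \<le> Im (?c (y u) + t * ?c (unit_dir v u))" using that by auto
    moreover have "\<exists>u\<in>X. 0 < Im (?c (y u) + t * ?c (unit_dir v u))" using that v by (intro
        bexI[of _ v]) auto
    ultimately show ?thesis unfolding eval by (rule strictly_stable_nonzero[OF q])
  qed
  have cnj: "comm_ring_hom cnj" by unfold_locales auto
  have "poly (map_poly ?c (line_poly id y (unit_dir v) q)) (cnj z) = cnj (poly (map_poly ?c
      (line_poly id y (unit_dir v) q)) z)"
    unfolding eval by (subst comm_ring_hom_meval[OF cnj]) simp
  then have "poly (map_poly ?c (line_poly id y (unit_dir v) q)) (cnj z) = 0" using root by simp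
  then show ?thesis using pos[of z] pos[of "cnj z"] root by fastforce
qed

text \<open>If the derivative in direction \<open>v\<close> is invariant under translation by \<open>s x\<close>, then the
  restrictions of \<open>q\<close> to the lines through \<open>y + s x\<close> in direction \<open>v\<close> differ only in their
  constant coefficients. These restrictions are real-rooted of degree at least \<open>3\<close>, so the
  constant coefficients \<open>q (y + s x)\<close> stay bounded; being polynomial in \<open>s\<close>, they are constant,
  and \<open>q\<close> itself is invariant.\<close>

lemma lineality_free_mpderiv:
  assumes q: "strictly_stable_form X d q" and d: "3 \<le> d" and lin: "lineality_free X q" and v: "v
      \<in> X"
  shows "lineality_free X (mpderiv v q)"
  unfolding lineality_free_def
proof (intro allI impI)
  fix x
  assume const: "\<forall>y s. meval id (\<lambda>u. y u + s * x u) (mpderiv v q) = meval id y (mpderiv v q)"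
  have hom: "mhomogeneous d q" using q by (simp add: strictly_stable_form_def)
  have "meval id (\<lambda>u. y u + s * x u) q = meval id y q" for y s
  proof -
    define \<phi> where "\<phi> s = line_poly id (\<lambda>u. y u + s * x u) (unit_dir v) q" for s
    have pd: "pderiv (\<phi> s) = pderiv (\<phi> 0)" for s
    proof -
      have "poly (pderiv (\<phi> s)) t = poly (pderiv (\<phi> 0)) t" for t
        using const[rule_format, of "\<lambda>u. y u + t * unit_dir v u" s]
        unfolding \<phi>_def pderiv_line_poly[OF comm_ring_hom_id] poly_line_poly
        by (simp add: add_ac)
      then show ?thesis by (simp add: poly_eq_poly_eq_iff[symmetric] fun_eq_iff)
    qed
    have coeffs: "coeff (\<phi> s) (Suc i) = coeff (\<phi> 0) (Suc i)" for s i
      using arg_cong[OF pd[of s], of "\<lambda>p. coeff p i"] by (simp add: coeff_pderiv)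
    have top: "coeff (\<phi> s) d = meval id (unit_dir v) q" "degree (\<phi> s) \<le> d" for s
      using line_poly_top[OF hom, of id] by (auto simp: \<phi>_def)
    have "0 < meval id (unit_dir v) q" using q v by (auto simp: strictly_stable_form_def)
    then have deg: "degree (\<phi> s) = d" for s
      using top[of s] le_degree[of "\<phi> s" d] by simp
    define B where "B = \<bar>coeff (\<phi> 0) d\<bar> *
      (1 + ((coeff (\<phi> 0) (d - 1) / coeff (\<phi> 0) d)\<^sup>2 - 2 * (coeff (\<phi> 0) (d - 2) / coeff (\<phi> 0)
          d))) ^ d"
    have "\<bar>coeff (\<phi> s) 0\<bar> \<le> B" for s
    proof -
      have eq: "coeff (\<phi> s) i = coeff (\<phi> 0) i" if "i \<noteq> 0" for i
        using coeffs[of s "i - 1"] that by simp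
      have "\<bar>coeff (\<phi> s) 0\<bar> \<le> \<bar>coeff (\<phi> s) d\<bar> *
        (1 + ((coeff (\<phi> s) (d - 1) / coeff (\<phi> s) d)\<^sup>2 - 2 * (coeff (\<phi> s) (d - 2) / coeff (\<phi> s)
            d))) ^ d"
        by (rule real_rooted_constant_bound)
           (use strictly_stable_line_real_rooted[OF q v] d deg in \<open>auto simp: \<phi>_def\<close>)
      also have "\<dots> = B" using d by (simp add: B_def eq)
      finally show ?thesis .
    qed
    moreover have "coeff (\<phi> s) 0 = poly (line_poly id y x q) s" for s
      unfolding poly_0_coeff_0[symmetric] \<phi>_def poly_line_poly by simp
    ultimately have "\<bar>poly (line_poly id y x q) s\<bar> \<le> B" for s by simp
    from bounded_poly_constant[OF this, of s 0] show ?thesis by (simp add: poly_line_poly)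
  qed
  then show "\<forall>u\<in>X. x u = 0" using lin unfolding lineality_free_def by blast
qed

section \<open>Hessians of strictly stable quadratic forms\<close>

lemma sum_set_nth:
  assumes "distinct xs"
  shows "(\<Sum>v\<in>set xs. f v) = (\<Sum>i<length xs. f (xs ! i))"
  using sum_list_distinct_conv_sum_set[OF assms, of f]
  by (simp add: sum_list_sum_nth atLeast0LessThan)

lemma obtain_labelling:
  assumes "distinct xs"
  obtains z where "\<And>i. i < length xs \<Longrightarrow> z (xs ! i) = x i"
proof
  fix i assume "i < length xs"
  then have "(THE j. j < length xs \<and> xs ! j = xs ! i) = i"
    by (intro the_equality) (use assms in \<open>auto simp: nth_eq_iff_index_eq\<close>)
  then show "(\<lambda>v. x (THE j. j < length xs \<and> xs ! j = v)) (xs ! i) = x i" by simp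
qed

lemma quadratic_hessian:
  fixes g :: "('v, real) mvpoly"
  assumes xs: "distinct xs" and g: "mhomogeneous 2 g" "mvars g \<subseteq> set xs"
  shows "qform (length xs) (\<lambda>i j. mcoeff (mpderiv (xs ! i) (mpderiv (xs ! j) g)) 0) (\<lambda>i. z (xs !
      i)) = 2 * meval id z g"
proof -
  have d1: "meval id z (mpderiv v g) = (\<Sum>u\<in>set xs. z u * mcoeff (mpderiv u (mpderiv v g)) 0)" for v
  proof -
    have h1: "mhomogeneous 1 (mpderiv v g)" using mhomogeneous_mpderiv[OF g(1), of v] by simp
    have h0: "mhomogeneous 0 (mpderiv u (mpderiv v g))" for u using mhomogeneous_mpderiv[OF h1,
        of u] by simp
    have "(\<Sum>u\<in>set xs. z u * meval id z (mpderiv u (mpderiv v g))) = real 1 * meval id z (mpderiv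
        v g)"
      by (rule euler_homogeneous[OF h1]) (use g(2) mvars_mpderiv[of v g] in auto)
    then show ?thesis using meval_homogeneous_0[OF h0, of id z] by simp
  qed
  have "2 * meval id z g = (\<Sum>v\<in>set xs. z v * meval id z (mpderiv v g))"
    using euler_homogeneous[OF g(1,2), of z] by simp
  also have "\<dots> = (\<Sum>j<length xs. \<Sum>i<length xs. z (xs ! j) * (z (xs ! i) * mcoeff (mpderiv (xs !
      i) (mpderiv (xs ! j) g)) 0))"
    unfolding d1 sum_set_nth[OF xs] sum_distrib_left ..
  also have "\<dots> = qform (length xs) (\<lambda>i j. mcoeff (mpderiv (xs ! i) (mpderiv (xs ! j) g)) 0) (\<lambda>i.
      z (xs ! i))"
    unfolding bform_def by (subst sum.swap) (simp add: mult_ac)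
  finally show ?thesis by simp
qed

text \<open>Real-rootedness on the lines in a coordinate direction \<open>e\<close> is a condition on the
  discriminant, namely the reverse inequality of Cauchy and Schwarz with respect to \<open>e\<close>. A
  kernel vector of the Hessian would be a direction of invariance.\<close>

lemma strictly_stable_hessian:
  assumes xs: "distinct xs" "xs \<noteq> []" and g: "strictly_stable_form (set xs) 2 g" and lin:
      "lineality_free (set xs) g"
  shows "lorentzian_mat (hessian_mat xs g)"
proof -
  let ?c = complex_of_real
  define n where "n = length xs"
  define H where "H i j = mcoeff (mpderiv (xs ! i) (mpderiv (xs ! j) g)) 0" for i j
  have hom: "mhomogeneous 2 g" "mvars g \<subseteq> set xs" using g by (auto simp: strictly_stable_form_def)
  have H: "qform n H (\<lambda>i. z (xs ! i)) = 2 * meval id z g" for z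
    using quadratic_hessian[OF xs(1) hom, of z] by (simp add: n_def H_def[abs_def])
  have sym: "symmetric_on n H" by (simp add: symmetric_on_def H_def mpderiv_commute)
  have qcong: "bform n H x y = bform n H x' y'" if "\<And>i. i < n \<Longrightarrow> x i = x' i" "\<And>i. i < n \<Longrightarrow> y i =
      y' i" for x y x' y'
    unfolding bform_def by (intro sum.cong) (use that in auto)
  have H': "qform n H x = 2 * meval id z g" if "\<And>i. i < n \<Longrightarrow> z (xs ! i) = x i" for x z
    unfolding H[symmetric] by (rule qcong) (simp_all add: that)
  have n: "0 < n" using xs by (simp add: n_def)
  define v where "v = xs ! 0"
  have v: "v \<in> set xs" using n by (simp add: v_def n_def)
  define e where "e i = (unit_dir v (xs ! i) :: real)" for i
  have gv: "0 < meval id (unit_dir v) g" using g v by (auto simp: strictly_stable_form_def)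
  have He: "0 < qform n H e" using gv H[of "unit_dir v"] by (simp add: e_def[abs_def])
  have "qform n H x \<le> 0" if orth: "bform n H x e = 0" for x
  proof (rule ccontr)
    assume "\<not> qform n H x \<le> 0"
    obtain z where z: "\<And>i. i < n \<Longrightarrow> z (xs ! i) = x i"
      using obtain_labelling[OF xs(1)] unfolding n_def by blast
    have gz: "0 < meval id z g" using \<open>\<not> qform n H x \<le> 0\<close> H'[of z x, OF z] by simp
    have "line_poly id z (unit_dir v) g = [:meval id z g, 0, meval id (unit_dir v) g:]"
    proof -
      have "poly (line_poly id z (unit_dir v) g) t = poly [:meval id z g, 0, meval id (unit_dir
          v) g:] t" for t
      proof -
        have "2 * meval id (\<lambda>u. z u + t * unit_dir v u) g = qform n H (\<lambda>i. 1 * x i + t * e i)"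
          by (rule H'[symmetric]) (simp add: z e_def)
        also have "\<dots> = qform n H x + t\<^sup>2 * qform n H e"
          unfolding qform_add[OF sym] orth by simp
        also have "\<dots> = 2 * meval id z g + t\<^sup>2 * (2 * meval id (unit_dir v) g)"
          using H'[of z x, OF z] H[of "unit_dir v"] by (simp add: e_def[abs_def])
        finally show ?thesis by (simp add: poly_line_poly power2_eq_square algebra_simps)
      qed
      then show ?thesis by (simp add: poly_eq_poly_eq_iff[symmetric] fun_eq_iff)
    qed
    \<comment> \<open>as both values are positive, the restriction has the non-real root \<open>\<i> s\<close>\<close>
    moreover define s where "s = sqrt (meval id z g / meval id (unit_dir v) g)"
    have "s * s * meval id (unit_dir v) g = meval id z g" using gz gv by (simp add: s_def)
    then have "?c s * ?c s * ?c (meval id (unit_dir v) g) = ?c (meval id z g)"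
      by (metis of_real_mult)
    then have "poly (map_poly ?c [:meval id z g, 0, meval id (unit_dir v) g:]) (\<i> * ?c s) = 0"
      by (simp add: of_real_hom.map_poly_pCons_hom algebra_simps)
    ultimately have "Im (\<i> * ?c s) = 0"
      by (intro strictly_stable_line_real_rooted[OF g v, of z]) simp
    then show False using gz gv by (simp add: s_def)
  qed
  moreover have "det (fmat n H) \<noteq> 0"
  proof
    assume "det (fmat n H) = 0"
    then obtain x where x: "\<exists>i<n. x i \<noteq> 0" "\<forall>i<n. (\<Sum>j<n. H i j * x j) = 0"
      by (auto simp: det_fmat_eq_0_iff)
    obtain z where z: "\<And>i. i < n \<Longrightarrow> z (xs ! i) = x i"
      using obtain_labelling[OF xs(1)] unfolding n_def by blast
    have bx: "bform n H y x = 0" for y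
      using x(2) by (simp add: bform_def mult.assoc sum_distrib_left[symmetric])
    have "meval id (\<lambda>v. y v + s * z v) g = meval id y g" for y s
    proof -
      have "2 * meval id (\<lambda>v. y v + s * z v) g = qform n H (\<lambda>i. 1 * y (xs ! i) + s * x i)"
        by (rule H'[symmetric]) (simp add: z)
      also have "\<dots> = qform n H (\<lambda>i. y (xs ! i))" unfolding qform_add[OF sym] bx by simp
      finally show ?thesis by (simp add: H)
    qed
    then have "\<forall>v\<in>set xs. z v = 0" using lin unfolding lineality_free_def by blast
    then show False using x(1) z by (auto simp: n_def)
  qed
  moreover have "hessian_mat xs g = fmat n H"
    by (simp add: hessian_mat_def indexed_mat_def fmat_def H_def n_def)
  ultimately show ?thesis using lorentzian_mat_if_reverse_cauchy_schwarz[OF sym _ He] by simp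
qed

lemma strictly_lorentzian_if_strictly_stable:
  assumes xs: "distinct xs" "xs \<noteq> []" and d: "2 \<le> d"
    and q: "strictly_stable_form (set xs) d q" and lin: "lineality_free (set xs) q"
  shows "strictly_lorentzian xs d q"
proof -
  have "lorentzian_mat (hessian_mat xs (fold mpderiv js q))"
    if "set js \<subseteq> set xs" "length js = d - 2" for js
    using that d q lin
  proof (induction js arbitrary: d q)
    case Nil
    then show ?case using strictly_stable_hessian[OF xs, of q] by simp
  next
    case (Cons j js)
    have "3 \<le> d" using Cons.prems by simp
    then show ?case
      using Cons.IH[of "d - 1" "mpderiv j q"] Cons.prems
        strictly_stable_mpderiv[of "set xs" d q j] lineality_free_mpderiv[of "set xs" d q j] by simp
  qed
  then show ?thesis
    using q strictly_stable_coeff_pos[OF q] xs(2)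
    unfolding strictly_lorentzian_def by (auto simp: strictly_stable_form_def)
qed

section \<open>Coefficientwise limits\<close>

definition coeffs_tendsto :: "(nat \<Rightarrow> ('v, real) mvpoly) \<Rightarrow> ('v, real) mvpoly \<Rightarrow> bool" where
  "coeffs_tendsto q p \<longleftrightarrow> (\<forall>m. (\<lambda>i. mcoeff (q i) m) \<longlonglongrightarrow> mcoeff p m)"

text \<open>Hence a coefficient of a product is a finite sum over an index set that does not depend on
  the factors, and passes to the limit.\<close>

lemma finite_splittings:
  fixes m :: "'v \<Rightarrow>\<^sub>0 nat"
  shows "finite {(a, b). a + b = m}"
proof -
  let ?S = "{(a, b). a + b = m}" and ?K = "keys m"
  let ?f = "\<lambda>(a, b :: 'v \<Rightarrow>\<^sub>0 nat). restrict (lookup a) ?K"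
  have le: "lookup a v \<le> lookup m v" if "a + b = m" for a b v
    using that by (auto simp: lookup_add)
  have "?f ` ?S \<subseteq> Pi\<^sub>E ?K (\<lambda>v. {..lookup m v})"
    using le by (auto simp: PiE_def)
  then have "finite (?f ` ?S)" by (rule finite_subset) (intro finite_PiE, auto)
  moreover have "inj_on ?f ?S"
  proof (rule inj_onI, clarify)
    fix a b a' b' :: "'v \<Rightarrow>\<^sub>0 nat"
    assume m: "m = a + b" "a' + b' = a + b"
      and eq: "restrict (lookup a) (keys (a + b)) =
        restrict (lookup a') (keys (a + b))"
    have "a = a'"
    proof (rule poly_mapping_eqI)
      fix v
      show "lookup a v = lookup a' v"
      proof (cases "v \<in> keys (a + b)")
        case True
        then show ?thesis using fun_cong[OF eq, of v] by simp
      next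
        case False
        then have "v \<notin> keys (a' + b')" using m by simp
        with False show ?thesis unfolding keys_add_nat by (simp add: in_keys_iff)
      qed
    qed
    then show "a = a' \<and> b = b'" using m by simp
  qed
  ultimately show ?thesis by (rule finite_imageD)
qed

lemma lookup_mult_splittings:
  fixes p q :: "('v, 'c::comm_ring_1) mvpoly"
  shows "mcoeff (p * q) m = (\<Sum>(a, b)\<in>{(a, b). a + b = m}. mcoeff p a * mcoeff q b)"
proof -
  let ?K = "keys p \<times> keys q" and ?S = "{(a, b). a + b = m}"
  have "mcoeff (p * q) m = (\<Sum>(a, b)\<in>?K. if (a, b) \<in> ?S then mcoeff p a * mcoeff q b else 0)"
    by (simp add: mvpoly_mult_monomials lookup_sum lookup_single when_def sum.cartesian_product
        case_prod_beta)
  also have "\<dots> = (\<Sum>(a, b)\<in>?K \<inter> ?S. mcoeff p a * mcoeff q b)"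
    by (subst sum.inter_restrict) (auto intro!: sum.cong)
  also have "\<dots> = (\<Sum>(a, b)\<in>?S. mcoeff p a * mcoeff q b)"
    by (rule sum.mono_neutral_left) (use finite_splittings in \<open>auto simp: in_keys_iff\<close>)
  finally show ?thesis .
qed

lemma coeffs_tendsto_const: "coeffs_tendsto (\<lambda>_. p) p"
  by (simp add: coeffs_tendsto_def)

lemma coeffs_tendsto_mconst: "c \<longlonglongrightarrow> l \<Longrightarrow> coeffs_tendsto (\<lambda>i. mconst (c i)) (mconst l)"
  by (simp add: coeffs_tendsto_def mconst_def lookup_single when_def)

lemma coeffs_tendsto_add: "coeffs_tendsto p p' \<Longrightarrow> coeffs_tendsto q q' \<Longrightarrow> coeffs_tendsto (\<lambda>i. p i +
    q i) (p' + q')"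
  by (simp add: coeffs_tendsto_def lookup_add tendsto_add)

lemma coeffs_tendsto_if:
  "(b \<Longrightarrow> coeffs_tendsto p p') \<Longrightarrow> (\<not> b \<Longrightarrow> coeffs_tendsto q q') \<Longrightarrow>
    coeffs_tendsto (\<lambda>i. if b then p i else q i) (if b then p' else q')"
  by (cases b) simp_all

lemma coeffs_tendsto_sum:
  "(\<And>j. j \<in> J \<Longrightarrow> coeffs_tendsto (p j) (p' j)) \<Longrightarrow> coeffs_tendsto (\<lambda>i. \<Sum>j\<in>J. p j i) (\<Sum>j\<in>J. p' j)"
  by (simp add: coeffs_tendsto_def lookup_sum tendsto_sum)

lemma coeffs_tendsto_mult: "coeffs_tendsto p p' \<Longrightarrow> coeffs_tendsto q q' \<Longrightarrow> coeffs_tendsto (\<lambda>i. p i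
    * q i) (p' * q')"
  unfolding coeffs_tendsto_def lookup_mult_splittings case_prod_beta
  by (intro allI tendsto_sum tendsto_mult) auto

lemma coeffs_tendsto_prod:
  "(\<And>j. j \<in> J \<Longrightarrow> coeffs_tendsto (p j) (p' j)) \<Longrightarrow> coeffs_tendsto (\<lambda>i. \<Prod>j\<in>J. p j i) (\<Prod>j\<in>J. p' j)"
proof (induction J rule: infinite_finite_induct)
  case (insert j J)
  then show ?case by (simp add: coeffs_tendsto_mult)
qed (simp_all add: coeffs_tendsto_const)

lemma coeffs_tendsto_det:
  assumes "\<And>i. A i \<in> carrier_mat k k" "B \<in> carrier_mat k k"
    and "\<And>r c. r < k \<Longrightarrow> c < k \<Longrightarrow> coeffs_tendsto (\<lambda>i. A i $$ (r, c)) (B $$ (r, c))"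
  shows "coeffs_tendsto (\<lambda>i. det (A i)) (det B)"
  unfolding det_def'[OF assms(1)] det_def'[OF assms(2)]
proof (intro coeffs_tendsto_sum coeffs_tendsto_mult coeffs_tendsto_const coeffs_tendsto_prod
    assms(3))
  fix p j
  assume "p \<in> {p. p permutes {0..<k}}" "j \<in> {0..<k}"
  then show "p j < k" using permutes_in_image[of p "{0..<k}" j] by simp
qed auto

section \<open>Approximation of determinantal pencils\<close>

text \<open>The zero polynomial is included, so that sums and scalar multiples stay in the set.\<close>

definition linear_form :: "'v set \<Rightarrow> ('v, 'c::zero) mvpoly \<Rightarrow> bool" where
  "linear_form X q \<longleftrightarrow> (\<forall>m\<in>keys q. keys m \<subseteq> X \<and> mdegree m = 1)"

lemma keys_mconst_mult:
  fixes q :: "('v, 'c::comm_ring_1) mvpoly"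
  shows "keys (mconst c * q) \<subseteq> keys q"
proof
  fix m assume "m \<in> keys (mconst c * q)"
  then obtain a b where "m = a + b" "a \<in> keys (mconst c :: ('v, 'c) mvpoly)" "b \<in> keys q"
    using keys_mult by blast
  then show "m \<in> keys q" by (auto simp: mconst_def split: if_splits)
qed

lemma linear_form_mvar: "v \<in> X \<Longrightarrow> linear_form X (mvar v :: ('v, 'c::zero_neq_one) mvpoly)"
  by (auto simp: linear_form_def mvar_def)

lemma linear_form_mconst_mult: "linear_form X q \<Longrightarrow> linear_form X (mconst c * q :: ('v,
    'c::comm_ring_1) mvpoly)"
  using keys_mconst_mult[of c q] unfolding linear_form_def by blast

lemma linear_form_add: "linear_form X p \<Longrightarrow> linear_form X q \<Longrightarrow> linear_form X (p + q :: ('v,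
    'c::comm_ring_1) mvpoly)"
  using keys_add[of p q] unfolding linear_form_def by blast

lemma linear_form_zero [simp]: "linear_form X 0"
  by (simp add: linear_form_def)

lemma linear_form_sum:
  "(\<And>i. i \<in> I \<Longrightarrow> linear_form X (p i :: ('v, 'c::comm_ring_1) mvpoly)) \<Longrightarrow> linear_form X (\<Sum>i\<in>I. p i)"
  by (induction I rule: infinite_finite_induct) (auto intro: linear_form_add)

lemma mconst_two: "(2 :: ('v, 'c::comm_ring_1) mvpoly) = mconst 2"
  by (simp add: mconst_def)

lemma pencil_homogeneous:
  fixes M :: "nat \<Rightarrow> nat \<Rightarrow> 'c::comm_ring_1"
  assumes "linear_form X L0" "\<And>j. j < k \<Longrightarrow> linear_form X (L j)"
  shows "mvars (det (pencil k (\<lambda>i j. mconst (M i j)) L0 L)) \<subseteq> X"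
    and "mhomogeneous k (det (pencil k (\<lambda>i j. mconst (M i j)) L0 L))"
proof -
  let ?A = "pencil k (\<lambda>i j. mconst (M i j)) L0 L"
  have "keys m \<subseteq> X \<and> mdegree m = (\<Sum>j<k. 1)" if "m \<in> keys (det ?A)" for m
  proof (rule keys_det_graded[where R = "\<lambda>n m. keys m \<subseteq> X \<and> mdegree m = n" and d = "\<lambda>_. 1", OF _
      _ _ _ that])
    fix i j m
    assume ij: "i < k" "j < k" and m: "m \<in> keys (?A $$ (i, j))"
    have "linear_form X (?A $$ (i, j))"
      using ij assms
      by (auto simp: pencil_def mconst_two intro!: linear_form_add linear_form_mconst_mult)
    then show "keys m \<subseteq> X \<and> mdegree m = 1" using m by (auto simp: linear_form_def)
  qed (auto simp: keys_add_nat mdegree_add)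
  then show "mvars (det ?A) \<subseteq> X" "mhomogeneous k (det ?A)"
    by (auto simp: mvars_def mhomogeneous_def in_keys_iff)
qed

text \<open>The determinant of the pencil after two changes: \<open>M\<close> becomes positive definite by adding
  \<open>\<delta> Id\<close>, and every variable is replaced by itself plus \<open>\<delta>\<close> times the sum of all variables. The
  substitution moves nonzero points of the closed half planes into the open ones, and the first
  change removes all directions of invariance. For a complete multipartite graph the unperturbed
  form depends only on the sums of the variables over the parts, so it has such directions as
  soon as a part has two vertices.\<close>

definition perturbed_form :: "'v list \<Rightarrow> nat \<Rightarrow> (nat \<Rightarrow> nat \<Rightarrow> real) \<Rightarrow> real \<Rightarrow> ('v, real) mvpoly" where
  "perturbed_form xs k M \<delta> =
     (let L = (\<lambda>j. mvar (xs ! j) + mconst \<delta> * (\<Sum>v\<in>set xs. mvar v))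
      in det (pencil k (\<lambda>i j. mconst (M i j + (if i = j then \<delta> else 0))) (L 0) (\<lambda>j. L (Suc j))))"

lemma meval_perturbed_form:
  assumes "comm_ring_hom h"
  shows "meval h z (perturbed_form xs k M \<delta>) =
    det (pencil k (\<lambda>i j. h (M i j + (if i = j then \<delta> else 0)))
      (z (xs ! 0) + h \<delta> * (\<Sum>v\<in>set xs. z v)) (\<lambda>j. z (xs ! Suc j) + h \<delta> * (\<Sum>v\<in>set xs. z v)))"
proof -
  interpret h: comm_ring_hom h by fact
  interpret m: comm_ring_hom "meval h z" by (rule meval_comm_ring_hom) fact
  show ?thesis
    unfolding perturbed_form_def Let_def hom_det_pencil[OF m.comm_ring_hom_axioms]
    by (simp add: m.hom_add m.hom_mult m.hom_sum)
qed

context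
  fixes xs :: "'v list" and k :: nat and M :: "nat \<Rightarrow> nat \<Rightarrow> real"
  assumes xs: "distinct xs" "length xs = Suc k" and k: "2 \<le> k"
    and sym: "symmetric_on k M" and psd: "psd_on k M"
    and off: "\<And>i j. i < k \<Longrightarrow> j < k \<Longrightarrow> i \<noteq> j \<Longrightarrow> M i j \<noteq> 0"
begin

lemma perturbed_matrix:
  assumes "0 < \<delta>"
  shows "symmetric_on k (\<lambda>i j. M i j + (if i = j then \<delta> else 0))"
    and "pd_on k (\<lambda>i j. M i j + (if i = j then \<delta> else 0))"
    and "psd_on k (\<lambda>i j. M i j + (if i = j then \<delta> else 0))"
proof -
  let ?M = "\<lambda>i j. M i j + (if i = j then \<delta> else 0)"
  show "symmetric_on k ?M" using sym by (simp add: symmetric_on_def)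
  have q: "qform k ?M x = qform k M x + \<delta> * (\<Sum>i<k. (x i)\<^sup>2)" for x
  proof -
    have "qform k ?M x = (\<Sum>i<k. \<Sum>j<k. x i * M i j * x j + (if j = i then \<delta> * (x i)\<^sup>2 else 0))"
      unfolding bform_def by (intro sum.cong) (auto simp: power2_eq_square algebra_simps)
    then show ?thesis by (simp add: sum.distrib bform_def sum_distrib_left)
  qed
  show "pd_on k ?M"
    unfolding pd_on_def q
  proof (intro allI impI)
    fix x :: "nat \<Rightarrow> real" assume "\<exists>i<k. x i \<noteq> 0"
    then have "0 < (\<Sum>i<k. (x i)\<^sup>2)" using sum_squares_pos by blast
    then show "0 < qform k M x + \<delta> * (\<Sum>i<k. (x i)\<^sup>2)"
      using psd assms by (intro add_nonneg_pos) (auto simp: psd_on_def)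
  qed
  show "psd_on k ?M"
    unfolding psd_on_def q using psd assms by (auto simp: psd_on_def intro!: add_nonneg_nonneg
        mult_nonneg_nonneg sum_nonneg)
qed

lemma nth_in_set: "j < k \<Longrightarrow> xs ! Suc j \<in> set xs" "xs ! 0 \<in> set xs" "set xs \<noteq> {}"
  using xs by auto

lemma perturbed_form_shape:
  "mvars (perturbed_form xs k M \<delta>) \<subseteq> set xs" "mhomogeneous k (perturbed_form xs k M \<delta>)"
proof -
  have lin: "linear_form (set xs) (mvar (xs ! j) + mconst \<delta> * (\<Sum>v\<in>set xs. mvar v))" if "j \<le> k" for j
    using that xs by (intro linear_form_add linear_form_mconst_mult linear_form_sum
        linear_form_mvar) auto
  show "mvars (perturbed_form xs k M \<delta>) \<subseteq> set xs" "mhomogeneous k (perturbed_form xs k M \<delta>)"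
    unfolding perturbed_form_def Let_def by (rule pencil_homogeneous[where X = "set xs"]; use
        lin in simp)+
qed

lemma perturbed_form_strictly_stable:
  assumes \<delta>: "0 < \<delta>"
  shows "strictly_stable_form (set xs) k (perturbed_form xs k M \<delta>)"
  unfolding strictly_stable_form_def
proof (intro conjI allI impI perturbed_form_shape)
  fix z :: "'v \<Rightarrow> complex"
  assume z: "(\<forall>v\<in>set xs. 0 \<le> Im (z v)) \<and> (\<exists>v\<in>set xs. 0 < Im (z v))"
  then obtain u where u: "u \<in> set xs" "0 < Im (z u)" by blast
  have "0 < (\<Sum>v\<in>set xs. Im (z v))" using z u by (intro sum_pos2[of _ u]) auto
  then have pos: "0 < Im (z v + complex_of_real \<delta> * (\<Sum>v\<in>set xs. z v))" if "v \<in> set xs" for v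
    using z that \<delta> by (auto intro!: add_nonneg_pos)
  have w0: "0 < Im (z (xs ! 0) + complex_of_real \<delta> * (\<Sum>v\<in>set xs. z v))"
    by (rule pos[OF nth_in_set(2)])
  then have "z (xs ! 0) + complex_of_real \<delta> * (\<Sum>v\<in>set xs. z v) \<noteq> 0"
    by (metis less_irrefl zero_complex.sel(2))
  then show "meval complex_of_real z (perturbed_form xs k M \<delta>) \<noteq> 0"
    unfolding meval_perturbed_form[OF comm_ring_hom_of_real]
    using w0 pos[OF nth_in_set(1)]
    by (intro det_pencil_nonzero perturbed_matrix \<delta>) simp_all
next
  fix y :: "'v \<Rightarrow> real"
  assume y: "(\<forall>v\<in>set xs. 0 \<le> y v) \<and> (\<exists>v\<in>set xs. 0 < y v)"
  then obtain u where u: "u \<in> set xs" "0 < y u" by blast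
  have "0 < (\<Sum>v\<in>set xs. y v)" using y u by (intro sum_pos2[of _ u]) auto
  then have pos: "0 < y v + id \<delta> * (\<Sum>v\<in>set xs. y v)" if "v \<in> set xs" for v
    using y that \<delta> by (auto intro!: add_nonneg_pos)
  show "0 < meval id y (perturbed_form xs k M \<delta>)"
    unfolding meval_perturbed_form[OF comm_ring_hom_id] id_apply[of "M _ _ + _"]
    using pos nth_in_set by (intro det_pencil_pos perturbed_matrix \<delta>) auto
qed

text \<open>The linear substitution is invertible, so a direction of invariance \<open>x\<close> corresponds to one
  of the pencil, which vanishes. The base point \<open>y\<close> is the preimage of \<open>(1/2, 0)\<close>, where the
  pencil is the identity matrix.\<close>

lemma perturbed_form_lineality_free:
  assumes \<delta>: "0 < \<delta>"
  shows "lineality_free (set xs) (perturbed_form xs k M \<delta>)"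
  unfolding lineality_free_def
proof (intro allI impI)
  fix x :: "'v \<Rightarrow> real"
  assume const: "\<forall>y s. meval id (\<lambda>v. y v + s * x v) (perturbed_form xs k M \<delta>) = meval id y
      (perturbed_form xs k M \<delta>)"
  let ?M = "\<lambda>i j. M i j + (if i = j then \<delta> else 0)"
  let ?X = "set xs" and ?n = "real (card (set xs))"
  define t where "t = (\<Sum>v\<in>?X. x v)"
  \<comment> \<open>the substitution maps \<open>y\<close> to \<open>y + c\<close>, so \<open>c\<close> has to be \<open>\<delta>\<close> times the sum of the coordinates
      of \<open>y\<close>\<close>
  define c where "c = \<delta> * (1 / 2) / (1 + \<delta> * ?n)"
  define y where "y v = (if v = xs ! 0 then 1 / 2 else 0) - c" for v
  have pos: "0 < 1 + \<delta> * ?n" using \<delta> by (intro add_pos_nonneg) auto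
  have sum_y: "c = \<delta> * (\<Sum>v\<in>?X. y v)"
  proof -
    have "(\<Sum>v\<in>?X. y v) = 1 / 2 - ?n * c"
      using nth_in_set(2) by (simp add: y_def sum_subtractf)
    then show ?thesis using pos by (simp add: c_def field_simps)
  qed
  have x0: "xs ! Suc j \<noteq> xs ! 0" if "j < k" for j
    using that xs nth_eq_iff_index_eq[of xs "Suc j" 0] by simp
  have eval: "meval id (\<lambda>v. y v + s * x v) (perturbed_form xs k M \<delta>) =
      det (pencil k ?M (1 / 2 + s * (x (xs ! 0) + \<delta> * t)) (\<lambda>j. s * (x (xs ! Suc j) + \<delta> * t)))" for s
  proof -
    have "\<delta> * (\<Sum>v\<in>?X. y v + s * x v) = c + s * (\<delta> * t)"
      by (simp add: sum.distrib t_def sum_y distrib_left sum_distrib_left[symmetric] mult_ac)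
    then have "meval id (\<lambda>v. y v + s * x v) (perturbed_form xs k M \<delta>) =
        det (pencil k ?M (y (xs ! 0) + s * x (xs ! 0) + (c + s * (\<delta> * t))) (\<lambda>j. y (xs ! Suc j) +
            s * x (xs ! Suc j) + (c + s * (\<delta> * t))))"
      by (simp add: meval_perturbed_form[OF comm_ring_hom_id])
    also have "pencil k ?M (y (xs ! 0) + s * x (xs ! 0) + (c + s * (\<delta> * t))) (\<lambda>j. y (xs ! Suc j)
        + s * x (xs ! Suc j) + (c + s * (\<delta> * t))) =
        pencil k ?M (1 / 2 + s * (x (xs ! 0) + \<delta> * t)) (\<lambda>j. s * (x (xs ! Suc j) + \<delta> * t))"
      unfolding pencil_def by (rule fmat_cong) (simp add: y_def x0 algebra_simps)
    finally show ?thesis .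
  qed
  have one: "det (pencil k ?M (1 / 2) (\<lambda>j. 0)) = 1"
  proof -
    have "pencil k ?M (1 / 2) (\<lambda>j. 0) = 1\<^sub>m k"
      by (rule eq_matI) (auto simp: pencil_def fmat_def)
    then show ?thesis by simp
  qed
  have "det (pencil k ?M (1 / 2 + s * (x (xs ! 0) + \<delta> * t)) (\<lambda>j. s * (x (xs ! Suc j) + \<delta> * t)))
      \<noteq> 0" for s
    using eval[of s] eval[of 0] const[rule_format, of y s] const[rule_format, of y 0] one by simp
  from pencil_lineality[OF perturbed_matrix(1,2)[OF \<delta>] k _ this]
  have u: "x (xs ! 0) + \<delta> * t = 0" "\<And>j. j < k \<Longrightarrow> x (xs ! Suc j) + \<delta> * t = 0"
    using off by auto
  have all: "x v = - (\<delta> * t)" if v: "v \<in> ?X" for v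
  proof -
    obtain i where "i < Suc k" "v = xs ! i" using v xs by (metis in_set_conv_nth)
    then show ?thesis using u by (cases i) (auto simp: add_eq_0_iff2)
  qed
  have "t = ?n * (- (\<delta> * t))" unfolding t_def by (subst sum.cong[OF refl all]) (simp_all add: t_def)
  then have "t * (1 + \<delta> * ?n) = 0" by (simp add: algebra_simps)
  then have "t = 0" using pos by simp
  then show "\<forall>v\<in>?X. x v = 0" using all by simp
qed

text \<open>The perturbed forms are strictly Lorentzian and converge coefficientwise as \<open>\<delta>\<close> tends to
  \<open>0\<close>. Nonnegativity of the coefficients is inherited from the strictly positive coefficients of
  the approximants.\<close>

lemma pencil_lorentzian:
  "lorentzian xs k (det (pencil k (\<lambda>i j. mconst (M i j)) (mvar (xs ! 0)) (\<lambda>j. mvar (xs ! Suc j))))"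
proof -
  let ?p = "det (pencil k (\<lambda>i j. mconst (M i j)) (mvar (xs ! 0)) (\<lambda>j. mvar (xs ! Suc j)))"
  define \<delta> where "\<delta> i = 1 / real (Suc i)" for i
  define q where "q i = perturbed_form xs k M (\<delta> i)" for i
  have \<delta>: "0 < \<delta> i" for i by (simp add: \<delta>_def)
  have lim: "\<delta> \<longlonglongrightarrow> 0" unfolding \<delta>_def[abs_def] by (rule LIMSEQ_Suc[OF lim_inverse_n'])
  have strict: "strictly_lorentzian xs k (q i)" for i
    unfolding q_def
    by (rule strictly_lorentzian_if_strictly_stable[OF xs(1) _ k
        perturbed_form_strictly_stable[OF \<delta>]
          perturbed_form_lineality_free[OF \<delta>]]) (use xs in auto)
  have L: "coeffs_tendsto (\<lambda>i. mvar (xs ! j) + mconst (\<delta> i) * (\<Sum>v\<in>set xs. mvar v)) (mvar (xs !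
      j))" for j
  proof -
    have "coeffs_tendsto (\<lambda>i. mvar (xs ! j) + mconst (\<delta> i) * (\<Sum>v\<in>set xs. mvar v))
        (mvar (xs ! j) + mconst 0 * (\<Sum>v\<in>set xs. mvar v))"
      by (intro coeffs_tendsto_add coeffs_tendsto_mult coeffs_tendsto_const
          coeffs_tendsto_mconst lim)
    then show ?thesis by (simp add: mconst_def)
  qed
  have "coeffs_tendsto q ?p"
    unfolding q_def perturbed_form_def Let_def
  proof (rule coeffs_tendsto_det)
    fix r c
    assume rc: "r < k" "c < k"
    have "(\<lambda>i. M r c + (if r = c then \<delta> i else 0)) \<longlonglongrightarrow> M r c"
      using tendsto_add[OF tendsto_const[of "M r c"] lim] by (cases "r = c") simp_all
    then show "coeffs_tendsto (\<lambda>i. pencil k (\<lambda>ia j. mconst (M ia j + (if ia = j then \<delta> i else 0)))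
        (mvar (xs ! 0) + mconst (\<delta> i) * (\<Sum>v\<in>set xs. mvar v))
        (\<lambda>j. mvar (xs ! Suc j) + mconst (\<delta> i) * (\<Sum>v\<in>set xs. mvar v)) $$ (r, c))
       (pencil k (\<lambda>i j. mconst (M i j)) (mvar (xs ! 0)) (\<lambda>j. mvar (xs ! Suc j)) $$ (r, c))"
      using rc unfolding pencil_def fmat_index[OF rc]
      by (intro coeffs_tendsto_add coeffs_tendsto_if coeffs_tendsto_mult coeffs_tendsto_const
          coeffs_tendsto_mconst L)
  qed simp_all
  then have conv: "\<forall>m. (\<lambda>i. mcoeff (q i) m) \<longlonglongrightarrow> mcoeff ?p m" by (simp add: coeffs_tendsto_def)
  have "0 \<le> mcoeff (q i) m" for i m
  proof (cases "mcoeff (q i) m = 0")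
    case False
    then have "keys m \<subseteq> set xs \<and> mdegree m = k"
      using strict[of i] mvars_subsetD[of "q i" "set xs" m]
      by (simp add: strictly_lorentzian_def mhomogeneous_def in_keys_iff)
    then show ?thesis using strict[of i] by (auto simp: strictly_lorentzian_def less_imp_le)
  qed simp
  then have "nonneg_coeffs ?p"
    unfolding nonneg_coeffs_def using conv LIMSEQ_le_const by blast
  moreover have "mvars ?p \<subseteq> set xs" "mhomogeneous k ?p"
    by (rule pencil_homogeneous[where X = "set xs"]; use xs in \<open>auto intro: linear_form_mvar\<close>)+
  ultimately show ?thesis unfolding lorentzian_def using strict conv by blast
qed

end

section \<open>Distances in graphs\<close>

lemma relpow_sym:
  assumes "sym E" "(u, v) \<in> E ^^ l"
  shows "(v, u) \<in> E ^^ l"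
  using assms(2)
proof (induction l arbitrary: v)
  case (Suc l)
  then obtain w where "(u, w) \<in> E ^^ l" "(w, v) \<in> E" by (auto elim: relpow_Suc_E)
  then show ?case using relpow_Suc_I2[OF symD[OF assms(1)] Suc.IH] by blast
qed simp

lemma graph_dist_commute: "sym E \<Longrightarrow> graph_dist E u v = graph_dist E v u"
  unfolding graph_dist_def by (metis relpow_sym)

lemma graph_dist_refl [simp]: "graph_dist E v v = 0"
  unfolding graph_dist_def by (rule Least_equality) auto

lemma graph_dist_edge:
  assumes "(u, v) \<in> E" "u \<noteq> v"
  shows "graph_dist E u v = 1"
  unfolding graph_dist_def
proof (rule Least_equality)
  fix l assume "(u, v) \<in> E ^^ l"
  then show "1 \<le> l" using assms(2) by (cases l) auto
qed (use assms(1) in auto)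

lemma relpow_graph_dist:
  assumes "(u, v) \<in> E\<^sup>*"
  shows "(u, v) \<in> E ^^ graph_dist E u v"
  unfolding graph_dist_def using rtrancl_imp_relpow[OF assms] by (auto intro: LeastI)

lemma graph_dist_nonadjacent:
  assumes "(u, v) \<in> E\<^sup>*" "u \<noteq> v" "(u, v) \<notin> E"
  shows "2 \<le> graph_dist E u v"
proof (rule ccontr)
  assume "\<not> 2 \<le> graph_dist E u v"
  then have "graph_dist E u v = 0 \<or> graph_dist E u v = 1" by linarith
  then show False using relpow_graph_dist[OF assms(1)] assms(2,3) by auto
qed

lemma graph_dist_common_neighbour:
  assumes "(u, v) \<in> E\<^sup>*" "u \<noteq> v" "(u, v) \<notin> E" "(u, w) \<in> E" "(w, v) \<in> E"
  shows "graph_dist E u v = 2"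
proof -
  have "(u, v) \<in> E ^^ 2" using assms(4,5) by (auto simp: numeral_2_eq_2)
  then have "graph_dist E u v \<le> 2" unfolding graph_dist_def by (rule Least_le)
  then show ?thesis using graph_dist_nonadjacent[OF assms(1-3)] by simp
qed

lemma simple_connected_graphD:
  assumes "simple_connected_graph V E"
  shows "finite V" "E \<subseteq> V \<times> V" "sym E" "(v, v) \<notin> E"
    and "u \<in> V \<Longrightarrow> w \<in> V \<Longrightarrow> (u, w) \<in> E\<^sup>*"
  using assms by (auto simp: simple_connected_graph_def irrefl_def)

lemma obtain_neighbour:
  assumes G: "simple_connected_graph V E" and "2 \<le> card V" "v \<in> V"
  obtains u where "u \<in> V" "(v, u) \<in> E" "(u, v) \<in> E"
proof -
  have "\<not> V \<subseteq> {v}"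
    using assms(2) card_mono[of "{v}" V] by auto
  then obtain w where "w \<in> V" "w \<noteq> v" by blast
  then have "(v, w) \<in> E\<^sup>*" using simple_connected_graphD(5)[OF G] assms(3) by blast
  then obtain u where "(v, u) \<in> E" using \<open>w \<noteq> v\<close> by (auto elim: converse_rtranclE)
  moreover have "(u, v) \<in> E" by (rule symD[OF simple_connected_graphD(3)[OF G]]) fact
  moreover have "u \<in> V" using \<open>(v, u) \<in> E\<close> simple_connected_graphD(2)[OF G] by blast
  ultimately show ?thesis using that by blast
qed

section \<open>Distances in blowups\<close>

lemma set_blowup_vertices: "set (blowup_vertices vs n) = (SIGMA v:set vs. {..<n v})"
  by (auto simp: blowup_vertices_def)

lemma distinct_blowup_vertices:
  assumes "distinct vs"
  shows "distinct (blowup_vertices vs n)"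
  using assms
proof (induction vs)
  case (Cons v vs)
  have "blowup_vertices (v # vs) n = map (Pair v) [0..<n v] @ blowup_vertices vs n"
    by (simp add: blowup_vertices_def)
  moreover have "set (map (Pair v) [0..<n v]) \<inter> set (blowup_vertices vs n) = {}"
    using Cons.prems by (auto simp: set_blowup_vertices)
  ultimately show ?case using Cons by (simp add: distinct_map inj_on_def)
qed (simp add: blowup_vertices_def)

lemma length_blowup_vertices: "distinct vs \<Longrightarrow> length (blowup_vertices vs n) = (\<Sum>v\<in>set vs. n v)"
  by (simp add: blowup_vertices_def length_concat o_def sum_list_distinct_conv_sum_set)

lemma blowup_walk_project:
  "((v, i), (w, j)) \<in> blowup_edges E n ^^ l \<Longrightarrow> (v, w) \<in> E ^^ l"
proof (induction l arbitrary: w j)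
  case (Suc l)
  from Suc.prems obtain u a where "((v, i), (u, a)) \<in> blowup_edges E n ^^ l" "((u, a), (w, j)) \<in>
      blowup_edges E n"
    by (auto elim: relpow_Suc_E)
  then show ?case using Suc.IH by (auto simp: blowup_edges_def)
qed simp

lemma blowup_walk_lift:
  assumes G: "simple_connected_graph V E" and n: "\<forall>v\<in>V. 0 < n v"
  shows "(v, w) \<in> E ^^ Suc l \<Longrightarrow> i < n v \<Longrightarrow> j < n w \<Longrightarrow> ((v, i), (w, j)) \<in> blowup_edges E n ^^ Suc l"
proof (induction l arbitrary: w j)
  case 0
  then show ?case using simple_connected_graphD(4)[OF G] by (auto simp: blowup_edges_def)
next
  case (Suc l)
  from Suc.prems obtain u where u: "(v, u) \<in> E ^^ Suc l" "(u, w) \<in> E" by (auto elim: relpow_Suc_E)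
  then have "0 < n u" using simple_connected_graphD(2)[OF G] n by blast
  then have "((v, i), (u, 0)) \<in> blowup_edges E n ^^ Suc l" using Suc.IH u Suc.prems by blast
  moreover have "((u, 0), (w, j)) \<in> blowup_edges E n"
    using u \<open>0 < n u\<close> Suc.prems simple_connected_graphD(4)[OF G] by (auto simp: blowup_edges_def)
  ultimately show ?case by (rule relpow_Suc_I)
qed

text \<open>Walks in the blowup project to walks of the graph and, if not empty, lift back. Two copies
  of one vertex are at distance \<open>2\<close> through any neighbour; this is the origin of the shift by \<open>2
  Id\<close>.\<close>

lemma graph_dist_blowup:
  assumes G: "simple_connected_graph V E" and V: "2 \<le> card V" and n: "\<forall>v\<in>V. 0 < n v"
    and v: "v \<in> V" "i < n v" and w: "w \<in> V" "j < n w"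
  shows "int (graph_dist (blowup_edges E n) (v, i) (w, j)) =
    int (graph_dist E v w) + (if v = w then 2 else 0) - (if (v, i) = (w, j) then 2 else 0)"
proof -
  let ?F = "blowup_edges E n"
  consider "(v, i) = (w, j)" | "v = w" "i \<noteq> j" | "v \<noteq> w" by auto
  then show ?thesis
  proof cases
    case 1
    then show ?thesis by simp
  next
    case 2
    obtain u where u: "u \<in> V" "(v, u) \<in> E" "(u, v) \<in> E" using obtain_neighbour[OF G V v(1)] by blast
    have "((v, i), (u, 0)) \<in> ?F" "((u, 0), (w, j)) \<in> ?F"
      using u v w n 2 simple_connected_graphD(4)[OF G] by (auto simp: blowup_edges_def)
    moreover have "((v, i), (w, j)) \<notin> ?F" using 2 by (auto simp: blowup_edges_def)
    moreover have "(v, i) \<noteq> (w, j)" using 2 by simp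
    ultimately have "graph_dist ?F (v, i) (w, j) = 2"
      by (intro graph_dist_common_neighbour) (auto intro: rtrancl_trans)
    then show ?thesis using 2 by simp
  next
    case 3
    have "((v, i), (w, j)) \<in> ?F ^^ l \<longleftrightarrow> (v, w) \<in> E ^^ l" for l
    proof (cases l)
      case 0
      then show ?thesis using 3 by simp
    next
      case (Suc l')
      show ?thesis
      proof
        show "(v, w) \<in> E ^^ l" if "((v, i), (w, j)) \<in> ?F ^^ l" using blowup_walk_project[OF that] .
        show "((v, i), (w, j)) \<in> ?F ^^ l" if "(v, w) \<in> E ^^ l"
          using blowup_walk_lift[OF G n _ v(2) w(2)] that unfolding Suc by blast
      qed
    qed
    then show ?thesis using 3 by (simp add: graph_dist_def)
  qed
qed

section \<open>Sylvester's determinant identity\<close>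

text \<open>Both sides are the determinant of one block matrix, computed by clearing either of its
  off-diagonal blocks.\<close>

lemma sylvester_det:
  fixes W U :: "'a::idom mat"
  assumes W: "W \<in> carrier_mat N k" and U: "U \<in> carrier_mat k N"
  shows "x ^ k * det (x \<cdot>\<^sub>m 1\<^sub>m N + W * U) = x ^ N * det (x \<cdot>\<^sub>m 1\<^sub>m k + U * W)"
proof -
  let ?X = "four_block_mat (x \<cdot>\<^sub>m 1\<^sub>m N) (- W) U (1\<^sub>m k)"
  let ?R = "four_block_mat (1\<^sub>m N) (0\<^sub>m N k) (- U) (1\<^sub>m k)"
  let ?L = "four_block_mat (1\<^sub>m N) (0\<^sub>m N k) (- U) (x \<cdot>\<^sub>m 1\<^sub>m k)"
  have X: "?X \<in> carrier_mat (N + k) (N + k)" and R: "?R \<in> carrier_mat (N + k) (N + k)"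
    and L: "?L \<in> carrier_mat (N + k) (N + k)"
    using W U by auto
  have neg: "- W * - U = W * U" "U + - U = 0\<^sub>m k N" "- U + U = 0\<^sub>m k N"
    using W U by auto
  have "?X * ?R = four_block_mat (x \<cdot>\<^sub>m 1\<^sub>m N + W * U) (- W) (0\<^sub>m k N) (1\<^sub>m k)"
    by (subst mult_four_block_mat[of _ N N _ k _ k _ _ N _ k])
       (use W U neg in \<open>auto intro!: arg_cong2[where f = "\<lambda>a b. four_block_mat a b _ _"]\<close>)
  moreover have "det ?R = 1"
    by (subst det_four_block_mat_upper_right_zero[of _ N _ k]) (use U in auto)
  ultimately have dX: "det ?X = det (x \<cdot>\<^sub>m 1\<^sub>m N + W * U)"
    using det_mult[OF X R] det_four_block_mat_lower_left_zero[of "x \<cdot>\<^sub>m 1\<^sub>m N + W * U" N "- W" k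
        "0\<^sub>m k N" "1\<^sub>m k"] W U
    by simp
  have "?L * ?X = four_block_mat (x \<cdot>\<^sub>m 1\<^sub>m N) (- W) (0\<^sub>m k N) (x \<cdot>\<^sub>m 1\<^sub>m k + U * W)"
  proof -
    have a: "- U * (x \<cdot>\<^sub>m 1\<^sub>m N) + x \<cdot>\<^sub>m 1\<^sub>m k * U = 0\<^sub>m k N"
      using U mult_smult_distrib[of "- U" k N "1\<^sub>m N" N x] mult_smult_assoc_mat[of "1\<^sub>m k" k k U
          N x]
      by (auto intro!: eq_matI)
    have b: "- U * - W + x \<cdot>\<^sub>m 1\<^sub>m k * 1\<^sub>m k = x \<cdot>\<^sub>m 1\<^sub>m k + U * W"
      using W U by (intro eq_matI) auto
    show ?thesis
      by (subst mult_four_block_mat[of _ N N _ k _ k _ _ N _ k])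
         (use W U a b in auto)
  qed
  moreover have "det ?L = x ^ k"
    by (subst det_four_block_mat_upper_right_zero[of _ N _ k]) (use U in auto)
  ultimately have "x ^ k * det ?X = x ^ N * det (x \<cdot>\<^sub>m 1\<^sub>m k + U * W)"
    using det_mult[OF L X] det_four_block_mat_lower_left_zero[of "x \<cdot>\<^sub>m 1\<^sub>m N" N "- W" k "0\<^sub>m k
        N" "x \<cdot>\<^sub>m 1\<^sub>m k + U * W"] W U
    by simp
  then show ?thesis by (simp add: dX)
qed

section \<open>The blowup-polynomial as a determinant\<close>

text \<open>The entries of \<open>D + 2 Id\<close>, over an arbitrary ring: the blowup-polynomial needs them as
  integers, the pencils as reals and as constant polynomials.\<close>

definition modified_dist :: "'a list \<Rightarrow> ('a \<times> 'a) set \<Rightarrow> nat \<Rightarrow> nat \<Rightarrow> 'b::comm_ring_1" where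
  "modified_dist vs E i j = of_nat (graph_dist E (vs ! i) (vs ! j)) + (if i = j then 2 else 0)"

text \<open>The distance matrix of the blowup is \<open>W M W\<^sup>T - 2 Id\<close>, where row \<open>a\<close> of \<open>W\<close> indicates the
  vertex of which \<open>a\<close> is a copy. As \<open>W\<^sup>T W\<close> is the diagonal matrix of the multiplicities,
  Sylvester's identity with \<open>U = M W\<^sup>T\<close> reduces its determinant to one of size \<open>k\<close>.\<close>

lemma det_dist_mat_blowup:
  assumes G: "simple_connected_graph (set vs) E" and vs: "distinct vs" "2 \<le> length vs"
    and n: "\<forall>v\<in>set vs. 0 < n v"
  shows "det (dist_mat (blowup_vertices vs n) (blowup_edges E n)) =
    (-2) ^ (\<Sum>v\<in>set vs. n v - 1) * det (pencil (length vs) (modified_dist vs E) (-1 :: int) (\<lambda>j.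
        int (n (vs ! j))))"
proof -
  define L where "L = blowup_vertices vs n"
  define k where "k = length vs"
  define N where "N = length L"
  define M :: "nat \<Rightarrow> nat \<Rightarrow> int" where "M = modified_dist vs E"
  have L: "distinct L" "set L = (SIGMA v:set vs. {..<n v})"
    using vs(1) by (simp_all add: L_def distinct_blowup_vertices set_blowup_vertices)
  have card: "2 \<le> card (set vs)" using vs by (simp add: distinct_card)
  have LI: "fst (L ! a) \<in> set vs" "snd (L ! a) < n (fst (L ! a))" if "a < N" for a
  proof -
    have "L ! a \<in> set L" using that by (simp add: N_def)
    then show "fst (L ! a) \<in> set vs" "snd (L ! a) < n (fst (L ! a))" unfolding L(2) by auto
  qed
  define w where "w a j = (if fst (L ! a) = vs ! j then 1 else 0 :: int)" for a j
  define W where "W = mat N k (\<lambda>(a, j). w a j)"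
  define U where "U = mat k N (\<lambda>(i, b). \<Sum>j<k. M i j * w b j)"
  have W: "W \<in> carrier_mat N k" and U: "U \<in> carrier_mat k N" by (simp_all add: W_def U_def)
  have pick: "(\<Sum>j<k. f j * w a j) = f i" if "i < k" "fst (L ! a) = vs ! i" for f i a
  proof -
    have "(\<Sum>j<k. f j * w a j) = (\<Sum>j<k. if j = i then f j else 0)"
      using that vs(1) by (intro sum.cong) (auto simp: w_def k_def nth_eq_iff_index_eq)
    then show ?thesis using that by simp
  qed
  have D: "dist_mat L (blowup_edges E n) = (-2 :: int) \<cdot>\<^sub>m 1\<^sub>m N + W * U"
  proof (rule eq_matI)
    fix a b
    assume "a < dim_row ((-2 :: int) \<cdot>\<^sub>m 1\<^sub>m N + W * U)" "b < dim_col ((-2 :: int) \<cdot>\<^sub>m 1\<^sub>m N + W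
        * U)"
    then have ab: "a < N" "b < N" using W U by auto
    obtain i where i: "i < k" "fst (L ! a) = vs ! i" using LI(1)[OF ab(1)] by (metis
        in_set_conv_nth k_def)
    obtain j where j: "j < k" "fst (L ! b) = vs ! j" using LI(1)[OF ab(2)] by (metis
        in_set_conv_nth k_def)
    have "(W * U) $$ (a, b) = (\<Sum>l<k. (\<Sum>j<k. M l j * w b j) * w a l)"
      using ab W U by (simp add: W_def U_def scalar_prod_def atLeast0LessThan mult.commute)
    also have "\<dots> = M i j" by (simp only: pick[OF i] pick[OF j])
    finally have WU: "(W * U) $$ (a, b) = M i j" .
    have "dist_mat L (blowup_edges E n) $$ (a, b) = int (graph_dist (blowup_edges E n) (fst (L !
        a), snd (L ! a)) (fst (L ! b), snd (L ! b)))"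
      using ab by (simp add: dist_mat_def indexed_mat_def N_def)
    also have "\<dots> = int (graph_dist E (fst (L ! a)) (fst (L ! b))) + (if fst (L ! a) = fst (L !
        b) then 2 else 0) - (if L ! a = L ! b then 2 else 0)"
      using graph_dist_blowup[OF G card n LI[OF ab(1)] LI[OF ab(2)]] by simp
    also have "\<dots> = M i j - (if a = b then 2 else 0)"
      using i j ab vs(1) L(1) by (simp add: M_def modified_dist_def N_def k_def nth_eq_iff_index_eq)
    finally show "dist_mat L (blowup_edges E n) $$ (a, b) = ((-2 :: int) \<cdot>\<^sub>m 1\<^sub>m N + W * U) $$
        (a, b)"
      using ab W U by (simp add: WU)
  qed (use W U in \<open>auto simp: dist_mat_def indexed_mat_def N_def\<close>)
  have P: "(-2 :: int) \<cdot>\<^sub>m 1\<^sub>m k + U * W = pencil k M (-1) (\<lambda>j. int (n (vs ! j)))"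
  proof (rule eq_matI)
    fix i j
    assume "i < dim_row (pencil k M (-1) (\<lambda>j. int (n (vs ! j))))" "j < dim_col (pencil k M (-1)
        (\<lambda>j. int (n (vs ! j))))"
    then have ij: "i < k" "j < k" by (auto simp: pencil_def fmat_def)
    have "(U * W) $$ (i, j) = (\<Sum>b<N. (\<Sum>l<k. M i l * w b l) * w b j)"
      using ij by (simp add: W_def U_def scalar_prod_def atLeast0LessThan)
    also have "\<dots> = (\<Sum>b<N. M i j * w b j)"
      by (intro sum.cong refl) (use pick[of j] ij in \<open>auto simp: w_def\<close>)
    also have "\<dots> = (\<Sum>p\<in>set L. M i j * (if fst p = vs ! j then 1 else 0))"
      unfolding sum_set_nth[OF L(1)] N_def w_def ..
    also have "\<dots> = (\<Sum>v\<in>set vs. \<Sum>l<n v. M i j * (if v = vs ! j then 1 else 0))"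
      unfolding L(2) by (subst sum.Sigma) (auto simp: case_prod_beta)
    also have "\<dots> = (\<Sum>v\<in>set vs. if v = vs ! j then M i j * int (n v) else 0)"
      by (intro sum.cong) auto
    also have "\<dots> = M i j * int (n (vs ! j))" using ij by (simp add: k_def)
    finally show "((-2 :: int) \<cdot>\<^sub>m 1\<^sub>m k + U * W) $$ (i, j) = pencil k M (-1) (\<lambda>j. int (n (vs !
        j))) $$ (i, j)"
      using ij U W by (simp add: pencil_def fmat_def)
  qed (auto simp: pencil_def fmat_def U_def W_def)
  have "N = (\<Sum>v\<in>set vs. n v)" using vs(1) by (simp add: N_def L_def length_blowup_vertices)
  also have "\<dots> = (\<Sum>v\<in>set vs. 1 + (n v - 1))" using n by (intro sum.cong) auto
  also have "\<dots> = k + (\<Sum>v\<in>set vs. n v - 1)" using vs(1) unfolding sum.distrib by (simp add: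
      distinct_card k_def)
  finally have "(-2) ^ k * det (dist_mat L (blowup_edges E n)) =
      (-2) ^ k * ((-2) ^ (\<Sum>v\<in>set vs. n v - 1) * det (pencil k M (-1) (\<lambda>j. int (n (vs ! j)))))"
    using sylvester_det[OF W U, of "-2"] by (simp add: D P power_add)
  then have "det (dist_mat L (blowup_edges E n)) =
      (-2) ^ (\<Sum>v\<in>set vs. n v - 1) * det (pencil k M (-1) (\<lambda>j. int (n (vs ! j))))"
    by simp
  then show ?thesis by (simp only: L_def M_def k_def)
qed

lemma meval_det_pencil:
  assumes "comm_ring_hom h"
  shows "meval h z (det (pencil k (\<lambda>i j. mconst (M i j)) L0 L)) =
    det (pencil k (\<lambda>i j. h (M i j)) (meval h z L0) (\<lambda>j. meval h z (L j)))"
proof -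
  interpret h: comm_ring_hom h by fact
  show ?thesis by (simp add: hom_det_pencil[OF meval_comm_ring_hom[OF assms]])
qed

lemma keys_pencil_entry:
  fixes M :: "nat \<Rightarrow> nat \<Rightarrow> 'c::comm_ring_1"
  assumes "i < k" "j < k"
  shows "keys (pencil k (\<lambda>i j. mconst (M i j)) L0 L $$ (i, j)) \<subseteq>
    keys L0 \<union> keys (L j)"
  using assms keys_add[of "if i = j then mconst 2 * L0 else 0" "mconst (M i j) * L j"]
    keys_mconst_mult[of 2 L0] keys_mconst_mult[of "M i j" "L j"]
  by (auto simp: pencil_def mconst_two split: if_splits)

lemma mvars_det_pencil:
  fixes M :: "nat \<Rightarrow> nat \<Rightarrow> 'c::comm_ring_1"
  assumes "mvars L0 \<subseteq> X" "\<And>j. j < k \<Longrightarrow> mvars (L j) \<subseteq> X"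
  shows "mvars (det (pencil k (\<lambda>i j. mconst (M i j)) L0 L)) \<subseteq> X"
proof (rule mvars_subsetI)
  fix m assume m: "m \<in> keys (det (pencil k (\<lambda>i j. mconst (M i j)) L0 L))"
  show "keys m \<subseteq> X"
  proof (rule keys_det_graded[where R = "\<lambda>_ m. keys m \<subseteq> X" and d = "\<lambda>_. 0", OF _ _ _ _ m])
    fix i j l
    assume ij: "i < k" "j < k" and l: "l \<in> keys (pencil k (\<lambda>i j. mconst (M i j)) L0 L $$ (i, j))"
    show "keys l \<subseteq> X"
      using l assms ij keys_pencil_entry[OF ij, of M L0 L] by (fastforce dest: mvars_subsetD)
  qed (auto simp: keys_add_nat)
qed

lemma mvars_mvar [simp]: "mvars (mvar v :: ('v, 'c::zero_neq_one) mvpoly) = {v}"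
  by (auto simp: mvars_def mvar_def)

lemma blowup_poly_eq:
  assumes G: "simple_connected_graph (set vs) E" and vs: "distinct vs" "2 \<le> length vs"
  shows "blowup_poly vs E = det (pencil (length vs) (\<lambda>i j. mconst (modified_dist vs E i j)) (-1)
      (\<lambda>j. mvar (vs ! j)))"
  unfolding blowup_poly_def
proof (rule the_equality)
  let ?P = "det (pencil (length vs) (\<lambda>i j. mconst (modified_dist vs E i j)) (-1) (\<lambda>j. mvar (vs !
      j))) :: ('a, int) mvpoly"
  interpret ev: comm_ring_hom "meval id z :: ('a, int) mvpoly \<Rightarrow> int" for z
    by (intro meval_comm_ring_hom comm_ring_hom_id)
  have ev: "meval id z ?P = det (pencil (length vs) (modified_dist vs E) (-1) (\<lambda>j. z (vs ! j)))"
      for z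
    by (simp add: meval_det_pencil[OF comm_ring_hom_id] ev.hom_uminus)
  show P: "mvars ?P \<subseteq> set vs \<and>
     (\<forall>n. (\<forall>v\<in>set vs. 0 < n v) \<longrightarrow>
        det (dist_mat (blowup_vertices vs n) (blowup_edges E n)) =
          (-2) ^ (\<Sum>v\<in>set vs. n v - 1) * meval id (\<lambda>v. int (n v)) ?P)"
  proof (intro conjI allI impI)
    have "mvars (- 1 :: ('a, int) mvpoly) \<subseteq> set vs"
      by (rule mvars_subsetI) (simp add: in_keys_iff lookup_one when_def split: if_splits)
    then show "mvars ?P \<subseteq> set vs" by (rule mvars_det_pencil) simp
  qed (simp only: ev det_dist_mat_blowup[OF G vs])
  fix p :: "('a, int) mvpoly"
  assume p: "mvars p \<subseteq> set vs \<and>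
     (\<forall>n. (\<forall>v\<in>set vs. 0 < n v) \<longrightarrow>
        det (dist_mat (blowup_vertices vs n) (blowup_edges E n)) =
          (-2) ^ (\<Sum>v\<in>set vs. n v - 1) * meval id (\<lambda>v. int (n v)) p)"
  show "p = ?P"
  proof (rule mvpoly_eqI)
    fix n :: "'a \<Rightarrow> nat"
    assume "\<And>v. 0 < n v"
    then have "(-2) ^ (\<Sum>v\<in>set vs. n v - 1) * meval id (\<lambda>v. int (n v)) p =
        (-2) ^ (\<Sum>v\<in>set vs. n v - 1) * meval id (\<lambda>v. int (n v)) ?P"
      using p P by metis
    then show "meval id (\<lambda>v. of_nat (n v)) p = meval id (\<lambda>v. of_nat (n v)) ?P" by simp
  qed
qed

lemma meval_blowup_poly:
  fixes h :: "int \<Rightarrow> 'd::comm_ring_1"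
  assumes G: "simple_connected_graph (set vs) E" and vs: "distinct vs" "2 \<le> length vs"
    and h: "comm_ring_hom h"
  shows "meval h z (blowup_poly vs E) = det (pencil (length vs) (modified_dist vs E) (-1) (\<lambda>j. z
      (vs ! j)))"
proof -
  interpret h: comm_ring_hom h by fact
  interpret ev: comm_ring_hom "meval h z :: ('a, int) mvpoly \<Rightarrow> 'd" by (rule meval_comm_ring_hom)
      fact
  have "h (modified_dist vs E i j) = modified_dist vs E i j" for i j
    by (simp add: modified_dist_def h.hom_add h.hom_of_nat h.hom_numeral)
  then show ?thesis
    by (simp add: blowup_poly_eq[OF G vs] meval_det_pencil[OF h] ev.hom_uminus)
qed

lemma homogenized_blowup_poly_eq:
  assumes G: "simple_connected_graph (set vs) E" and vs: "distinct vs" "2 \<le> length vs"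
  shows "homogenized_blowup_poly vs E =
    det (pencil (length vs) (\<lambda>i j. mconst (modified_dist vs E i j)) (mvar None) (\<lambda>j. mvar (Some
        (vs ! j))))"
  unfolding homogenized_blowup_poly_def
proof (rule the_equality)
  let ?Q = "det (pencil (length vs) (\<lambda>i j. mconst (modified_dist vs E i j)) (mvar None) (\<lambda>j.
      mvar (Some (vs ! j)))) :: ('a option, real) mvpoly"
  let ?h = "\<lambda>z. (- z None) ^ length vs * meval real_of_int (\<lambda>v. z (Some v) / (- z None))
      (blowup_poly vs E)"
  have ev: "meval id z ?Q = ?h z" if "z None \<noteq> 0" for z
  proof -
    have "meval id z ?Q = det (pencil (length vs) (modified_dist vs E) (z None) (\<lambda>j. z (Some (vs
        ! j))))"
      by (simp add: meval_det_pencil[OF comm_ring_hom_id])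
    also have "\<dots> = det (pencil (length vs) (modified_dist vs E) (- z None * -1) (\<lambda>j. - z None *
        (z (Some (vs ! j)) / (- z None))))"
      using that by simp
    finally show ?thesis
      by (simp only: det_pencil_scale meval_blowup_poly[OF G vs comm_ring_hom_of_int])
  qed
  show Q: "mvars ?Q \<subseteq> set (homogenized_vars vs) \<and> (\<forall>z. z None \<noteq> 0 \<longrightarrow> meval id z ?Q = ?h z)"
    using ev mvars_det_pencil[of "mvar None" "set (homogenized_vars vs)" "length vs" "\<lambda>j. mvar
        (Some (vs ! j))"]
    by (auto simp: homogenized_vars_def)
  fix q :: "('a option, real) mvpoly"
  assume q: "mvars q \<subseteq> set (homogenized_vars vs) \<and> (\<forall>z. z None \<noteq> 0 \<longrightarrow> meval id z q = ?h z)"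
  show "q = ?Q"
  proof (rule mvpoly_eqI)
    fix n :: "'a option \<Rightarrow> nat"
    assume "\<And>v. 0 < n v"
    then have "real (n None) \<noteq> 0" by simp
    then show "meval id (\<lambda>v. of_nat (n v)) q = meval id (\<lambda>v. of_nat (n v)) ?Q" using q Q by simp
  qed
qed

lemma blowup_poly_at_minus_one_eq:
  assumes G: "simple_connected_graph (set vs) E" and vs: "distinct vs" "2 \<le> length vs"
  shows "blowup_poly_at_minus_one vs E = (-1) ^ length vs * det (pencil (length vs)
      (modified_dist vs E) 1 (\<lambda>_. 1))"
  unfolding blowup_poly_at_minus_one_def meval_blowup_poly[OF G vs comm_ring_hom_of_int]
  using det_pencil_scale[of "length vs" "modified_dist vs E" "-1" 1 "\<lambda>_. 1 :: real"] by simp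

lemma reflected_blowup_poly_eq:
  assumes G: "simple_connected_graph (set vs) E" and vs: "distinct vs" "2 \<le> length vs"
  shows "reflected_blowup_poly vs E =
    mconst (1 / det (pencil (length vs) (modified_dist vs E) 1 (\<lambda>_. 1))) *
    det (pencil (length vs) (\<lambda>i j. mconst (modified_dist vs E i j)) 1 (\<lambda>j. mvar (vs ! j)))"
proof -
  let ?k = "length vs"
  interpret c: comm_ring_hom "mconst :: real \<Rightarrow> ('a, real) mvpoly" by (rule comm_ring_hom_mconst)
  have mc: "modified_dist vs E i j = (mconst (modified_dist vs E i j) :: ('a, real) mvpoly)" for i j
    by (simp add: modified_dist_def c.hom_add c.hom_of_nat c.hom_numeral)
  have "meval (\<lambda>c. mconst (real_of_int c)) (\<lambda>v. - mvar v) (blowup_poly vs E) =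
      det (pencil ?k (modified_dist vs E) (-1 * 1) (\<lambda>j. -1 * mvar (vs ! j)))"
    by (simp add: meval_blowup_poly[OF G vs comm_ring_hom_comp[OF comm_ring_hom_mconst
        comm_ring_hom_of_int]])
  also have "\<dots> = (-1) ^ ?k * det (pencil ?k (modified_dist vs E) 1 (\<lambda>j. mvar (vs ! j)))"
    by (rule det_pencil_scale)
  also have "(-1 :: ('a, real) mvpoly) ^ ?k = mconst ((-1) ^ ?k)"
    by (simp add: c.hom_power c.hom_uminus)
  finally have "reflected_blowup_poly vs E =
      mconst (1 / ((-1) ^ ?k * det (pencil ?k (modified_dist vs E) 1 (\<lambda>_. 1)))) * mconst ((-1) ^
          ?k) *
      det (pencil ?k (modified_dist vs E) 1 (\<lambda>j. mvar (vs ! j)))"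
    unfolding reflected_blowup_poly_def blowup_poly_at_minus_one_eq[OF G vs] by (simp add:
        mult.assoc)
  also have "mconst (1 / ((-1) ^ ?k * det (pencil ?k (modified_dist vs E) 1 (\<lambda>_. 1)))) * mconst
      ((-1) ^ ?k) =
      (mconst (1 / det (pencil ?k (modified_dist vs E) 1 (\<lambda>_. 1))) :: ('a, real) mvpoly)"
    unfolding c.hom_mult[symmetric] by simp
  also have "pencil ?k (modified_dist vs E) 1 (\<lambda>j. mvar (vs ! j)) =
      (pencil ?k (\<lambda>i j. mconst (modified_dist vs E i j)) 1 (\<lambda>j. mvar (vs ! j)) :: ('a, real)
          mvpoly mat)"
    unfolding pencil_def by (rule fmat_cong) (simp add: mc)
  finally show ?thesis .
qed

section \<open>Complete multipartite graphs\<close>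

lemma modified_dist_symmetric:
  assumes "sym E"
  shows "symmetric_on k (modified_dist vs E)"
  by (auto simp: symmetric_on_def modified_dist_def graph_dist_commute[OF assms])

lemma complete_multipartite_if_equiv:
  assumes r: "equiv V r" and E: "\<And>u w. u \<in> V \<Longrightarrow> w \<in> V \<Longrightarrow> (u, w) \<in> E \<longleftrightarrow> (u, w) \<notin> r"
  shows "complete_multipartite V E"
  unfolding complete_multipartite_def
proof (intro exI conjI ballI)
  show "partition_on V (V // r)" using r by (rule partition_on_quotient)
  fix u w assume uw: "u \<in> V" "w \<in> V"
  have "(\<exists>B\<in>V // r. u \<in> B \<and> w \<in> B) \<longleftrightarrow> (u, w) \<in> r"
  proof
    assume "\<exists>B\<in>V // r. u \<in> B \<and> w \<in> B"
    then show "(u, w) \<in> r" using in_quotient_imp_in_rel[OF r] by blast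
  next
    assume "(u, w) \<in> r"
    then show "\<exists>B\<in>V // r. u \<in> B \<and> w \<in> B"
      using uw equiv_class_self[OF r] by (intro bexI[of _ "r `` {u}"]) (auto intro: quotientI)
  qed
  then show "(u, w) \<in> E \<longleftrightarrow> \<not> (\<exists>B\<in>V // r. u \<in> B \<and> w \<in> B)" using E[OF uw] by blast
qed

text \<open>The vector \<open>e\<^sub>i - e\<^sub>j\<close> has value \<open>4 - 2 d(i, j)\<close>, so distances are at most \<open>2\<close> and
  non-adjacent vertices have distance \<open>2\<close>. If \<open>j\<close> is non-adjacent to the adjacent vertices \<open>i\<close>
  and \<open>l\<close>, the vector \<open>e\<^sub>i - 2 e\<^sub>j + e\<^sub>l\<close> has value \<open>-2\<close>. Hence non-adjacency is an equivalence
  relation.\<close>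

lemma complete_multipartite_if_psd:
  assumes G: "simple_connected_graph (set vs) E" and vs: "distinct vs"
    and psd: "psd_on (length vs) (modified_dist vs E)"
  shows "complete_multipartite (set vs) E"
proof -
  let ?k = "length vs" and ?M = "modified_dist vs E :: nat \<Rightarrow> nat \<Rightarrow> real"
  let ?e = "\<lambda>i l. if l = i then 1 else 0 :: real"
  note GD = simple_connected_graphD[OF G]
  have sym: "symmetric_on ?k ?M" by (rule modified_dist_symmetric[OF GD(3)])
  have Mii: "?M i i = 2" for i by (simp add: modified_dist_def)
  have two: "?M i j = 2" if ij: "i < ?k" "j < ?k" "i \<noteq> j" "(vs ! i, vs ! j) \<notin> E" for i j
  proof -
    have "0 \<le> qform ?k ?M (\<lambda>l. 1 * ?e i l + -1 * ?e j l)" using psd by (simp only: psd_on_def)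
    also have "\<dots> = 4 - 2 * ?M i j"
      unfolding qform_add[OF sym] using ij by (simp add: bform_unit Mii)
    finally have "real (graph_dist E (vs ! i) (vs ! j)) \<le> 2" using ij by (simp add:
        modified_dist_def)
    moreover have "vs ! i \<noteq> vs ! j" using ij vs by (simp add: nth_eq_iff_index_eq)
    then have "2 \<le> graph_dist E (vs ! i) (vs ! j)"
      using ij by (intro graph_dist_nonadjacent GD) auto
    ultimately show ?thesis using ij by (simp add: modified_dist_def)
  qed
  have trans: "(vs ! i, vs ! l) \<notin> E"
    if ijl: "i < ?k" "j < ?k" "l < ?k" "i \<noteq> j" "j \<noteq> l" "i \<noteq> l" and n: "(vs ! i, vs ! j) \<notin> E"
        "(vs ! j, vs ! l) \<notin> E" for i j l
  proof
    assume adj: "(vs ! i, vs ! l) \<in> E"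
    have "vs ! i \<noteq> vs ! l" using ijl vs by (simp add: nth_eq_iff_index_eq)
    then have Mil: "?M i l = 1" using ijl graph_dist_edge[OF adj] by (simp add: modified_dist_def)
    have "0 \<le> qform ?k ?M (\<lambda>m. 1 * (1 * ?e i m + -2 * ?e j m) + 1 * ?e l m)"
      using psd by (simp only: psd_on_def)
    also have "\<dots> = -2"
      unfolding qform_add[OF sym] unfolding bform_add_left
      using ijl n Mil by (simp add: bform_unit Mii two)
    finally show False by simp
  qed
  define r where "r = {(u, w). u \<in> set vs \<and> w \<in> set vs \<and> (u, w) \<notin> E}"
  have "(u, x) \<notin> E" if uwx: "u \<in> set vs" "w \<in> set vs" "x \<in> set vs" and n: "(u, w) \<notin> E" "(w, x) \<notin>
      E" for u w x
  proof -
    obtain i j l where "i < ?k" "j < ?k" "l < ?k" "u = vs ! i" "w = vs ! j" "x = vs ! l"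
      using uwx by (metis in_set_conv_nth)
    then show ?thesis using trans[of i j l] n GD(4) by (cases "i = j \<or> j = l \<or> i = l") auto
  qed
  then have "equiv (set vs) r"
    unfolding equiv_def refl_on_def sym_def trans_def r_def using GD(3,4) by (auto dest: symD)
  then show ?thesis by (rule complete_multipartite_if_equiv) (auto simp: r_def)
qed

text \<open>Vertices of different parts are adjacent, and two vertices of one part have a common
  neighbour. So \<open>D + 2 Id\<close> is the all-ones matrix plus the sum over the parts \<open>B\<close> of \<open>1\<^sub>B
  1\<^sub>B\<^sup>T\<close>, and its quadratic form is a sum of squares.\<close>

lemma psd_if_complete_multipartite:
  assumes G: "simple_connected_graph (set vs) E" and vs: "distinct vs" "2 \<le> length vs"
    and mp: "complete_multipartite (set vs) E"
  shows "psd_on (length vs) (modified_dist vs E)"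
  unfolding psd_on_def
proof
  fix x :: "nat \<Rightarrow> real"
  note GD = simple_connected_graphD[OF G]
  let ?V = "set vs"
  obtain P where P: "partition_on ?V P" and E: "\<forall>u\<in>?V. \<forall>w\<in>?V. (u, w) \<in> E \<longleftrightarrow> \<not> (\<exists>B\<in>P. u \<in> B \<and> w \<in> B)"
    using mp unfolding complete_multipartite_def by blast
  have finP: "finite P" by (rule finite_elements[OF _ P]) simp
  define c where "c B u = (if u \<in> B then 1 else 0 :: real)" for B and u :: 'a
  have M: "real (graph_dist E u v) + (if u = v then 2 else 0) = 1 + (\<Sum>B\<in>P. c B u * c B v)"
    if uv: "u \<in> ?V" "v \<in> ?V" for u v
  proof -
    obtain A where A: "A \<in> P" "u \<in> A" using uv partition_onD1[OF P] by blast
    have uniq: "B = A" if "B \<in> P" "u \<in> B" for B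
      using that A partition_onD2[OF P] by (auto simp: disjoint_def)
    have "(\<Sum>B\<in>P. c B u * c B v) = (\<Sum>B\<in>P. if B = A then c A v else 0)"
    proof (intro sum.cong refl)
      fix B assume "B \<in> P"
      show "c B u * c B v = (if B = A then c A v else 0)"
      proof (cases "B = A")
        case True
        then show ?thesis using A(2) by (simp add: c_def)
      next
        case False
        then have "u \<notin> B" using uniq \<open>B \<in> P\<close> by blast
        then show ?thesis using False by (simp add: c_def)
      qed
    qed
    then have sum: "(\<Sum>B\<in>P. c B u * c B v) = c A v" using A finP by simp
    consider "u = v" | "u \<noteq> v" "(u, v) \<in> E" | "u \<noteq> v" "(u, v) \<notin> E" by blast
    then show ?thesis
    proof cases
      case 1
      then show ?thesis using A unfolding sum by (simp add: c_def)
    next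
      case 2
      then have "v \<notin> A" using E uv A by blast
      then show ?thesis using 2 unfolding sum by (simp add: c_def graph_dist_edge)
    next
      case 3
      then have "v \<in> A" using E uv uniq by blast
      have card: "2 \<le> card ?V" using vs by (simp add: distinct_card)
      obtain w where w: "w \<in> ?V" "(u, w) \<in> E" using obtain_neighbour[OF G card uv(1)] by blast
      have "(v, w) \<in> E"
      proof (rule ccontr)
        assume "(v, w) \<notin> E"
        then obtain B where "B \<in> P" "v \<in> B" "w \<in> B" using E uv w by blast
        moreover have "B = A"
          using \<open>B \<in> P\<close> \<open>v \<in> B\<close> \<open>v \<in> A\<close> A(1) partition_onD2[OF P] by (auto simp: disjoint_def)
        ultimately show False using E uv w A by blast
      qed
      then have "graph_dist E u v = 2"
        using 3 w uv GD(3) by (intro graph_dist_common_neighbour[of _ _ _ w] GD(5)) (auto dest: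
            symD)
      then show ?thesis using 3 \<open>v \<in> A\<close> unfolding sum by (simp add: c_def)
    qed
  qed
  obtain f where f: "\<And>i. i < length vs \<Longrightarrow> f (vs ! i) = x i"
    using obtain_labelling[OF vs(1)] by blast
  have "qform (length vs) (modified_dist vs E) x =
      (\<Sum>i<length vs. \<Sum>j<length vs. f (vs ! i) * (real (graph_dist E (vs ! i) (vs ! j)) + (if vs
          ! i = vs ! j then 2 else 0)) * f (vs ! j))"
    unfolding bform_def
    by (intro sum.cong) (use vs in \<open>auto simp: f modified_dist_def nth_eq_iff_index_eq\<close>)
  also have "\<dots> = (\<Sum>u\<in>?V. \<Sum>v\<in>?V. f u * (real (graph_dist E u v) + (if u = v then 2 else 0)) * f v)"
    unfolding sum_set_nth[OF vs(1)] ..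
  also have "\<dots> = (\<Sum>u\<in>?V. \<Sum>v\<in>?V. f u * f v + (\<Sum>B\<in>P. (c B u * f u) * (c B v * f v)))"
    by (intro sum.cong refl) (simp add: M distrib_left distrib_right sum_distrib_left
        sum_distrib_right mult_ac)
  also have "\<dots> = (\<Sum>u\<in>?V. f u)\<^sup>2 + (\<Sum>B\<in>P. (\<Sum>u\<in>?V. c B u * f u)\<^sup>2)"
  proof -
    have "(\<Sum>u\<in>?V. \<Sum>v\<in>?V. \<Sum>B\<in>P. (c B u * f u) * (c B v * f v)) = (\<Sum>B\<in>P. \<Sum>u\<in>?V. \<Sum>v\<in>?V. (c B u * f
        u) * (c B v * f v))"
      by (subst (2) sum.swap, subst sum.swap) rule
    then show ?thesis by (simp add: sum.distrib power2_eq_square sum_product)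
  qed
  also have "0 \<le> \<dots>" by (intro add_nonneg_nonneg sum_nonneg) auto
  finally show "0 \<le> qform (length vs) (modified_dist vs E) x" .
qed

text \<open>The parts are the fibres of the first projection of the blowup. That there are at least
  two of them uses that a connected graph with two vertices has an edge.\<close>

lemma complete_multipartite_iff_blowup_of_complete_graph:
  assumes G: "simple_connected_graph V E" and V: "2 \<le> card V"
  shows "blowup_of_complete_graph V E \<longleftrightarrow> complete_multipartite V E"
proof
  assume "blowup_of_complete_graph V E"
  then obtain r n f where f: "bij_betw f V (set (blowup_vertices [0..<r] n))"
    and E: "\<forall>u\<in>V. \<forall>w\<in>V. (u, w) \<in> E \<longleftrightarrow> (f u, f w) \<in> blowup_edges (complete_edges r) n"
    unfolding blowup_of_complete_graph_def graph_iso_def by blast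
  have fV: "fst (f u) < r" "snd (f u) < n (fst (f u))" if "u \<in> V" for u
    using bij_betw_apply[OF f that] by (auto simp: set_blowup_vertices)
  have E': "(u, w) \<in> E \<longleftrightarrow> fst (f u) \<noteq> fst (f w)" if "u \<in> V" "w \<in> V" for u w
    using E that fV[OF that(1)] fV[OF that(2)]
    by (cases "f u"; cases "f w") (auto simp: blowup_edges_def complete_edges_def)
  show "complete_multipartite V E"
  proof (rule complete_multipartite_if_equiv)
    show "equiv V {(u, w). u \<in> V \<and> w \<in> V \<and> fst (f u) = fst (f w)}"
      unfolding equiv_def refl_on_def sym_def trans_def by auto
  qed (simp add: E')
next
  assume "complete_multipartite V E"
  then obtain P where P: "partition_on V P" and E: "\<forall>u\<in>V. \<forall>w\<in>V. (u, w) \<in> E \<longleftrightarrow> \<not> (\<exists>B\<in>P. u \<in> B \<and> w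
      \<in> B)"
    unfolding complete_multipartite_def by blast
  have finV: "finite V" using simple_connected_graphD(1)[OF G] .
  have finP: "finite P" by (rule finite_elements[OF finV P])
  define r where "r = card P"
  obtain g where g: "bij_betw g {0..<r} P"
    using ex_bij_betw_nat_finite[OF finP] unfolding r_def by blast
  define n where "n i = card (g i)" for i
  have gP: "g i \<in> P" if "i < r" for i using bij_betw_apply[OF g, of i] that by simp
  have gi: "finite (g i)" "g i \<noteq> {}" "g i \<subseteq> V" if "i < r" for i
    using gP[OF that] P finV partition_onD1[OF P] partition_onD3[OF P] by (auto intro:
        finite_subset)
  have "\<forall>i. \<exists>h. i < r \<longrightarrow> bij_betw h (g i) {0..<n i}"
    using ex_bij_betw_finite_nat gi(1) unfolding n_def by blast
  then obtain h where h: "\<And>i. i < r \<Longrightarrow> bij_betw (h i) (g i) {0..<n i}" by metis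
  have same: "i = j" if "i < r" "j < r" "v \<in> g i" "v \<in> g j" for i j v
  proof -
    have "g i = g j" using gP[OF that(1)] gP[OF that(2)] that partition_onD2[OF P] by (auto
        simp: disjoint_def)
    then show ?thesis using g that by (auto simp: bij_betw_def inj_on_def)
  qed
  have ex: "\<exists>i<r. v \<in> g i" if v: "v \<in> V" for v
  proof -
    obtain B where "B \<in> P" "v \<in> B" using v partition_onD1[OF P] by blast
    then show ?thesis using g by (auto simp: bij_betw_def image_iff)
  qed
  define idx where "idx v = (THE i. i < r \<and> v \<in> g i)" for v
  have idx_eq: "idx v = i" if "i < r" "v \<in> g i" for v i
    unfolding idx_def using that same by blast
  have idx: "idx v < r" "v \<in> g (idx v)" if "v \<in> V" for v
    using ex[OF that] idx_eq by auto
  define f where "f v = (idx v, h (idx v) v)" for v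
  have "f ` V = set (blowup_vertices [0..<r] n)"
  proof
    show "f ` V \<subseteq> set (blowup_vertices [0..<r] n)"
    proof
      fix p assume "p \<in> f ` V"
      then obtain v where v: "v \<in> V" "p = f v" by blast
      then have "h (idx v) v \<in> {0..<n (idx v)}" using bij_betw_apply[OF h idx(2)] idx(1) by blast
      then show "p \<in> set (blowup_vertices [0..<r] n)"
        using v idx(1) by (simp add: f_def set_blowup_vertices)
    qed
    show "set (blowup_vertices [0..<r] n) \<subseteq> f ` V"
    proof
      fix p assume "p \<in> set (blowup_vertices [0..<r] n)"
      then obtain i a where p: "p = (i, a)" "i < r" "a < n i" by (auto simp: set_blowup_vertices)
      then have "a \<in> h i ` g i" using h[OF p(2)] by (simp add: bij_betw_def)
      then obtain v where "v \<in> g i" "a = h i v" by blast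
      then have "f v = p" "v \<in> V" using p idx_eq gi(3)[OF p(2)] by (auto simp: f_def)
      then show "p \<in> f ` V" by blast
    qed
  qed
  moreover have "inj_on f V"
  proof (rule inj_onI)
    fix u w assume uw: "u \<in> V" "w \<in> V" "f u = f w"
    then have "idx u = idx w" "h (idx u) u = h (idx u) w" by (auto simp: f_def)
    moreover have "inj_on (h (idx u)) (g (idx u))" using h[OF idx(1)[OF uw(1)]] by (simp add:
        bij_betw_def)
    ultimately show "u = w" using idx(2)[OF uw(1)] idx(2)[OF uw(2)] by (auto dest: inj_onD)
  qed
  ultimately have bij: "bij_betw f V (set (blowup_vertices [0..<r] n))" by (simp add: bij_betw_def)
  have adj: "(u, w) \<in> E \<longleftrightarrow> idx u \<noteq> idx w" if uw: "u \<in> V" "w \<in> V" for u w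
  proof -
    have "(\<exists>B\<in>P. u \<in> B \<and> w \<in> B) \<longleftrightarrow> idx u = idx w"
    proof
      assume "\<exists>B\<in>P. u \<in> B \<and> w \<in> B"
      then obtain i where "i < r" "u \<in> g i" "w \<in> g i" using g by (auto simp: bij_betw_def)
      then show "idx u = idx w" using idx_eq by simp
    next
      assume "idx u = idx w"
      then show "\<exists>B\<in>P. u \<in> B \<and> w \<in> B"
        using idx[OF uw(1)] idx[OF uw(2)] gP by (intro bexI[of _ "g (idx u)"]) auto
    qed
    then show ?thesis using E uw by blast
  qed
  have edges: "(f u, f w) \<in> blowup_edges (complete_edges r) n \<longleftrightarrow> idx u \<noteq> idx w" if uw: "u \<in> V" "w
      \<in> V" for u w
    using idx[OF uw(1)] idx[OF uw(2)] bij_betw_apply[OF h[OF idx(1)[OF uw(1)]] idx(2)[OF uw(1)]]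
      bij_betw_apply[OF h[OF idx(1)[OF uw(2)]] idx(2)[OF uw(2)]]
    by (auto simp: f_def blowup_edges_def complete_edges_def)
  have "2 \<le> r"
  proof -
    obtain v where "v \<in> V" using V by fastforce
    obtain u where "u \<in> V" "(v, u) \<in> E" using obtain_neighbour[OF G V \<open>v \<in> V\<close>] by blast
    then have "idx v \<noteq> idx u" "idx v < r" "idx u < r" using adj idx(1) \<open>v \<in> V\<close> by auto
    then show ?thesis by linarith
  qed
  moreover have "\<forall>i<r. 0 < n i" using gi by (simp add: n_def card_gt_0_iff)
  ultimately show "blowup_of_complete_graph V E"
    unfolding blowup_of_complete_graph_def graph_iso_def using bij adj edges by blast
qed

section \<open>The equivalent conditions\<close>

lemma psd_mat_fmat: "psd_mat (fmat k M) \<longleftrightarrow> symmetric_on k M \<and> psd_on k M"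
proof -
  have "(fmat k M)\<^sup>T = fmat k M \<longleftrightarrow> symmetric_on k M"
  proof
    assume T: "(fmat k M)\<^sup>T = fmat k M"
    show "symmetric_on k M"
      unfolding symmetric_on_def
    proof (intro allI impI)
      fix i j assume "i < k" "j < k"
      then show "M i j = M j i" using arg_cong[OF T, of "\<lambda>A. A $$ (i, j)"] by (simp add: fmat_def)
    qed
  qed (auto simp: fmat_def symmetric_on_def intro!: eq_matI)
  moreover have q: "v \<bullet> (fmat k M *\<^sub>v v) = qform k M (\<lambda>i. v $ i)" if "v \<in> carrier_vec k" for v
    using that by (simp add: fmat_def bform_def scalar_prod_def atLeast0LessThan
        sum_distrib_left mult.assoc)
  have "(\<forall>v\<in>carrier_vec k. 0 \<le> v \<bullet> (fmat k M *\<^sub>v v)) \<longleftrightarrow> psd_on k M"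
  proof
    assume *: "\<forall>v\<in>carrier_vec k. 0 \<le> v \<bullet> (fmat k M *\<^sub>v v)"
    show "psd_on k M"
      unfolding psd_on_def
    proof
      fix x
      have "0 \<le> vec k x \<bullet> (fmat k M *\<^sub>v vec k x)" by (rule bspec[OF *]) simp
      also have "\<dots> = qform k M (\<lambda>i. vec k x $ i)" by (rule q) simp
      also have "\<dots> = qform k M x" by (simp add: bform_def)
      finally show "0 \<le> qform k M x" .
    qed
  qed (simp add: psd_on_def q)
  ultimately show ?thesis by (simp add: psd_mat_def fmat_def)
qed

text \<open>The variable of a vertex occurs in its own column only, and there linearly.\<close>

lemma multi_affine_det_pencil:
  fixes M :: "nat \<Rightarrow> nat \<Rightarrow> 'c::comm_ring_1"
  assumes "distinct vs" "length vs = k"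
  shows "multi_affine (det (pencil k (\<lambda>i j. mconst (M i j)) 1 (\<lambda>j. mvar (vs ! j))))"
  unfolding multi_affine_def
proof (intro allI impI)
  let ?A = "pencil k (\<lambda>i j. mconst (M i j)) 1 (\<lambda>j. mvar (vs ! j)) :: ('a, 'c) mvpoly mat"
  fix m v
  assume "mcoeff (det ?A) m \<noteq> 0"
  then have m: "m \<in> keys (det ?A)" by (simp add: in_keys_iff)
  have "lookup m v \<le> (\<Sum>j<k. if vs ! j = v then 1 else 0)"
  proof (rule keys_det_graded[where R = "\<lambda>n m. lookup m v \<le> n", OF _ _ _ _ m])
    fix i j l
    assume ij: "i < k" "j < k" and l: "l \<in> keys (?A $$ (i, j))"
    have "l \<in> keys (1 :: ('a, 'c) mvpoly) \<union> keys (mvar (vs ! j) :: ('a, 'c) mvpoly)"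
      using l keys_pencil_entry[OF ij, of M 1 "\<lambda>j. mvar (vs ! j)"] by blast
    then have "l = 0 \<or> l = single (vs ! j) 1"
      by (auto simp: mvar_def)
    then show "lookup l v \<le> (if vs ! j = v then 1 else 0)"
      by (auto simp: lookup_single when_def)
  next
    fix a b :: nat and m n :: "'a \<Rightarrow>\<^sub>0 nat"
    show "lookup m v \<le> a \<Longrightarrow> lookup n v \<le> b \<Longrightarrow> lookup (m + n) v \<le> a + b"
      by (simp add: lookup_add)
  qed simp_all
  also have "(\<Sum>j<k. if vs ! j = v then 1 else 0 :: nat) = (\<Sum>u\<in>set vs. if u = v then 1 else 0)"
    unfolding sum_set_nth[OF assms(1)] assms(2) ..
  also have "\<dots> \<le> 1" by simp
  finally show "lookup m v \<le> 1" .
qed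

lemma sum_coeffs: "(\<Sum>m\<in>keys p. mcoeff p m) = meval id (\<lambda>_. 1) (p :: ('v, real) mvpoly)"
  by (simp add: meval_def)

theorem theorem2p3:
  fixes V :: "'a set" and E :: "('a \<times> 'a) set" and vs :: "'a list" and k :: nat
  assumes "simple_connected_graph V E"
    and "distinct vs" and "set vs = V"
    and "card V = k" and "2 \<le> k"
  shows
    "tfae
       [ \<comment> \<open>(1)\<close>
         real_stable (set (homogenized_vars vs)) (homogenized_blowup_poly vs E),
         \<comment> \<open>(2)\<close>
         lorentzian (homogenized_vars vs) k (homogenized_blowup_poly vs E),
         \<comment> \<open>(3)\<close>
         nonneg_coeffs (homogenized_blowup_poly vs E),
         \<comment> \<open>(4)\<close>
         (-1) ^ k * blowup_poly_at_minus_one vs E > 0 \<and>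
           strongly_rayleigh V (reflected_blowup_poly vs E),
         \<comment> \<open>(5)\<close>
         psd_mat (dist_mat vs E + 2 \<cdot>\<^sub>m 1\<^sub>m k),
         \<comment> \<open>(6), in its two phrasings\<close>
         blowup_of_complete_graph V E,
         complete_multipartite V E ]"
proof -
  let ?c = complex_of_real
  define M :: "nat \<Rightarrow> nat \<Rightarrow> real" where "M = modified_dist vs E"
  have k: "k = length vs" using assms(2-4) distinct_card by metis
  have G: "simple_connected_graph (set vs) E" and vs: "distinct vs" "2 \<le> length vs"
    using assms k by auto
  have card: "2 \<le> card V" using assms by simp
  note GD = simple_connected_graphD[OF G]
  have sym: "symmetric_on k M" unfolding M_def by (rule modified_dist_symmetric[OF GD(3)])
  have off: "M i j \<noteq> 0" if "i < k" "j < k" "i \<noteq> j" for i j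
  proof -
    have "vs ! i \<noteq> vs ! j" "vs ! i \<in> set vs" "vs ! j \<in> set vs" using that vs k by (auto simp:
        nth_eq_iff_index_eq)
    then have "graph_dist E (vs ! i) (vs ! j) \<noteq> 0"
      using relpow_graph_dist[OF GD(5), of "vs ! i" "vs ! j"] by (metis relpow_0_E)
    then show ?thesis using that by (simp add: M_def modified_dist_def)
  qed
  define Q where "Q = homogenized_blowup_poly vs E"
  have Q: "Q = det (pencil k (\<lambda>i j. mconst (M i j)) (mvar None) (\<lambda>j. mvar (Some (vs ! j))))"
    by (simp add: Q_def homogenized_blowup_poly_eq[OF G vs] M_def k)
  have evQ: "meval h z Q = det (pencil k (\<lambda>i j. h (M i j)) (z None) (\<lambda>j. z (Some (vs ! j))))"
    if "comm_ring_hom h" for h :: "real \<Rightarrow> 'd::comm_ring_1" and z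
  proof -
    interpret h: comm_ring_hom h by fact
    show ?thesis by (simp add: Q meval_det_pencil[OF that])
  qed
  define R where "R = reflected_blowup_poly vs E"
  define c where "c = det (pencil k M 1 (\<lambda>_. 1))"
  define R0 where "R0 = det (pencil k (\<lambda>i j. mconst (M i j)) 1 (\<lambda>j. mvar (vs ! j)))"
  have R: "R = mconst (1 / c) * R0"
    by (simp add: R_def R0_def c_def reflected_blowup_poly_eq[OF G vs] M_def k)
  have evR: "meval h z R = h (1 / c) * det (pencil k (\<lambda>i j. h (M i j)) 1 (\<lambda>j. z (vs ! j)))"
    if "comm_ring_hom h" for h :: "real \<Rightarrow> 'd::comm_ring_1" and z
  proof -
    interpret h: comm_ring_hom h by fact
    interpret ev: comm_ring_hom "meval h z :: ('a, real) mvpoly \<Rightarrow> 'd" by (rule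
        meval_comm_ring_hom) fact
    show ?thesis by (simp add: R R0_def ev.hom_mult meval_det_pencil[OF that])
  qed
  have at1: "(-1) ^ k * blowup_poly_at_minus_one vs E = c"
    by (simp add: blowup_poly_at_minus_one_eq[OF G vs] c_def M_def k
        power_mult_distrib[symmetric] mult.assoc[symmetric])
  have P5: "psd_mat (dist_mat vs E + 2 \<cdot>\<^sub>m 1\<^sub>m k) \<longleftrightarrow> psd_on k M"
  proof -
    have "dist_mat vs E + 2 \<cdot>\<^sub>m 1\<^sub>m k = fmat k M"
      by (rule eq_matI) (auto simp: dist_mat_def indexed_mat_def fmat_def M_def modified_dist_def k)
    then show ?thesis using sym by (simp add: psd_mat_fmat)
  qed

  have to1: "real_stable (set (homogenized_vars vs)) Q" if psd: "psd_on k M"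
    unfolding real_stable_def
  proof (intro conjI allI impI)
    show "mvars Q \<subseteq> set (homogenized_vars vs)"
      unfolding Q by (rule mvars_det_pencil) (auto simp: homogenized_vars_def k)
    fix z :: "'a option \<Rightarrow> complex"
    assume z: "\<forall>v\<in>set (homogenized_vars vs). 0 < Im (z v)"
    then have "0 < Im (z None)" "\<And>j. j < k \<Longrightarrow> 0 < Im (z (Some (vs ! j)))"
      by (auto simp: homogenized_vars_def k)
    then show "meval complex_of_real z Q \<noteq> 0"
      unfolding evQ[OF comm_ring_hom_of_real] by (intro det_pencil_nonzero[OF sym psd]) auto
  qed
  have from1: "psd_on k M" if stable: "real_stable (set (homogenized_vars vs)) Q"
  proof (rule psd_if_pencil_nonsingular[OF sym])
    fix s :: real
    assume "0 < s"
    \<comment> \<open>homogeneity turns purely imaginary arguments into positive real ones\<close>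
    define z where "z v = \<i> * ?c (case v of None \<Rightarrow> 1 | Some _ \<Rightarrow> s)" for v :: "'a option"
    have "meval ?c z Q \<noteq> 0"
      using stable \<open>0 < s\<close> by (auto simp: real_stable_def z_def split: option.split)
    moreover have "meval ?c z Q = \<i> ^ k * det (pencil k (\<lambda>i j. ?c (M i j)) (?c 1) (\<lambda>_. ?c s))"
      unfolding evQ[OF comm_ring_hom_of_real] z_def by (simp only: option.case det_pencil_scale)
    moreover have "?c (det (pencil k M 1 (\<lambda>_. s))) = det (pencil k (\<lambda>i j. ?c (M i j)) (?c 1)
        (\<lambda>_. ?c s))"
      by (rule hom_det_pencil[OF comm_ring_hom_of_real])
    ultimately show "det (pencil k M 1 (\<lambda>_. s)) \<noteq> 0" by auto
  qed
  have to2: "lorentzian (homogenized_vars vs) k Q" if psd: "psd_on k M"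
  proof -
    have dist: "distinct (homogenized_vars vs)" and len: "length (homogenized_vars vs) = Suc k"
      using vs by (simp_all add: homogenized_vars_def k distinct_map)
    have "pencil k (\<lambda>i j. mconst (M i j)) (mvar (homogenized_vars vs ! 0)) (\<lambda>j. mvar
        (homogenized_vars vs ! Suc j)) =
        (pencil k (\<lambda>i j. mconst (M i j)) (mvar None) (\<lambda>j. mvar (Some (vs ! j))) :: ('a option,
            real) mvpoly mat)"
      unfolding pencil_def by (rule fmat_cong) (simp add: homogenized_vars_def k)
    then show ?thesis
      using pencil_lorentzian[OF dist len assms(5) sym psd off] by (simp add: Q)
  qed
  have from2: "nonneg_coeffs Q" if "lorentzian (homogenized_vars vs) k Q"
    using that by (simp add: lorentzian_def)
  have from3: "psd_on k M" if nonneg: "nonneg_coeffs Q"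
  proof (rule psd_if_pencil_nonsingular[OF sym])
    fix s :: real
    assume "0 < s"
    \<comment> \<open>the \<open>k\<close>-th power of the homogenizing variable has the coefficient \<open>2 ^ k\<close>\<close>
    have "Q \<noteq> 0"
    proof
      assume "Q = 0"
      then have "meval id (\<lambda>v. case v of None \<Rightarrow> 1 | Some _ \<Rightarrow> 0) Q = (0 :: real)" by (simp add:
          meval_def)
      moreover have "pencil k M 1 (\<lambda>_. 0) = 2 \<cdot>\<^sub>m 1\<^sub>m k"
        by (rule eq_matI) (auto simp: pencil_def fmat_def)
      ultimately show False by (simp add: evQ[OF comm_ring_hom_id])
    qed
    then have "0 < meval id (\<lambda>v. case v of None \<Rightarrow> 1 | Some _ \<Rightarrow> s) Q"
      using \<open>0 < s\<close> by (intro meval_pos_if_nonneg_coeffs[OF nonneg]) (auto split: option.split)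
    then show "det (pencil k M 1 (\<lambda>_. s)) \<noteq> 0" by (simp add: evQ[OF comm_ring_hom_id])
  qed
  have to4: "0 < c \<and> strongly_rayleigh V R" if psd: "psd_on k M"
  proof
    show c: "0 < c" unfolding c_def by (rule det_pencil_pos[OF sym psd]) auto
    show "strongly_rayleigh V R"
      unfolding strongly_rayleigh_def
    proof (intro conjI)
      have keysR: "keys R \<subseteq> keys R0" unfolding R by (rule keys_mconst_mult)
      show "multi_affine R"
        using multi_affine_det_pencil[OF vs(1) k[symmetric], of M] keysR
        unfolding R0_def multi_affine_def in_keys_iff[symmetric] lookup_not_eq_zero_eq_in_keys
            by blast
      show "real_stable V R"
        unfolding real_stable_def
      proof (intro conjI allI impI)
        have "mvars (1 :: ('a, real) mvpoly) \<subseteq> V" by (simp add: mvars_def)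
        then have "mvars R0 \<subseteq> V" unfolding R0_def using assms(3) k by (intro mvars_det_pencil) auto
        then show "mvars R \<subseteq> V" using keysR unfolding mvars_def by blast
        fix z :: "'a \<Rightarrow> complex"
        assume "\<forall>v\<in>V. 0 < Im (z v)"
        then have "det (pencil k (\<lambda>i j. ?c (M i j)) 1 (\<lambda>j. z (vs ! j))) \<noteq> 0"
          using assms(3) k by (intro det_pencil_nonzero[OF sym psd]) auto
        then show "meval complex_of_real z R \<noteq> 0" using c by (simp add: evR[OF
            comm_ring_hom_of_real])
      qed
      \<comment> \<open>\<open>R\<close> is, up to a positive factor, the homogenized polynomial at \<open>z\<^sub>0 = 1\<close>\<close>
      show "nonneg_coeffs R"
      proof -
        let ?s = "\<lambda>v. case v of None \<Rightarrow> 1 :: ('a, real) mvpoly | Some u \<Rightarrow> mvar u"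
        have "nonneg_coeffs (meval mconst ?s Q)"
          using from2[OF to2[OF psd]]
          by (rule nonneg_coeffs_subst)
             (auto simp: nonneg_coeffs_def mvar_def lookup_single lookup_one when_def split:
                 option.split)
        then have "nonneg_coeffs R0" by (simp add: evQ[OF comm_ring_hom_mconst] R0_def)
        then show ?thesis
          unfolding R using c by (intro nonneg_coeffs_mult) (simp_all add: mconst_def
              nonneg_coeffs_single)
      qed
      show "(\<Sum>m\<in>keys R. mcoeff R m) = 1"
        unfolding sum_coeffs evR[OF comm_ring_hom_id] using c by (simp add: c_def)
    qed
  qed
  have from4: "psd_on k M" if c: "0 < c" and R4: "strongly_rayleigh V R"
  proof (rule psd_if_pencil_nonsingular[OF sym])
    fix s :: real
    assume "0 < s"
    have "R \<noteq> 0" using R4 by (auto simp: strongly_rayleigh_def)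
    then have "0 < meval id (\<lambda>_. s) R"
      using R4 \<open>0 < s\<close> by (intro meval_pos_if_nonneg_coeffs) (auto simp: strongly_rayleigh_def)
    then show "det (pencil k M 1 (\<lambda>_. s)) \<noteq> 0" by (auto simp: evR[OF comm_ring_hom_id])
  qed
  have mp: "psd_on k M \<longleftrightarrow> complete_multipartite V E"
    using complete_multipartite_if_psd[OF G vs(1)] psd_if_complete_multipartite[OF G vs]
    unfolding M_def k assms(3) by blast
  have bc: "blowup_of_complete_graph V E \<longleftrightarrow> complete_multipartite V E"
    by (rule complete_multipartite_iff_blowup_of_complete_graph[OF assms(1) card])

  have "real_stable (set (homogenized_vars vs)) Q \<longleftrightarrow> psd_on k M" using to1 from1 by blast
  moreover have "lorentzian (homogenized_vars vs) k Q \<longleftrightarrow> psd_on k M" using to2 from2 from3 by blast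
  moreover have "nonneg_coeffs Q \<longleftrightarrow> psd_on k M" using to2 from2 from3 by blast
  moreover have "0 < c \<and> strongly_rayleigh V R \<longleftrightarrow> psd_on k M" using to4 from4 by blast
  ultimately show ?thesis
    unfolding tfae_def at1 P5 bc mp[symmetric] Q_def[symmetric] R_def[symmetric] by simp
qed

end
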